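(* Let $\mathsf{A},\mathsf{E},\mathsf{C}$ be finite-dimensional Hilbert spaces, let $\rho_{AE}$ be a density operator on $\mathsf{A}\otimes\mathsf{E}$, and let $\mathcal{T}_{A\to C}$ be a quantum channel (completely positive trace-preserving map) with Choi state $\omega_{A'C}:=(\mathrm{id}_{A'}\otimes\mathcal{T}_{A\to C})(\Phi_{A'A})$. Then for every $\alpha\in[1,2]$, \[ \frac12\,\mathbf{E}_{U\sim\mathds{U}(\mathsf{A})}\Big\|\mathcal{T}_{A\to C}\big((U_A\otimes\mathds{1}_E)\rho_{AE}(U_A\otimes\mathds{1}_E)^\dagger\big)-\omega_C\otimes\rho_E\Big\|_1\le \exp\!\Big(\tfrac{1-\alpha}{\alpha}\big(H_\alpha^*(A'|C)_\omega+H_\alpha^*(A|E)_\rho+\log 3\big)\Big). \] Moreover, $\sup_{\alpha\in[1,2]}\frac{\alpha-1}{\alpha}\big(H_\alpha^*(A|E)_\rho+H_\alpha^*(A'|C)_\omega\big)>0$ if and only if $H(A'|C)_\omega+H(A|E)_\rho>0$.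
   Context: $\mathbf{E}_{U\sim\mathds{U}(\mathsf{A})}$ denotes integration with respect to the Haar probability measure on the unitary group of $\mathsf{A}$. $\mathsf{A}'\cong\mathsf{A}$ is a copy of $\mathsf{A}$ with $d=\dim\mathsf{A}$, and $\Phi_{A'A}=|\Phi\rangle\langle\Phi|$ with $|\Phi\rangle=d^{-1/2}\sum_i|i\rangle_{A'}|i\rangle_A$ the normalized maximally entangled state. Reduced states are denoted by dropping subsystems, e.g. $\omega_C=\mathrm{Tr}_{A'}\omega_{A'C}=\mathcal{T}(\mathds{1}_A/d)$, $\rho_E=\mathrm{Tr}_A\rho_{AE}$. All logarithms are natural. The sandwiched Rényi divergence is $D_\alpha^*(\rho\|\sigma)=\frac{1}{\alpha-1}\log\mathrm{Tr}\big[(\sigma^{\frac{1-\alpha}{2\alpha}}\rho\,\sigma^{\frac{1-\alpha}{2\alpha}})^\alpha\big]$, and the sandwiched conditional Rényi entropy is $H_\alpha^*(A|B)_\rho:=-\inf_{\sigma_B}D_\alpha^*(\rho_{AB}\|\mathds{1}_A\otimes\sigma_B)$, the infimum over density operators $\sigma_B$. At $\alpha=1$ it is the conditional von Neumann entropy $H(A|B)_\rho=-\mathrm{Tr}[\rho_{AB}(\log\rho_{AB}-\log(\mathds{1}_A\otimes\rho_B))]$ (its limit as $\alpha\to1$). $\|\cdot\|_1$ is the trace norm. *)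

theory Defs
  imports "HOL-Analysis.Analysis" "HOL-Probability.Probability"
begin

text \<open>An operator on a Hilbert space with orthonormal basis indexed by the finite type 'n
  is a matrix of type complex^'n^'n (row index first).  Tensor products of spaces
  correspond to product index types ('a \<times> 'e).\<close>

definition cadj :: "complex^'n::finite^'m::finite \<Rightarrow> complex^'m^'n" where
  "cadj M = (\<chi> i j. cnj (M$j$i))"

definition unitary_mat :: "complex^'n::finite^'n \<Rightarrow> bool" where
  "unitary_mat U \<longleftrightarrow> cadj U ** U = mat 1 \<and> U ** cadj U = mat 1"

definition psd_on :: "'i set \<Rightarrow> ('i \<Rightarrow> 'i \<Rightarrow> complex) \<Rightarrow> bool" where
  "psd_on I M \<longleftrightarrow> (\<forall>v::'i \<Rightarrow> complex.
      let q = (\<Sum>p\<in>I. \<Sum>q\<in>I. cnj (v p) * M p q * v q) in Im q = 0 \<and> Re q \<ge> 0)"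

definition psd :: "complex^'n::finite^'n \<Rightarrow> bool" where
  "psd M \<longleftrightarrow> psd_on UNIV (\<lambda>i j. M$i$j)"

definition density :: "complex^'n::finite^'n \<Rightarrow> bool" where
  "density \<rho> \<longleftrightarrow> psd \<rho> \<and> trace \<rho> = 1"

definition cdiag :: "('n::finite \<Rightarrow> real) \<Rightarrow> complex^'n^'n" where
  "cdiag l = (\<chi> i j. if i = j then complex_of_real (l i) else 0)"

definition mfun :: "(real \<Rightarrow> real) \<Rightarrow> complex^'n::finite^'n \<Rightarrow> complex^'n^'n" where
  "mfun f A = (let (U, l) = (SOME (U, l). unitary_mat U \<and> A = U ** cdiag l ** cadj U)
               in U ** cdiag (f \<circ> l) ** cadj U)"

text \<open>Powers on the support (0 stays 0, i.e. generalized inverse for negative exponents).\<close>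
definition mpow :: "real \<Rightarrow> complex^'n::finite^'n \<Rightarrow> complex^'n^'n" where
  "mpow t A = mfun (\<lambda>x. if x > 0 then x powr t else 0) A"

text \<open>Natural logarithm on the support (convention 0 log 0 = 0).\<close>
definition mlog :: "complex^'n::finite^'n \<Rightarrow> complex^'n^'n" where
  "mlog A = mfun (\<lambda>x. if x > 0 then ln x else 0) A"

definition trnorm :: "complex^'n::finite^'n \<Rightarrow> real" where
  "trnorm X = Re (trace (mfun sqrt (cadj X ** X)))"

definition kron :: "complex^'a::finite^'a \<Rightarrow> complex^'b::finite^'b \<Rightarrow> complex^('a\<times>'b)^('a\<times>'b)" where
  "kron X Y = (\<chi> p q. X$(fst p)$(fst q) * Y$(snd p)$(snd q))"

definition ptr1 :: "complex^('a::finite\<times>'b::finite)^('a\<times>'b) \<Rightarrow> complex^'b^'b" where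
  "ptr1 M = (\<chi> k l. \<Sum>i\<in>UNIV. M$(i,k)$(i,l))"

definition ptr2 :: "complex^('a::finite\<times>'b::finite)^('a\<times>'b) \<Rightarrow> complex^'a^'a" where
  "ptr2 M = (\<chi> i j. \<Sum>k\<in>UNIV. M$(i,k)$(j,k))"

definition clinear_map :: "(complex^'a::finite^'a \<Rightarrow> complex^'c::finite^'c) \<Rightarrow> bool" where
  "clinear_map T \<longleftrightarrow> (\<forall>X Y. T (X + Y) = T X + T Y) \<and>
     (\<forall>c X. T (\<chi> i j. c * X$i$j) = (\<chi> i j. c * (T X)$i$j))"

text \<open>Complete positivity: id_n \<otimes> T is positive for every ancilla dimension n
  (ancilla basis {..<n}).\<close>
definition completely_positive :: "(complex^'a::finite^'a \<Rightarrow> complex^'c::finite^'c) \<Rightarrow> bool" where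
  "completely_positive T \<longleftrightarrow> (\<forall>(n::nat) (M :: nat \<times> 'a \<Rightarrow> nat \<times> 'a \<Rightarrow> complex).
      psd_on ({..<n} \<times> UNIV) M \<longrightarrow>
      psd_on ({..<n} \<times> (UNIV :: 'c set))
        (\<lambda>p q. (T (\<chi> i j. M (fst p, i) (fst q, j)))$(snd p)$(snd q)))"

definition trace_preserving :: "(complex^'a::finite^'a \<Rightarrow> complex^'c::finite^'c) \<Rightarrow> bool" where
  "trace_preserving T \<longleftrightarrow> (\<forall>X. trace (T X) = trace X)"

definition quantum_channel :: "(complex^'a::finite^'a \<Rightarrow> complex^'c::finite^'c) \<Rightarrow> bool" where
  "quantum_channel T \<longleftrightarrow> clinear_map T \<and> completely_positive T \<and> trace_preserving T"

definition id_tensor :: "(complex^'a::finite^'a \<Rightarrow> complex^'c::finite^'c) \<Rightarrow>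
    complex^('b::finite\<times>'a)^('b\<times>'a) \<Rightarrow> complex^('b\<times>'c)^('b\<times>'c)" where
  "id_tensor T M = (\<chi> p q. (T (\<chi> i j. M$(fst p, i)$(fst q, j)))$(snd p)$(snd q))"

definition tensor_id :: "(complex^'a::finite^'a \<Rightarrow> complex^'c::finite^'c) \<Rightarrow>
    complex^('a\<times>'e::finite)^('a\<times>'e) \<Rightarrow> complex^('c\<times>'e)^('c\<times>'e)" where
  "tensor_id T M = (\<chi> p q. (T (\<chi> i j. M$(i, snd p)$(j, snd q)))$(fst p)$(fst q))"

definition max_ent :: "complex^('a::finite\<times>'a)^('a\<times>'a)" where
  "max_ent = (\<chi> p q. if fst p = snd p \<and> fst q = snd q
                      then complex_of_real (1 / real CARD('a)) else 0)"

definition choi_state :: "(complex^'a::finite^'a \<Rightarrow> complex^'c::finite^'c) \<Rightarrow> complex^('a\<times>'c)^('a\<times>'c)" where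
  "choi_state T = id_tensor T max_ent"

text \<open>Sandwiched Renyi divergence (for alpha > 1), +\<infinity> unless supp rho \<subseteq> supp sigma.\<close>
definition sandwiched_div :: "real \<Rightarrow> complex^'n::finite^'n \<Rightarrow> complex^'n^'n \<Rightarrow> ereal" where
  "sandwiched_div \<alpha> \<rho> \<sigma> =
     (if (\<forall>v. \<sigma> *v v = 0 \<longrightarrow> \<rho> *v v = 0)
      then (let s = (1 - \<alpha>) / (2 * \<alpha>) in
        ereal (1 / (\<alpha> - 1) * ln (Re (trace (mpow \<alpha> (mpow s \<sigma> ** \<rho> ** mpow s \<sigma>))))))
      else \<infinity>)"

definition cond_vN :: "complex^('x::finite\<times>'y::finite)^('x\<times>'y) \<Rightarrow> real" where
  "cond_vN \<rho> = - Re (trace (\<rho> ** (mlog \<rho> - mlog (kron (mat 1 :: complex^'x^'x) (ptr1 \<rho>)))))"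

definition cond_sandwiched :: "real \<Rightarrow> complex^('x::finite\<times>'y::finite)^('x\<times>'y) \<Rightarrow> real" where
  "cond_sandwiched \<alpha> \<rho> =
     (if \<alpha> = 1 then cond_vN \<rho>
      else - real_of_ereal (Inf {sandwiched_div \<alpha> \<rho> (kron (mat 1 :: complex^'x^'x) \<sigma>) | \<sigma>. density \<sigma>}))"

definition haar_measure :: "(complex^'n::finite^'n) measure \<Rightarrow> bool" where
  "haar_measure \<mu> \<longleftrightarrow> sets \<mu> = sets borel \<and> prob_space \<mu> \<and>
     (AE U in \<mu>. unitary_mat U) \<and>
     (\<forall>V. unitary_mat V \<longrightarrow> distr \<mu> borel (\<lambda>U. V ** U) = \<mu>)"

end

theory Submission
  imports Defs "HOL-Complex_Analysis.Conformal_Mappings"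
begin

text \<open>
  The channel acts through its Choi state \<open>\<omega>\<close>, so the deviation \<open>T (U \<rho> U\<^sup>*) - \<omega>\<^sub>C \<otimes> \<rho>\<^sub>E\<close> is bilinear in
  \<open>(\<omega>, \<rho>)\<close>. Integrated against a measurable field of contractions (trace norm duality) it has two bounds:
  \<open>2\<close> times the product of the trace norms, from the first moment of the Haar measure, and
  \<open>d / sqrt (d\<^sup>2 - 1) \<le> 2 / sqrt 3\<close> times the product of the weighted Hilbert-Schmidt norms, from the second
  moment (for \<open>d = 1\<close> the deviation vanishes). Hadamard's three lines theorem, applied to analytic families
  through \<open>\<rho>\<close> and \<open>\<omega>\<close>, interpolates these to \<open>2 * 3 powr - ((\<alpha> - 1) / \<alpha>)\<close> times the product of the
  \<open>\<alpha>\<close>-norms of the sandwiched operators.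

  For the second claim, two more applications of the three lines theorem squeeze the sandwiched divergence
  between the relative entropy and the Petz divergence, and the latter tends to the relative entropy
  as \<open>\<alpha> \<rightarrow> 1\<close>.
\<close>

section \<open>Three lines and matrix norms\<close>

text \<open>The trace norm is not analytic, so the interpolated quantity is the integral of
  \<open>trace (G U ** D U)\<close> for one frozen field \<open>G\<close> of contractions; it is
  entire in the parameter of the two families. Both edges measure the output in trace norm, only the
  norms of the inputs differ. Off the real axis the families need not be Hermitian, which is why the
  decoupling map and its bounds are set up for arbitrary matrices and for products of the form
  contraction, nonnegative diagonal, contraction.

  States \<sigma> may be singular. Powers therefore live on supports, exponent 0 gives the support
  projection, and the kernel inclusion behind a finite divergence lets the families return exactly
  \<rho> and \<omega>.

  The two directions of the second claim are uneven. The sum of the von Neumann entropies dominates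
  the sum of the sandwiched entropies at every \<alpha> > 1, which settles one direction; the other
  asks for a single good \<alpha> close to 1, and there the reduced state is a sufficient choice of
  \<sigma>.\<close>

lemma three_lines:
  fixes F :: "complex \<Rightarrow> complex"
  assumes hol: "F holomorphic_on UNIV"
    and bnd: "\<And>z. 0 \<le> Re z \<Longrightarrow> Re z \<le> 1 \<Longrightarrow> norm (F z) \<le> K"
    and M0: "M0 > 0" "\<And>z. Re z = 0 \<Longrightarrow> norm (F z) \<le> M0"
    and M1: "M1 > 0" "\<And>z. Re z = 1 \<Longrightarrow> norm (F z) \<le> M1"
    and x: "0 \<le> x" "x \<le> 1"
  shows "norm (F (of_real x)) \<le> M0 powr (1 - x) * M1 powr x"
proof -
  \<comment> \<open>The factor \<open>exp (E e z)\<close> scales both edge bounds to 1. Its term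
    with \<open>e\<close> makes the product decay as the imaginary part grows; the
    \<open>- 1\<close> in that term keeps its real part at most 0 on the strip.\<close>
  define E where "E = (\<lambda>e z. (z - 1) * of_real (ln M0) - z * of_real (ln M1) + of_real e * (z\<^sup>2 - 1) :: complex)"
  define G where "G = (\<lambda>e z. F z * exp (E e z))"
  have ReE: "Re (E e z) = (Re z - 1) * ln M0 - Re z * ln M1 + e * ((Re z)\<^sup>2 - (Im z)\<^sup>2 - 1)" for e z
    by (simp add: E_def Re_power2)
  have normG: "norm (G e z) = norm (F z) * exp (Re (E e z))" for e z
    by (simp add: G_def norm_mult)
  have K0: "K \<ge> 0" using bnd[of 0] by (smt (verit) norm_ge_zero zero_complex.simps)
  have Gle: "norm (G e (of_real x)) \<le> 1" if e: "e > 0" for e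
  proof -
    define C where "C = K * exp (\<bar>ln M0\<bar> + \<bar>ln M1\<bar>)"
    have C0: "C \<ge> 0" using K0 by (simp add: C_def)
    obtain R where R: "R > 0" "C * exp (- e * R\<^sup>2) \<le> 1"
    proof -
      \<comment> \<open>Since \<open>exp t \<ge> 1 + t\<close>, it is enough that
        \<open>e * R\<^sup>2 \<ge> C\<close>; the summand 1 only keeps \<open>R\<close>
        positive.\<close>
      define R where "R = sqrt (C / e) + 1"
      have R1: "R > 0" using C0 e by (simp add: R_def add_nonneg_pos)
      have "R\<^sup>2 \<ge> (sqrt (C/e))\<^sup>2" using C0 e by (intro power_mono) (auto simp: R_def)
      then have "R\<^sup>2 \<ge> C / e" using C0 e by simp
      then have "e * R\<^sup>2 \<ge> C" using e by (simp add: field_simps)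
      then have "exp (e * R\<^sup>2) \<ge> C" using exp_ge_add_one_self[of "e * R\<^sup>2"] by linarith
      then have "C * exp (- e * R\<^sup>2) \<le> 1" by (simp add: exp_minus field_simps)
      with R1 that show ?thesis by blast
    qed
    define S where "S = cbox (Complex 0 (-R)) (Complex 1 R)"
    have inS: "z \<in> S \<longleftrightarrow> 0 \<le> Re z \<and> Re z \<le> 1 \<and> -R \<le> Im z \<and> Im z \<le> R" for z
      by (auto simp: S_def in_cbox_complex_iff)
    have holG: "G e holomorphic_on UNIV" unfolding G_def E_def
      by (intro holomorphic_intros hol)
    show ?thesis
    proof (rule maximum_modulus_frontier[where S=S and f="G e"])
      show "G e holomorphic_on interior S" using holG holomorphic_on_subset by blast
      show "continuous_on (closure S) (G e)"
        using holG holomorphic_on_imp_continuous_on continuous_on_subset by blast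
      show "bounded S" by (simp add: S_def)
      show "of_real x \<in> S" using x R by (simp add: inS)
      fix z assume "z \<in> frontier S"
      then have z: "z \<in> S" "z \<notin> box (Complex 0 (-R)) (Complex 1 R)"
        by (auto simp: S_def frontier_def)
      then have "Re z = 0 \<or> Re z = 1 \<or> \<bar>Im z\<bar> = R"
        by (auto simp: inS in_box_complex_iff)
      then consider "Re z = 0" | "Re z = 1" | "\<bar>Im z\<bar> = R" by blast
      then show "norm (G e z) \<le> 1"
      proof cases
        case 1
        have "- (Im z)\<^sup>2 - 1 \<le> 0" using zero_le_power2[of "Im z"] by linarith
        then have "e * (- (Im z)\<^sup>2 - 1) \<le> 0" using e by (intro mult_nonneg_nonpos) auto
        then have "Re (E e z) \<le> - ln M0" using 1 by (simp add: ReE)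
        then have "norm (G e z) \<le> M0 * exp (- ln M0)"
          unfolding normG using M0 1 by (intro mult_mono) auto
        then show ?thesis using M0 by (simp add: exp_minus)
      next
        case 2
        have "Re (E e z) \<le> - ln M1" using e 2 by (simp add: ReE)
        then have "norm (G e z) \<le> M1 * exp (- ln M1)"
          unfolding normG using M1 2 by (intro mult_mono) auto
        then show ?thesis using M1 by (simp add: exp_minus)
      next
        case 3
        have r: "0 \<le> Re z" "Re z \<le> 1" using z by (auto simp: inS)
        have i: "(Im z)\<^sup>2 = R\<^sup>2" using 3 by (metis power2_abs)
        have a: "(Re z - 1) * ln M0 \<le> \<bar>ln M0\<bar>"
        proof -
          have "(Re z - 1) * ln M0 \<le> \<bar>Re z - 1\<bar> * \<bar>ln M0\<bar>" by (metis abs_ge_self abs_mult)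
          also have "\<dots> \<le> 1 * \<bar>ln M0\<bar>" using r by (intro mult_right_mono) auto
          finally show ?thesis by simp
        qed
        have b: "- (Re z * ln M1) \<le> \<bar>ln M1\<bar>"
        proof -
          have "- (Re z * ln M1) \<le> \<bar>Re z\<bar> * \<bar>ln M1\<bar>" by (metis abs_ge_minus_self abs_mult)
          also have "\<dots> \<le> 1 * \<bar>ln M1\<bar>" using r by (intro mult_right_mono) auto
          finally show ?thesis by simp
        qed
        have c: "e * ((Re z)\<^sup>2 - (Im z)\<^sup>2 - 1) \<le> - e * R\<^sup>2"
        proof -
          have "(Re z)\<^sup>2 \<le> 1" using r by (simp add: power_le_one)
          then have "e * ((Re z)\<^sup>2 - (Im z)\<^sup>2 - 1) \<le> e * (- R\<^sup>2)"
            using e i by (intro mult_left_mono) auto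
          then show ?thesis by simp
        qed
        have "norm (G e z) \<le> K * exp (\<bar>ln M0\<bar> + \<bar>ln M1\<bar> + - e * R\<^sup>2)"
          unfolding normG using bnd[OF r] a b c K0 by (intro mult_mono) (auto simp: ReE)
        also have "\<dots> = C * exp (- e * R\<^sup>2)" by (simp add: C_def exp_add mult.assoc exp_diff exp_minus field_simps)
        finally show ?thesis using R by simp
      qed
    qed
  qed
  \<comment> \<open>The bound 1 is uniform in \<open>e\<close>, so the damping can be removed at the
    fixed point \<open>x\<close>.\<close>
  have "norm (G 0 (of_real x)) \<le> 1"
  proof (rule tendsto_upperbound)
    show "((\<lambda>e. norm (G e (of_real x))) \<longlongrightarrow> norm (G 0 (of_real x))) (at_right 0)"
      unfolding G_def E_def by (intro tendsto_intros)
    show "eventually (\<lambda>e. norm (G e (of_real x)) \<le> 1) (at_right 0)"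
      using eventually_at_right_less[of "0::real"] by eventually_elim (rule Gle)
  qed simp
  then have "norm (F (of_real x)) * exp ((x - 1) * ln M0 - x * ln M1) \<le> 1"
    by (simp add: normG ReE)
  then have "norm (F (of_real x)) \<le> exp ((1 - x) * ln M0 + x * ln M1)"
    by (simp add: exp_diff exp_add field_simps exp_minus left_diff_distrib right_diff_distrib)
  then show ?thesis using M0 M1 by (simp add: powr_def exp_add)
qed


section \<open>Adjoints, the Hilbert-Schmidt norm and contractions\<close>

lemma cadj_nth [simp]: "cadj A $ i $ j = cnj (A $ j $ i)"
  by (simp add: cadj_def)

lemma matrix_mult_nth: "(A ** B) $ i $ j = (\<Sum>k\<in>UNIV. A $ i $ k * B $ k $ j)"
  by (simp add: matrix_matrix_mult_def)

lemma mat_nth [simp]: "mat c $ i $ j = (if i = j then c else 0)"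
  by (simp add: mat_def)

lemma cadj_cadj [simp]: "cadj (cadj A) = A"
  by (simp add: vec_eq_iff)

lemma cadj_mat_1 [simp]: "cadj (mat 1) = mat 1"
  by (simp add: vec_eq_iff)

lemma cadj_mult: "cadj (A ** B) = cadj B ** cadj A"
  by (simp add: vec_eq_iff matrix_mult_nth mult.commute)

text \<open>\<open>norm\<close> on a vector of vectors nests two Euclidean norms, so on matrices it
  is the Hilbert-Schmidt norm.\<close>

lemma frobenius_norm:
  fixes A :: "complex^'n::finite^'m::finite"
  shows "(norm A)\<^sup>2 = (\<Sum>i\<in>UNIV. \<Sum>j\<in>UNIV. (cmod (A $ i $ j))\<^sup>2)"
  by (simp add: norm_vec_def L2_set_def sum_nonneg)

lemma norm_vec_sq:
  fixes v :: "complex^'n::finite"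
  shows "(norm v)\<^sup>2 = (\<Sum>i\<in>UNIV. (cmod (v $ i))\<^sup>2)"
  by (simp add: norm_vec_def L2_set_def sum_nonneg)

lemma norm_cadj [simp]: "norm (cadj A) = norm A"
proof -
  have "(norm (cadj A))\<^sup>2 = (norm A)\<^sup>2"
    unfolding frobenius_norm by (subst sum.swap) simp
  then show ?thesis by simp
qed

lemma trace_mult: "trace (A ** B) = (\<Sum>i\<in>UNIV. \<Sum>j\<in>UNIV. A $ i $ j * B $ j $ i)"
  by (simp add: trace_def matrix_mult_nth)

lemma trace_comm:
  fixes A :: "complex^'n::finite^'m::finite"
  shows "trace (A ** B) = trace (B ** A)"
  unfolding trace_mult by (subst sum.swap) (simp add: mult.commute)

lemma norm_sq_trace: "complex_of_real ((norm A)\<^sup>2) = trace (A ** cadj A)"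
  unfolding frobenius_norm trace_mult of_real_sum complex_norm_square by simp

lemma norm_trace_mult_le:
  fixes A :: "complex^'n::finite^'m::finite"
  shows "cmod (trace (A ** B)) \<le> norm A * norm B"
proof -
  have "cmod (trace (A ** B)) \<le> (\<Sum>i\<in>UNIV. \<Sum>j\<in>UNIV. cmod (A $ i $ j) * cmod (cadj B $ i $ j))"
    unfolding trace_mult by (rule sum_norm_le, rule sum_norm_le) (simp add: norm_mult)
  also have "\<dots> \<le> (\<Sum>i\<in>UNIV. norm (A $ i) * norm (cadj B $ i))"
  proof (rule sum_mono)
    fix i
    show "(\<Sum>j\<in>UNIV. cmod (A $ i $ j) * cmod (cadj B $ i $ j)) \<le> norm (A $ i) * norm (cadj B $ i)"
      using L2_set_mult_ineq[of "\<lambda>j. cmod (A $ i $ j)" "\<lambda>j. cmod (cadj B $ i $ j)" UNIV]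
      by (simp add: norm_vec_def)
  qed
  also have "\<dots> \<le> norm A * norm (cadj B)"
    using L2_set_mult_ineq[of "\<lambda>i. norm (A $ i)" "\<lambda>i. norm (cadj B $ i)" UNIV]
    by (simp add: norm_vec_def[of A] norm_vec_def[of "cadj B"] del: norm_cadj)
  finally show ?thesis by simp
qed

text \<open>The dot product is real, namely the real part of the Hermitian form; it yields the same
  norms, and Cauchy-Schwarz is applied to it.\<close>

lemma inner_cadj:
  fixes A :: "complex^'n::finite^'m::finite"
  shows "(A *v x) \<bullet> y = x \<bullet> (cadj A *v y)"
proof -
  have "(A *v x) \<bullet> y = Re (\<Sum>i\<in>UNIV. \<Sum>j\<in>UNIV. A $ i $ j * x $ j * cnj (y $ i))"
    by (simp add: inner_vec_def matrix_vector_mult_def inner_complex_def sum_distrib_right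
        sum_distrib_left ring_distribs sum.distrib sum_negf sum_subtractf)
  also have "\<dots> = Re (\<Sum>j\<in>UNIV. \<Sum>i\<in>UNIV. A $ i $ j * x $ j * cnj (y $ i))"
    by (subst sum.swap) simp
  also have "\<dots> = x \<bullet> (cadj A *v y)"
    by (simp add: inner_vec_def matrix_vector_mult_def inner_complex_def sum_distrib_right
        sum_distrib_left ring_distribs sum.distrib sum_negf sum_subtractf algebra_simps)
  finally show ?thesis .
qed

text \<open>Operator norm at most 1 in pointwise form: the unit ball dual to the trace norm.\<close>

definition contraction :: "complex^'n::finite^'m::finite \<Rightarrow> bool" where
  "contraction A \<longleftrightarrow> (\<forall>x. norm (A *v x) \<le> norm x)"

lemma contraction_mult: "contraction A \<Longrightarrow> contraction B \<Longrightarrow> contraction (A ** B)"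
  unfolding contraction_def matrix_vector_mul_assoc[symmetric] using order_trans by blast

lemma contraction_cadj:
  assumes "contraction A" shows "contraction (cadj A)"
  unfolding contraction_def
proof
  fix x
  have "(norm (cadj A *v x))\<^sup>2 = (A *v (cadj A *v x)) \<bullet> x"
    by (simp add: inner_cadj power2_norm_eq_inner)
  also have "\<dots> \<le> norm (A *v (cadj A *v x)) * norm x"
    by (rule norm_cauchy_schwarz)
  also have "\<dots> \<le> norm (cadj A *v x) * norm x"
    using assms by (intro mult_right_mono) (auto simp: contraction_def)
  finally show "norm (cadj A *v x) \<le> norm x"
    by (cases "norm (cadj A *v x) = 0") (auto simp: power2_eq_square)
qed

text \<open>The squared norm of \<open>cadj A *v x\<close> is the value at \<open>x\<close> of the
  form of \<open>A ** cadj A\<close>; this is one half of the identity between the norm of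
  \<open>A ** cadj A\<close> and the squared norm of \<open>A\<close>.\<close>

lemma contraction_of_gram:
  assumes "contraction (A ** cadj A)" shows "contraction A"
proof -
  have "norm (cadj A *v x) \<le> norm x" for x
  proof -
    have "(norm (cadj A *v x))\<^sup>2 = ((A ** cadj A) *v x) \<bullet> x"
      by (simp add: inner_cadj power2_norm_eq_inner flip: matrix_vector_mul_assoc)
    also have "\<dots> \<le> norm ((A ** cadj A) *v x) * norm x"
      by (rule norm_cauchy_schwarz)
    also have "\<dots> \<le> norm x * norm x"
      using assms by (intro mult_right_mono) (auto simp: contraction_def)
    finally have "(norm (cadj A *v x))\<^sup>2 \<le> (norm x)\<^sup>2" by (simp add: power2_eq_square)
    then show ?thesis by (rule power2_le_imp_le) simp
  qed
  then have "contraction (cadj A)" by (simp add: contraction_def)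
  from contraction_cadj[OF this] show ?thesis by simp
qed

lemma contraction_mat_1 [simp]: "contraction (mat 1)"
  by (simp add: contraction_def)

lemma unitary_contraction: "unitary_mat U \<Longrightarrow> contraction U"
  by (rule contraction_of_gram) (simp add: unitary_mat_def)

text \<open>The squared Hilbert-Schmidt norm is the sum of the squared norms of the columns, and
  \<open>A\<close> shrinks each column.\<close>

lemma norm_contraction_mult:
  fixes A :: "complex^'n::finite^'m::finite" and B :: "complex^'k::finite^'n"
  assumes "contraction A" shows "norm (A ** B) \<le> norm B"
proof -
  have c: "(norm C)\<^sup>2 = (\<Sum>j\<in>UNIV. (norm (\<chi> i. C $ i $ j))\<^sup>2)"
    for C :: "complex^'k^'l::finite"
    unfolding frobenius_norm norm_vec_sq by (subst sum.swap) simp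
  have "(\<chi> i. (A ** B) $ i $ j) = A *v (\<chi> i. B $ i $ j)" for j
    by (simp add: vec_eq_iff matrix_mult_nth matrix_vector_mult_def)
  then have "(norm (A ** B))\<^sup>2 \<le> (norm B)\<^sup>2"
    unfolding c using assms by (auto intro!: sum_mono power_mono simp: contraction_def)
  then show ?thesis by (rule power2_le_imp_le) simp
qed

lemma norm_mult_contraction:
  assumes "contraction B" shows "norm (A ** B) \<le> norm A"
  using norm_contraction_mult[OF contraction_cadj[OF assms], of "cadj A"]
  by (metis cadj_mult norm_cadj)

lemma contraction_col:
  fixes A :: "complex^'n::finite^'m::finite"
  assumes "contraction A" shows "(\<Sum>i\<in>UNIV. (cmod (A $ i $ j))\<^sup>2) \<le> 1"
proof -
  have "A *v axis j 1 = (\<chi> i. A $ i $ j)"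
    by (simp add: vec_eq_iff matrix_vector_mult_def axis_def if_distrib cong: if_cong)
  moreover have "norm (A *v axis j 1) \<le> norm (axis j (1::complex) :: complex^'n)"
    using assms unfolding contraction_def by blast
  ultimately have "(norm (\<chi> i. A $ i $ j))\<^sup>2 \<le> 1"
    by (simp add: norm_axis_1 power_le_one)
  then show ?thesis by (simp add: norm_vec_sq)
qed

lemma contraction_row:
  fixes A :: "complex^'n::finite^'m::finite"
  assumes "contraction A" shows "(\<Sum>j\<in>UNIV. (cmod (A $ i $ j))\<^sup>2) \<le> 1"
  using contraction_col[OF contraction_cadj[OF assms], of i] by simp

lemma contraction_entry:
  assumes "contraction A" shows "cmod (A $ i $ j) \<le> 1"
proof -
  have "(cmod (A $ i $ j))\<^sup>2 \<le> (\<Sum>i\<in>UNIV. (cmod (A $ i $ j))\<^sup>2)"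
    by (rule member_le_sum) auto
  then have "(cmod (A $ i $ j))\<^sup>2 \<le> 1\<^sup>2" using contraction_col[OF assms, of j] by simp
  then show ?thesis by (rule power2_le_imp_le) simp
qed

lemma unitary_col:
  "unitary_mat U \<Longrightarrow> (\<Sum>i\<in>UNIV. (cmod (U $ i $ j))\<^sup>2) = 1"
proof -
  assume "unitary_mat U"
  then have "(cadj U ** U) $ j $ j = 1" by (simp add: unitary_mat_def)
  then have "complex_of_real (\<Sum>i\<in>UNIV. (cmod (U $ i $ j))\<^sup>2) = 1"
    by (simp add: matrix_mult_nth complex_norm_square mult.commute del: of_real_power)
  then show ?thesis using of_real_eq_1_iff by blast
qed

lemma unitary_cadj: "unitary_mat U \<Longrightarrow> unitary_mat (cadj U)"
  by (simp add: unitary_mat_def)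

lemma unitary_row:
  "unitary_mat U \<Longrightarrow> (\<Sum>j\<in>UNIV. (cmod (U $ i $ j))\<^sup>2) = 1"
  using unitary_col[OF unitary_cadj, of U i] by simp

lemma unitary_mult:
  assumes "unitary_mat U" "unitary_mat V" shows "unitary_mat (U ** V)"
proof -
  have "cadj V ** (cadj U ** U) ** V = mat 1" "U ** (V ** cadj V) ** cadj U = mat 1"
    using assms by (simp_all add: unitary_mat_def)
  then show ?thesis by (simp add: unitary_mat_def cadj_mult matrix_mul_assoc)
qed

lemma unitary_if_left_inverse: "cadj U ** U = mat 1 \<Longrightarrow> unitary_mat (U :: complex^'n::finite^'n)"
  unfolding unitary_mat_def by (metis matrix_left_right_inverse)

section \<open>Spectral theorem\<close>

definition diag_mat :: "('n::finite \<Rightarrow> complex) \<Rightarrow> complex^'n^'n" where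
  "diag_mat g = (\<chi> i j. if i = j then g i else 0)"

text \<open>\<open>mfun\<close> picks a diagonalization by choice and takes real functions. Fixing
  the eigenbasis \<open>U\<close> and allowing complex values \<open>g\<close> gives a calculus in
  which complex powers can be multiplied and differentiated.\<close>

definition spectral :: "complex^'n::finite^'n \<Rightarrow> ('n \<Rightarrow> complex) \<Rightarrow> complex^'n^'n" where
  "spectral U g = U ** diag_mat g ** cadj U"

lemma diag_mat_nth: "diag_mat g $ i $ j = (if i = j then g i else 0)"
  by (simp add: diag_mat_def)

lemma cdiag_eq_diag_mat: "cdiag l = diag_mat (\<lambda>i. of_real (l i))"
  by (simp add: cdiag_def diag_mat_def)

lemma mult_diag_mat_nth: "(A ** diag_mat g) $ i $ j = A $ i $ j * g j"
  by (simp add: matrix_mult_nth diag_mat_nth if_distrib cong: if_cong)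

lemma diag_mat_mult_nth: "(diag_mat g ** A) $ i $ j = g i * A $ i $ j"
proof -
  have "(diag_mat g ** A) $ i $ j = (\<Sum>k\<in>UNIV. if i = k then g i * A $ k $ j else 0)"
    unfolding matrix_mult_nth diag_mat_nth by (rule sum.cong) auto
  then show ?thesis by simp
qed

lemma diag_mat_mult: "diag_mat g ** diag_mat h = diag_mat (\<lambda>i. g i * h i)"
  by (simp add: vec_eq_iff mult_diag_mat_nth) (simp add: diag_mat_nth)

lemma diag_mat_one: "diag_mat (\<lambda>_. 1) = mat 1"
  by (simp add: vec_eq_iff diag_mat_nth)

lemma cadj_diag_mat: "cadj (diag_mat g) = diag_mat (\<lambda>i. cnj (g i))"
  by (auto simp: vec_eq_iff diag_mat_nth)

lemma spectral_nth: "spectral U g $ i $ j = (\<Sum>k\<in>UNIV. U $ i $ k * g k * cnj (U $ j $ k))"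
  by (simp add: spectral_def matrix_mult_nth mult_diag_mat_nth) (simp add: matrix_mult_nth[symmetric] mult_diag_mat_nth)

lemma cadj_spectral: "cadj (spectral U g) = spectral U (\<lambda>i. cnj (g i))"
  by (simp add: spectral_def cadj_mult cadj_diag_mat matrix_mul_assoc)

lemma spectral_one: "unitary_mat U \<Longrightarrow> spectral U (\<lambda>_. 1) = mat 1"
  by (simp add: spectral_def diag_mat_one unitary_mat_def)

lemma spectral_mult:
  assumes "unitary_mat U" shows "spectral U g ** spectral U h = spectral U (\<lambda>i. g i * h i)"
proof -
  have "spectral U g ** spectral U h = U ** diag_mat g ** (cadj U ** U) ** diag_mat h ** cadj U"
    by (simp add: spectral_def matrix_mul_assoc)
  also have "\<dots> = U ** (diag_mat g ** diag_mat h) ** cadj U"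
    using assms by (simp add: unitary_mat_def matrix_mul_assoc)
  finally show ?thesis by (simp add: diag_mat_mult spectral_def)
qed

lemma trace_diag_mat: "trace (diag_mat g) = (\<Sum>i\<in>UNIV. g i)"
  by (simp add: trace_def diag_mat_nth)

lemma trace_spectral:
  assumes "unitary_mat U" shows "trace (spectral U g) = (\<Sum>i\<in>UNIV. g i)"
  unfolding spectral_def by (subst trace_comm)
    (use assms in \<open>simp add: matrix_mul_assoc unitary_mat_def trace_diag_mat\<close>)

lemma norm_unitary_mult:
  assumes "unitary_mat U" shows "norm (U ** A) = norm A"
proof (rule antisym)
  show "norm (U ** A) \<le> norm A" by (intro norm_contraction_mult unitary_contraction assms)
  have "norm A = norm (cadj U ** (U ** A))" using assms by (simp add: matrix_mul_assoc unitary_mat_def)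
  also have "\<dots> \<le> norm (U ** A)" by (intro norm_contraction_mult unitary_contraction unitary_cadj assms)
  finally show "norm A \<le> norm (U ** A)" .
qed

lemma norm_mult_unitary:
  assumes "unitary_mat U" shows "norm (A ** U) = norm A"
  using norm_unitary_mult[OF unitary_cadj[OF assms], of "cadj A"] by (metis cadj_mult norm_cadj)

lemma norm_diag_mat_sq: "(norm (diag_mat g))\<^sup>2 = (\<Sum>i\<in>UNIV. (cmod (g i))\<^sup>2)"
  unfolding frobenius_norm by (simp add: diag_mat_nth if_distrib[of cmod] if_distrib[of "\<lambda>x. x\<^sup>2"] cong: if_cong)

lemma norm_spectral_sq:
  assumes "unitary_mat U" shows "(norm (spectral U g))\<^sup>2 = (\<Sum>i\<in>UNIV. (cmod (g i))\<^sup>2)"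
  using assms by (simp add: spectral_def norm_mult_unitary norm_unitary_mult unitary_cadj norm_diag_mat_sq)

lemma contraction_diag_mat:
  assumes "\<And>i. cmod (g i) \<le> 1" shows "contraction (diag_mat g)"
  unfolding contraction_def
proof
  fix x
  have "diag_mat g *v x = (\<chi> i. g i * x $ i)"
  proof -
    have "(diag_mat g *v x) $ i = (\<Sum>k\<in>UNIV. if i = k then g i * x $ k else 0)" for i
      unfolding matrix_vector_mult_def diag_mat_nth vec_lambda_beta by (rule sum.cong) auto
    then show ?thesis by (simp add: vec_eq_iff)
  qed
  then have "(norm (diag_mat g *v x))\<^sup>2 \<le> (norm x)\<^sup>2"
    unfolding norm_vec_sq using assms
    by (auto intro!: sum_mono power_mono simp: norm_mult mult_left_le_one_le)
  then show "norm (diag_mat g *v x) \<le> norm x" by (rule power2_le_imp_le) simp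
qed

lemma contraction_spectral:
  assumes "unitary_mat U" "\<And>i. cmod (g i) \<le> 1" shows "contraction (spectral U g)"
  unfolding spectral_def using assms
  by (intro contraction_mult contraction_diag_mat unitary_contraction unitary_cadj)

text \<open>Both sides intertwine: \<open>W = V\<^sup>* U\<close> satisfies \<open>W i j * l j = m i * W i j\<close>,
  an entrywise condition that survives applying \<open>f\<close>.\<close>

lemma spectral_fun_eq:
  assumes U: "unitary_mat U" and V: "unitary_mat V"
    and eq: "spectral U (\<lambda>i. of_real (l i)) = spectral V (\<lambda>i. of_real (m i))"
  shows "spectral U (\<lambda>i. f (l i)) = spectral V (\<lambda>i. f (m i))"
proof -
  define W where "W = cadj V ** U"
  have VU: "cadj V ** spectral U g ** U = W ** diag_mat g" for g
  proof -
    have "cadj V ** spectral U g ** U = W ** diag_mat g ** (cadj U ** U)"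
      by (simp add: W_def spectral_def matrix_mul_assoc)
    then show ?thesis using U by (simp add: unitary_mat_def)
  qed
  have VV: "cadj V ** spectral V g ** U = diag_mat g ** W" for g
  proof -
    have "cadj V ** spectral V g ** U = (cadj V ** V) ** diag_mat g ** W"
      by (simp add: W_def spectral_def matrix_mul_assoc)
    then show ?thesis using V by (simp add: unitary_mat_def)
  qed
  have "W ** diag_mat (\<lambda>i. of_real (l i)) = diag_mat (\<lambda>i. of_real (m i)) ** W"
    by (metis VU VV eq)
  then have "W $ i $ j * of_real (l j) = of_real (m i) * W $ i $ j" for i j
    by (metis diag_mat_mult_nth mult_diag_mat_nth)
  then have "W $ i $ j = 0 \<or> l j = m i" for i j
    by (metis mult.commute mult_cancel_right of_real_eq_iff)
  then have "W ** diag_mat (\<lambda>i. f (l i)) = diag_mat (\<lambda>i. f (m i)) ** W"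
    unfolding vec_eq_iff diag_mat_mult_nth mult_diag_mat_nth by (metis mult.commute mult_zero_right)
  then have "cadj V ** spectral U (\<lambda>i. f (l i)) ** U = cadj V ** spectral V (\<lambda>i. f (m i)) ** U"
    by (simp add: VU VV)
  then have "(V ** cadj V) ** spectral U (\<lambda>i. f (l i)) ** (U ** cadj U)
      = (V ** cadj V) ** spectral V (\<lambda>i. f (m i)) ** (U ** cadj U)"
    by (metis matrix_mul_assoc)
  then show ?thesis using U V by (simp add: unitary_mat_def)
qed

text \<open>The choice inside \<open>mfun\<close> does no harm: whichever diagonalization it
  returns, \<open>spectral_fun_eq\<close> carries the result over to the given one.\<close>

lemma mfun_spectral:
  assumes "unitary_mat U" "A = spectral U (\<lambda>i. of_real (l i))"
  shows "mfun f A = spectral U (\<lambda>i. of_real (f (l i)))"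
proof -
  define p where "p = (SOME (U, l). unitary_mat U \<and> A = U ** cdiag l ** cadj U)"
  have "\<exists>p. (\<lambda>(U, l). unitary_mat U \<and> A = U ** cdiag l ** cadj U) p"
    using assms by (auto simp: spectral_def cdiag_eq_diag_mat)
  then have "(\<lambda>(U, l). unitary_mat U \<and> A = U ** cdiag l ** cadj U) p"
    unfolding p_def by (rule someI_ex)
  moreover obtain V m where p: "p = (V, m)" by (cases p)
  ultimately have V: "unitary_mat V" "A = spectral V (\<lambda>i. of_real (m i))"
    by (auto simp: spectral_def cdiag_eq_diag_mat)
  have "mfun f A = spectral V (\<lambda>i. of_real (f (m i)))"
    unfolding mfun_def p_def[symmetric] p by (simp add: spectral_def cdiag_eq_diag_mat o_def)
  also have "\<dots> = spectral U (\<lambda>i. of_real (f (l i)))"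
    using spectral_fun_eq[OF V(1) assms(1), of m l "\<lambda>x. of_real (f x)"] V(2) assms(2) by simp
  finally show ?thesis .
qed

section \<open>Compactness of the unitary group and diagonalization of Hermitian matrices\<close>

lemma continuous_on_matrix_entry [continuous_intros]:
  fixes f :: "'z::topological_space \<Rightarrow> complex^'n::finite^'m::finite"
  assumes "continuous_on S f" shows "continuous_on S (\<lambda>x. f x $ i $ j)"
  by (intro continuous_intros assms)

lemma continuous_on_matrixI:
  fixes f :: "'z::topological_space \<Rightarrow> complex^'n::finite^'m::finite"
  assumes "\<And>i j. continuous_on S (\<lambda>x. f x $ i $ j)"
  shows "continuous_on S f"
proof -
  have "continuous_on S (\<lambda>x. \<chi> i j. f x $ i $ j)"
    by (intro continuous_on_vec_lambda assms)
  then show ?thesis by simp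
qed

text \<open>Closed as the fibre of \<open>cadj U ** U\<close> over the identity, bounded because
  every unitary has the norm of the identity. Compactness supplies the maximizer in the spectral
  theorem and makes continuous functions integrable for the Haar measure.\<close>

lemma compact_unitary: "compact {U :: complex^'n::finite^'n. unitary_mat U}"
proof -
  have "continuous_on UNIV (\<lambda>U :: complex^'n^'n. cadj U ** U)"
    by (rule continuous_on_matrixI) (simp add: matrix_mult_nth, intro continuous_intros)
  then have "closed ((\<lambda>U :: complex^'n^'n. cadj U ** U) -` {mat 1})"
    by (intro closed_vimage) auto
  moreover have "(\<lambda>U :: complex^'n^'n. cadj U ** U) -` {mat 1} = {U. unitary_mat U}"
    using unitary_if_left_inverse by (auto simp: unitary_mat_def)
  ultimately have "closed {U :: complex^'n^'n. unitary_mat U}" by simp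
  moreover have "bounded {U :: complex^'n^'n. unitary_mat U}"
    unfolding bounded_iff
  proof (intro exI ballI)
    fix U :: "complex^'n^'n" assume "U \<in> {U. unitary_mat U}"
    then have "norm U = norm (mat 1 :: complex^'n^'n)"
      using norm_unitary_mult[of U "mat 1"] by simp
    then show "norm U \<le> norm (mat 1 :: complex^'n^'n)" by simp
  qed
  ultimately show ?thesis by (simp add: compact_eq_bounded_closed)
qed

text \<open>A complex rotation in the plane of coordinates i and j, with columns
  \<open>(c, s u)\<close> and \<open>(- s cnj u, c)\<close>, and the identity elsewhere. Writing the
  entries as sums of conditionals makes sums over \<open>k\<close> collapse; the phase
  \<open>u\<close> gives access to both the real and the imaginary part of an entry.\<close>

definition rot :: "'n::finite \<Rightarrow> 'n \<Rightarrow> complex \<Rightarrow> real \<Rightarrow> real \<Rightarrow> complex^'n^'n" where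
  "rot i j u c s = (\<chi> k b. if b = i then (if k = i then of_real c else 0) + (if k = j then of_real s * u else 0)
     else if b = j then (if k = i then - of_real s * cnj u else 0) + (if k = j then of_real c else 0)
     else if k = b then 1 else 0)"

lemma rot_sum:
  assumes "i \<noteq> j"
  shows "(\<Sum>k\<in>UNIV. cnj (rot i j u c s $ k $ a) * x k) =
    (if a = i then of_real c * x i + of_real s * cnj u * x j
     else if a = j then - of_real s * u * x i + of_real c * x j else x a)"
proof -
  have d: "(\<Sum>k\<in>UNIV. (if k = i then \<alpha> else 0) * x k + (if k = j then \<beta> else 0) * x k) = \<alpha> * x i + \<beta> * x j"
    for \<alpha> \<beta> by (simp add: sum.distrib if_distrib[of "\<lambda>y. y * _"] cong: if_cong)
  have e: "(\<Sum>k\<in>UNIV. (if k = a then 1 else 0) * x k) = x a"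
    by (simp add: if_distrib[of "\<lambda>y. y * _"] cong: if_cong)
  consider "a = i" | "a \<noteq> i" "a = j" | "a \<noteq> i" "a \<noteq> j" by blast
  then show ?thesis
  proof cases
    case 1
    then show ?thesis using d[of "of_real c" "of_real s * cnj u"]
      by (simp add: rot_def if_distrib[of cnj] ring_distribs cong: if_cong)
  next
    case 2
    then show ?thesis using d[of "- of_real s * u" "of_real c"]
      by (simp add: rot_def if_distrib[of cnj] ring_distribs cong: if_cong)
  next
    case 3
    then show ?thesis using e by (simp add: rot_def if_distrib[of cnj] cong: if_cong)
  qed
qed

lemma rot_unitary:
  assumes "i \<noteq> j" "cmod u = 1" "c\<^sup>2 + s\<^sup>2 = 1"
  shows "unitary_mat (rot i j u c s)"
proof (rule unitary_if_left_inverse)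
  have uu: "u * cnj u = 1" using assms(2) by (simp add: complex_norm_square[symmetric])
  then have uu': "cnj u * (u * z) = z" "u * (cnj u * z) = z" for z
    by (simp_all add: mult.assoc[symmetric] mult.commute)
  have cs: "of_real c * of_real c + of_real s * of_real s = (1::complex)"
    using assms(3) by (metis of_real_1 of_real_add of_real_mult power2_eq_square)
  have "(cadj (rot i j u c s) ** rot i j u c s) $ a $ b = mat 1 $ a $ b" for a b
    unfolding matrix_mult_nth cadj_nth rot_sum[OF assms(1)]
    using assms(1) cs by (auto simp: rot_def algebra_simps uu uu')
  then show "cadj (rot i j u c s) ** rot i j u c s = mat 1" by (simp add: vec_eq_iff)
qed

lemma rot_conj_diag:
  assumes ij: "i \<noteq> j" and u: "cmod u = 1" and h: "cadj B = B"
  shows "Re ((cadj (rot i j u c s) ** B ** rot i j u c s) $ a $ a) =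
    (if a = i then c\<^sup>2 * Re (B $ i $ i) + s\<^sup>2 * Re (B $ j $ j) + 2 * c * s * Re (u * B $ i $ j)
     else if a = j then s\<^sup>2 * Re (B $ i $ i) + c\<^sup>2 * Re (B $ j $ j) - 2 * c * s * Re (u * B $ i $ j)
     else Re (B $ a $ a))"
proof -
  let ?R = "rot i j u c s"
  have sym: "B $ q $ p = cnj (B $ p $ q)" for p q using h by (metis cadj_nth)
  have uu: "(Re u)\<^sup>2 + (Im u)\<^sup>2 = 1" using u by (simp add: cmod_def)
  have BR: "(B ** ?R) $ k $ a = cnj (\<Sum>l\<in>UNIV. cnj (?R $ l $ a) * cnj (B $ k $ l))" for k a
    by (simp add: matrix_mult_nth mult.commute)
  have e: "(cadj ?R ** B ** ?R) $ a $ a = (\<Sum>k\<in>UNIV. cnj (?R $ k $ a) * (B ** ?R) $ k $ a)"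
    by (simp add: matrix_mul_assoc[symmetric] matrix_mult_nth[of "cadj ?R"])
  have im: "Im (B $ p $ p) = 0" for p using arg_cong[OF sym[of p p], of Im] by simp
  have ux: "x * (Re u)\<^sup>2 + x * (Im u)\<^sup>2 = x" for x using uu by (simp add: distrib_left[symmetric])
  show ?thesis
    unfolding e BR rot_sum[OF ij] using ij ux[of "s\<^sup>2 * Re (B $ j $ j)"] ux[of "s\<^sup>2 * Re (B $ i $ i)"]
    by (auto simp: sym[of i j] im algebra_simps power2_eq_square)
qed

text \<open>Variational proof: take a unitary that maximizes the diagonal of
  \<open>cadj U ** A ** U\<close>, weighted by pairwise distinct numbers \<open>w\<close>.
  Stationarity under rotations in the plane of i and j says that \<open>w i - w j\<close> times the
  off-diagonal entry vanishes.\<close>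

theorem hermitian_diagonalizable:
  fixes A :: "complex^'n::finite^'n"
  assumes h: "cadj A = A"
  obtains U l where "unitary_mat U" "A = spectral U (\<lambda>i. of_real (l i))"
proof -
  obtain w :: "'n \<Rightarrow> nat" where w: "inj w"
    using finite_imp_inj_to_nat_seg[of "UNIV :: 'n set"] by auto
  define f where "f = (\<lambda>U. \<Sum>k\<in>UNIV. real (w k) * Re ((cadj U ** A ** U) $ k $ k))"
  have "continuous_on {U. unitary_mat U} f"
    unfolding f_def by (simp add: matrix_mult_nth, intro continuous_intros)
  moreover have "{U :: complex^'n^'n. unitary_mat U} \<noteq> {}"
    by (auto intro!: exI[of _ "mat 1"] simp: unitary_mat_def)
  ultimately obtain U where U: "unitary_mat U" and max: "\<And>V. unitary_mat V \<Longrightarrow> f V \<le> f U"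
    using continuous_attains_sup[OF compact_unitary] by blast
  define B where "B = cadj U ** A ** U"
  have hB: "cadj B = B" by (simp add: B_def cadj_mult h matrix_mul_assoc)
  have zero: "Re (u * B $ i $ j) = 0" if ij: "i \<noteq> j" and u: "cmod u = 1" for i j u
  proof -
    \<comment> \<open>The objective along the rotation by the angle \<open>t\<close>; only the
      diagonal entries i and j move.\<close>
    define g where "g = (\<lambda>t. real (w i) * ((cos t)\<^sup>2 * Re (B $ i $ i) + (sin t)\<^sup>2 * Re (B $ j $ j)
        + 2 * cos t * sin t * Re (u * B $ i $ j))
      + real (w j) * ((sin t)\<^sup>2 * Re (B $ i $ i) + (cos t)\<^sup>2 * Re (B $ j $ j)
        - 2 * cos t * sin t * Re (u * B $ i $ j))
      + (\<Sum>k\<in>UNIV-{i,j}. real (w k) * Re (B $ k $ k)))"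
    have fg: "f (U ** rot i j u (cos t) (sin t)) = g t" for t
    proof -
      let ?R = "rot i j u (cos t) (sin t)"
      have "cadj (U ** ?R) ** A ** (U ** ?R) = cadj ?R ** B ** ?R"
        by (simp add: B_def cadj_mult matrix_mul_assoc)
      then have "f (U ** ?R) = (\<Sum>k\<in>UNIV. real (w k) * Re ((cadj ?R ** B ** ?R) $ k $ k))"
        by (simp add: f_def)
      also have "(UNIV :: 'n set) = insert i (insert j (UNIV - {i,j}))" by auto
      also have "(\<Sum>k\<in>\<dots>. real (w k) * Re ((cadj ?R ** B ** ?R) $ k $ k)) = g t"
        unfolding rot_conj_diag[OF ij u hB] g_def using ij
        by (subst sum.insert, simp, simp, subst sum.insert, simp, simp)
          (auto intro!: sum.cong arg_cong2[of _ _ _ _ "(+)"])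
      finally show ?thesis .
    qed
    have r0: "rot i j u (cos 0) (sin 0) = mat 1" using ij by (auto simp: rot_def vec_eq_iff)
    have "g t \<le> g 0" for t
    proof -
      have "g t \<le> f U" unfolding fg[symmetric]
        by (intro max unitary_mult U rot_unitary ij u) (simp add: sin_squared_eq)
      also have "f U = g 0" using fg[of 0] r0 by simp
      finally show ?thesis .
    qed
    \<comment> \<open>The squares of sine and cosine are stationary at 0; only
      \<open>2 * cos t * sin t\<close> contributes, with slope 2.\<close>
    moreover have "(g has_real_derivative (2 * (real (w i) - real (w j)) * Re (u * B $ i $ j))) (at 0)"
      unfolding g_def by (auto intro!: derivative_eq_intros simp: algebra_simps)
    ultimately have "2 * (real (w i) - real (w j)) * Re (u * B $ i $ j) = 0"
      by (intro DERIV_local_max[of g _ 0 1]) auto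
    moreover have "w i \<noteq> w j" using w ij by (simp add: inj_eq)
    ultimately show ?thesis by simp
  qed
  \<comment> \<open>The phases 1 and \<i> isolate the real and the imaginary part.\<close>
  have off: "B $ i $ j = 0" if "i \<noteq> j" for i j
    using zero[OF that, of 1] zero[OF that, of "\<i>"] by (simp add: complex_eq_iff)
  have im: "B $ i $ i = of_real (Re (B $ i $ i))" for i
  proof -
    have "B $ i $ i = cnj (B $ i $ i)" using hB by (metis cadj_nth)
    then have "Im (B $ i $ i) = 0" by (metis cnj.sel(2) equal_neg_zero)
    then show ?thesis by (simp add: complex_eq_iff)
  qed
  have "B = diag_mat (\<lambda>i. of_real (Re (B $ i $ i)))"
    using off im by (auto simp: vec_eq_iff diag_mat_nth)
  moreover have "A = U ** B ** cadj U"
  proof -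
    have "U ** B ** cadj U = (U ** cadj U) ** A ** (U ** cadj U)"
      by (simp add: B_def matrix_mul_assoc)
    then show ?thesis using U by (simp add: unitary_mat_def)
  qed
  ultimately have "A = spectral U (\<lambda>i. of_real (Re (B $ i $ i)))" unfolding spectral_def by metis
  with U show ?thesis by (rule that)
qed

section \<open>Positive semidefinite matrices and density operators\<close>

lemma psd_form: "psd A \<longleftrightarrow> (\<forall>v. Im (\<Sum>p\<in>UNIV. \<Sum>q\<in>UNIV. cnj (v p) * A $ p $ q * v q) = 0 \<and>
    0 \<le> Re (\<Sum>p\<in>UNIV. \<Sum>q\<in>UNIV. cnj (v p) * A $ p $ q * v q))"
  by (simp add: psd_def psd_on_def Let_def)

text \<open>Polarization: that the form is real at \<open>e_i + e_j\<close> and at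
  \<open>e_i + \<i> e_j\<close> yields the two real equations relating the entries at (i, j) and (j,
  i).\<close>

lemma psd_hermitian:
  fixes A :: "complex^'n::finite^'n"
  assumes "psd A" shows "cadj A = A"
proof -
  have q: "Im (\<Sum>p\<in>UNIV. \<Sum>q\<in>UNIV. cnj (v p) * A $ p $ q * v q) = 0" for v
    using assms by (simp add: psd_form)
  have two: "(\<Sum>p\<in>UNIV. \<Sum>q\<in>UNIV. cnj ((if p = i then a else 0) + (if p = j then b else 0)) * A $ p $ q *
      ((if q = i then a else 0) + (if q = j then b else 0))) =
    cnj a * A $ i $ i * a + cnj a * A $ i $ j * b + cnj b * A $ j $ i * a + cnj b * A $ j $ j * b" for i j a b
  proof -
    have s: "(\<Sum>q\<in>UNIV. x q * ((if q = i then a else 0) + (if q = j then b else 0))) = x i * a + x j * b"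
      for x :: "'n \<Rightarrow> complex" and a b and i j :: 'n
      by (simp add: distrib_left sum.distrib if_distrib[of "\<lambda>y. _ * y"] cong: if_cong)
    have s': "(\<Sum>q\<in>UNIV. cnj ((if q = i then a else 0) + (if q = j then b else 0)) * x q) = cnj a * x i + cnj b * x j"
      for x :: "'n \<Rightarrow> complex" and a b and i j :: 'n
      by (simp add: distrib_right sum.distrib if_distrib[of cnj] if_distrib[of "\<lambda>y. y * _"] cong: if_cong)
    show ?thesis unfolding s mult.assoc sum_distrib_left[symmetric] 
      unfolding mult.assoc[symmetric] s
      unfolding mult.assoc s' by (simp add: algebra_simps)
  qed
  have d: "Im (A $ i $ i) = 0" for i
    using q[of "\<lambda>p. (if p = i then 1 else 0) + (if p = i then 0 else 0)"] unfolding two by simp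
  have "cnj (A $ j $ i) = A $ i $ j" for i j
    using q[of "\<lambda>p. (if p = i then 1 else 0) + (if p = j then 1 else 0)"]
      q[of "\<lambda>p. (if p = i then 1 else 0) + (if p = j then \<i> else 0)"]
    unfolding two using d[of i] d[of j] by (simp add: complex_eq_iff)
  then show ?thesis by (simp add: vec_eq_iff)
qed

text \<open>Each eigenvalue is the value of the form at a column of \<open>U\<close>, hence
  nonnegative.\<close>

lemma psd_diagonalizable:
  fixes A :: "complex^'n::finite^'n"
  assumes "psd A"
  obtains U l where "unitary_mat U" "A = spectral U (\<lambda>i. of_real (l i))" "\<And>i. l i \<ge> 0"
proof -
  obtain U l where U: "unitary_mat U" and A: "A = spectral U (\<lambda>i. of_real (l i))"
    using hermitian_diagonalizable psd_hermitian[OF assms] by blast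
  have "l i \<ge> 0" for i
  proof -
    have "cadj U ** A ** U = (cadj U ** U) ** diag_mat (\<lambda>i. of_real (l i)) ** (cadj U ** U)"
      by (simp add: A spectral_def matrix_mul_assoc)
    also have "\<dots> = diag_mat (\<lambda>i. of_real (l i))" using U by (simp add: unitary_mat_def)
    finally have "(cadj U ** (A ** U)) $ i $ i = of_real (l i)"
      by (simp add: diag_mat_nth matrix_mul_assoc)
    then have "(\<Sum>p\<in>UNIV. \<Sum>q\<in>UNIV. cnj (U $ p $ i) * A $ p $ q * U $ q $ i) = of_real (l i)"
      by (simp add: matrix_mult_nth sum_distrib_left mult.assoc)
    moreover have "0 \<le> Re (\<Sum>p\<in>UNIV. \<Sum>q\<in>UNIV. cnj (U $ p $ i) * A $ p $ q * U $ q $ i)"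
      using assms by (simp add: psd_form)
    ultimately show ?thesis by simp
  qed
  with U A that show ?thesis by blast
qed

lemma density_diagonalizable:
  fixes \<rho> :: "complex^'n::finite^'n"
  assumes "density \<rho>"
  obtains U l where "unitary_mat U" "\<rho> = spectral U (\<lambda>i. of_real (l i))" "\<And>i. l i \<ge> 0" "(\<Sum>i\<in>UNIV. l i) = 1"
proof -
  obtain U l where U: "unitary_mat U" "\<rho> = spectral U (\<lambda>i. of_real (l i))" "\<And>i. l i \<ge> 0"
    using psd_diagonalizable assms unfolding density_def by metis
  have "complex_of_real (\<Sum>i\<in>UNIV. l i) = 1" using assms U by (simp add: density_def trace_spectral)
  then have "(\<Sum>i\<in>UNIV. l i) = 1" using of_real_eq_1_iff by blast
  with U that show ?thesis by blast
qed

lemma psd_spectral: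
  assumes "\<And>i. l i \<ge> 0" shows "psd (spectral U (\<lambda>i. of_real (l i)))"
  unfolding psd_form
proof
  fix v
  let ?F = "\<lambda>p q k. of_real (l k) * ((cnj (v p) * U $ p $ k) * (cnj (U $ q $ k) * v q))"
  have "(\<Sum>p\<in>UNIV. \<Sum>q\<in>UNIV. cnj (v p) * spectral U (\<lambda>i. of_real (l i)) $ p $ q * v q) =
    (\<Sum>p\<in>UNIV. \<Sum>q\<in>UNIV. \<Sum>k\<in>UNIV. ?F p q k)"
    by (simp add: spectral_nth sum_distrib_left sum_distrib_right mult_ac)
  also have "\<dots> = (\<Sum>p\<in>UNIV. \<Sum>k\<in>UNIV. \<Sum>q\<in>UNIV. ?F p q k)"
    by (rule sum.cong[OF refl], rule sum.swap)
  also have "\<dots> = (\<Sum>k\<in>UNIV. \<Sum>p\<in>UNIV. \<Sum>q\<in>UNIV. ?F p q k)"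
    by (rule sum.swap)
  also have "\<dots> = (\<Sum>k\<in>UNIV. of_real (l k) * ((\<Sum>p\<in>UNIV. cnj (v p) * U $ p $ k) * cnj (\<Sum>q\<in>UNIV. cnj (v q) * U $ q $ k)))"
  proof (rule sum.cong[OF refl])
    fix k
    have "cnj (\<Sum>q\<in>UNIV. cnj (v q) * U $ q $ k) = (\<Sum>q\<in>UNIV. cnj (U $ q $ k) * v q)"
      by (simp add: mult.commute)
    then show "(\<Sum>p\<in>UNIV. \<Sum>q\<in>UNIV. ?F p q k) =
      of_real (l k) * ((\<Sum>p\<in>UNIV. cnj (v p) * U $ p $ k) * cnj (\<Sum>q\<in>UNIV. cnj (v q) * U $ q $ k))"
      by (simp only:) (simp only: sum_product, simp only: sum_distrib_left)
  qed
  also have "\<dots> = of_real (\<Sum>k\<in>UNIV. l k * (cmod (\<Sum>p\<in>UNIV. cnj (v p) * U $ p $ k))\<^sup>2)"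
    by (simp only: complex_norm_square[symmetric] of_real_sum of_real_mult)
  finally show "Im (\<Sum>p\<in>UNIV. \<Sum>q\<in>UNIV. cnj (v p) * spectral U (\<lambda>i. of_real (l i)) $ p $ q * v q) = 0 \<and>
    0 \<le> Re (\<Sum>p\<in>UNIV. \<Sum>q\<in>UNIV. cnj (v p) * spectral U (\<lambda>i. of_real (l i)) $ p $ q * v q)"
    using assms by (auto intro!: sum_nonneg)
qed

lemma psd_congruence:
  fixes A :: "complex^'n::finite^'n" and B :: "complex^'n^'m::finite"
  assumes "psd A" shows "psd (B ** A ** cadj B)"
  unfolding psd_form
proof
  fix v
  let ?F = "\<lambda>p q b a. cnj (v p) * B $ p $ a * A $ a $ b * cnj (B $ q $ b) * v q"
  have "(\<Sum>p\<in>UNIV. \<Sum>q\<in>UNIV. cnj (v p) * (B ** A ** cadj B) $ p $ q * v q) =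
    (\<Sum>p\<in>UNIV. \<Sum>q\<in>UNIV. \<Sum>b\<in>UNIV. \<Sum>a\<in>UNIV. ?F p q b a)"
    by (simp add: matrix_mult_nth sum_distrib_left sum_distrib_right mult_ac)
  also have "\<dots> = (\<Sum>p\<in>UNIV. \<Sum>b\<in>UNIV. \<Sum>q\<in>UNIV. \<Sum>a\<in>UNIV. ?F p q b a)"
    by (rule sum.cong[OF refl], rule sum.swap)
  also have "\<dots> = (\<Sum>b\<in>UNIV. \<Sum>p\<in>UNIV. \<Sum>q\<in>UNIV. \<Sum>a\<in>UNIV. ?F p q b a)"
    by (rule sum.swap)
  also have "\<dots> = (\<Sum>b\<in>UNIV. \<Sum>p\<in>UNIV. \<Sum>a\<in>UNIV. \<Sum>q\<in>UNIV. ?F p q b a)"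
    by (rule sum.cong[OF refl], rule sum.cong[OF refl], rule sum.swap)
  also have "\<dots> = (\<Sum>b\<in>UNIV. \<Sum>a\<in>UNIV. \<Sum>p\<in>UNIV. \<Sum>q\<in>UNIV. ?F p q b a)"
    by (rule sum.cong[OF refl], rule sum.swap)
  also have "\<dots> = (\<Sum>a\<in>UNIV. \<Sum>b\<in>UNIV. \<Sum>p\<in>UNIV. \<Sum>q\<in>UNIV. ?F p q b a)"
    by (rule sum.swap)
  also have "\<dots> = (\<Sum>a\<in>UNIV. \<Sum>b\<in>UNIV. cnj (\<Sum>p\<in>UNIV. cnj (B $ p $ a) * v p) * A $ a $ b * (\<Sum>q\<in>UNIV. cnj (B $ q $ b) * v q))"
    by (simp add: sum_distrib_left sum_distrib_right mult_ac)
  finally have e: "(\<Sum>p\<in>UNIV. \<Sum>q\<in>UNIV. cnj (v p) * (B ** A ** cadj B) $ p $ q * v q) = \<dots>" .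
  show "Im (\<Sum>p\<in>UNIV. \<Sum>q\<in>UNIV. cnj (v p) * (B ** A ** cadj B) $ p $ q * v q) = 0 \<and>
    0 \<le> Re (\<Sum>p\<in>UNIV. \<Sum>q\<in>UNIV. cnj (v p) * (B ** A ** cadj B) $ p $ q * v q)"
    unfolding e using assms[unfolded psd_form, rule_format, of "\<lambda>a. \<Sum>p\<in>UNIV. cnj (B $ p $ a) * v p"] .
qed

section \<open>Trace norm duality\<close>

text \<open>The witness is the adjoint of the partial isometry in the polar decomposition of
  \<open>X\<close>, obtained as the power -1/2 of \<open>cadj X ** X\<close> times
  \<open>cadj X\<close>.\<close>

lemma trnorm_attained:
  fixes X :: "complex^'n::finite^'n"
  obtains G where "contraction G" "trnorm X = Re (trace (G ** X))"
proof -
  define S where "S = cadj X ** X"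
  have "psd S" using psd_congruence[of "mat 1" "cadj X"] psd_spectral[of "\<lambda>_. 1" "mat 1 :: complex^'n^'n"]
    by (simp add: S_def spectral_def diag_mat_one)
  then obtain U l where U: "unitary_mat U" and S: "S = spectral U (\<lambda>i. of_real (l i))" and l: "\<And>i. l i \<ge> 0"
    using psd_diagonalizable by blast
  \<comment> \<open>Division by zero is 0, so \<open>r\<close> is already the generalized inverse
    square root on the kernel of \<open>S\<close>.\<close>
  define r where "r = (\<lambda>i. complex_of_real (1 / sqrt (l i)))"
  define G where "G = spectral U r ** cadj X"
  have "G ** cadj G = spectral U r ** S ** spectral U r"
    by (simp add: G_def S_def cadj_mult cadj_spectral matrix_mul_assoc r_def)
  also have "\<dots> = spectral U (\<lambda>i. r i * of_real (l i) * r i)"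
    by (simp add: S spectral_mult U)
  finally have "contraction (G ** cadj G)"
  proof (simp, intro contraction_spectral U)
    fix i
    show "cmod (r i * of_real (l i) * r i) \<le> 1"
      using l[of i] by (simp add: r_def norm_mult norm_divide)
  qed
  then have "contraction G" by (rule contraction_of_gram)
  moreover have "trnorm X = Re (trace (G ** X))"
  proof -
    have "G ** X = spectral U (\<lambda>i. r i * of_real (l i))"
      by (simp add: G_def matrix_mul_assoc[symmetric] S_def[symmetric] S spectral_mult[OF U, symmetric])
    moreover have "r i * of_real (l i) = of_real (sqrt (l i))" for i
      using l[of i] by (simp add: r_def) (metis of_real_divide real_div_sqrt)
    ultimately show ?thesis
      using mfun_spectral[OF U S, of sqrt] by (simp add: trnorm_def S_def[symmetric])
  qed
  ultimately show ?thesis using that by blast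
qed

section \<open>Complex powers on the support\<close>

text \<open>A nonpositive base gives 0 for every exponent, the exponent 0 included. Hence
  \<open>cpow x 0\<close> is the indicator of \<open>x > 0\<close>, \<open>spow U l 0\<close> is the
  support projection, and exponents add without exceptions.\<close>

definition cpow :: "real \<Rightarrow> complex \<Rightarrow> complex" where
  "cpow x z = (if x > 0 then exp (z * of_real (ln x)) else 0)"

abbreviation sreal :: "complex^'n::finite^'n \<Rightarrow> ('n \<Rightarrow> real) \<Rightarrow> complex^'n^'n" where
  "sreal U l \<equiv> spectral U (\<lambda>i. complex_of_real (l i))"

abbreviation spow :: "complex^'n::finite^'n \<Rightarrow> ('n \<Rightarrow> real) \<Rightarrow> complex \<Rightarrow> complex^'n^'n" where
  "spow U l z \<equiv> spectral U (\<lambda>i. cpow (l i) z)"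

lemma cpow_add: "cpow x (z + w) = cpow x z * cpow x w"
  by (simp add: cpow_def exp_add distrib_right)

lemma norm_cpow: "cmod (cpow x z) = (if x > 0 then x powr Re z else 0)"
  by (simp add: cpow_def powr_def)

lemma cpow_of_real: "cpow x (of_real t) = of_real (if x > 0 then x powr t else 0)"
  by (simp add: cpow_def powr_def mult.commute flip: of_real_mult exp_of_real)

lemma cpow_one: "x \<ge> 0 \<Longrightarrow> cpow x 1 = of_real x"
  using cpow_of_real[of x 1] by simp

lemma cnj_cpow: "cnj (cpow x z) = cpow x (cnj z)"
  by (simp add: cpow_def exp_cnj)

lemma holomorphic_cpow [holomorphic_intros]:
  "f holomorphic_on S \<Longrightarrow> (\<lambda>z. cpow x (f z)) holomorphic_on S"
  unfolding cpow_def by (cases "x > 0") (auto intro!: holomorphic_intros)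

lemma holomorphic_matrix_mult:
  assumes "\<And>i j. (\<lambda>z. A z $ i $ j) holomorphic_on S" "\<And>i j. (\<lambda>z. B z $ i $ j) holomorphic_on S"
  shows "(\<lambda>z. (A z ** B z) $ i $ j) holomorphic_on S"
  unfolding matrix_mult_nth by (intro holomorphic_intros assms)

lemma holomorphic_spectral:
  assumes "\<And>i. (\<lambda>z. g z i) holomorphic_on S"
  shows "(\<lambda>z. spectral U (g z) $ i $ j) holomorphic_on S"
  unfolding spectral_nth by (intro holomorphic_intros assms)

section \<open>Moments of the Haar measure\<close>

locale haar =
  fixes \<mu> :: "(complex^'n::finite^'n) measure"
  assumes haar: "haar_measure \<mu>"
begin

lemma sets_eq [measurable_cong]: "sets \<mu> = sets borel"
  using haar by (simp add: haar_measure_def)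

lemma prob: "prob_space \<mu>"
  using haar by (simp add: haar_measure_def)

sublocale prob_space \<mu> by (rule prob)

lemma AE_unitary: "AE U in \<mu>. unitary_mat U"
  using haar by (simp add: haar_measure_def)

lemma measurable_continuous:
  fixes f :: "complex^'n^'n \<Rightarrow> 'b::topological_space"
  assumes "continuous_on UNIV f" shows "f \<in> borel_measurable \<mu>"
  using borel_measurable_continuous_onI[OF assms] measurable_cong_sets[OF sets_eq refl] by blast

text \<open>Almost every \<open>U\<close> lies in the compact unitary group, where a continuous
  function is bounded.\<close>

lemma integrable_continuous:
  fixes f :: "complex^'n^'n \<Rightarrow> 'b::{banach, second_countable_topology}"
  assumes "continuous_on UNIV f" shows "integrable \<mu> f"
proof -
  have "compact (f ` {U. unitary_mat U})"
    by (intro compact_continuous_image compact_unitary continuous_on_subset[OF assms]) auto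
  then obtain B where "\<And>U. unitary_mat U \<Longrightarrow> norm (f U) \<le> B"
    using compact_imp_bounded by (force simp: bounded_iff)
  with AE_unitary have "AE U in \<mu>. norm (f U) \<le> B" by (auto elim: eventually_mono)
  then show ?thesis by (rule integrable_const_bound) (rule measurable_continuous[OF assms])
qed

lemma integral_left_mult:
  fixes f :: "complex^'n^'n \<Rightarrow> 'b::{banach, second_countable_topology}"
  assumes V: "unitary_mat V" and f: "continuous_on UNIV f"
  shows "(\<integral>U. f (V ** U) \<partial>\<mu>) = (\<integral>U. f U \<partial>\<mu>)"
proof -
  have "continuous_on UNIV (\<lambda>U :: complex^'n^'n. V ** U)"
    by (rule continuous_on_matrixI) (simp add: matrix_mult_nth, intro continuous_intros)
  then have m: "(\<lambda>U. V ** U) \<in> measurable \<mu> borel" by (rule measurable_continuous)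
  have "(\<integral>U. f U \<partial>\<mu>) = (\<integral>U. f U \<partial>(distr \<mu> borel (\<lambda>U. V ** U)))"
    using haar V by (simp add: haar_measure_def)
  also have "\<dots> = (\<integral>U. f (V ** U) \<partial>\<mu>)"
    by (rule integral_distr[OF m borel_measurable_continuous_onI[OF f]])
  finally show ?thesis by simp
qed

end

definition conj_by :: "complex^'n::finite^'n \<Rightarrow> complex^'n^'n \<Rightarrow> complex^'n^'n" where
  "conj_by U N = U ** N ** cadj U"

lemma conj_by_mult: "conj_by (V ** U) N = conj_by V (conj_by U N)"
  by (simp add: conj_by_def cadj_mult matrix_mul_assoc)

lemma conj_by_nth:
  "conj_by U N $ a $ b = (\<Sum>j\<in>UNIV. \<Sum>i\<in>UNIV. U $ a $ i * N $ i $ j * cnj (U $ b $ j))"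
  by (simp add: conj_by_def matrix_mult_nth sum_distrib_right)

lemma continuous_conj_by: "continuous_on UNIV (\<lambda>U. conj_by U N $ a $ b)"
  unfolding conj_by_nth by (intro continuous_intros)

lemma trace_conj_by: "unitary_mat U \<Longrightarrow> trace (conj_by U N) = trace N"
  unfolding conj_by_def by (subst trace_comm) (simp add: matrix_mul_assoc unitary_mat_def)

lemma norm_conj_by: "unitary_mat U \<Longrightarrow> norm (conj_by U N) = norm N"
  by (simp add: conj_by_def norm_mult_unitary norm_unitary_mult unitary_cadj)

lemma conj_by_diag_mat_nth: "conj_by (diag_mat g) P $ a $ b = g a * P $ a $ b * cnj (g b)"
  by (simp add: conj_by_def cadj_diag_mat mult_diag_mat_nth diag_mat_mult_nth)

lemma unitary_diag_mat:
  assumes "\<And>i. cmod (g i) = 1" shows "unitary_mat (diag_mat g)"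
proof (rule unitary_if_left_inverse)
  have "cnj (g i) * g i = 1" for i
    using assms[of i] by (simp add: complex_norm_square[symmetric] mult.commute[of "cnj _"])
  then show "cadj (diag_mat g) ** diag_mat g = mat 1" by (simp add: cadj_diag_mat diag_mat_mult diag_mat_one)
qed

definition perm_mat :: "('n::finite \<Rightarrow> 'n) \<Rightarrow> complex^'n^'n" where
  "perm_mat p = (\<chi> i j. if j = p i then 1 else 0)"

lemma perm_mat_mult: "(perm_mat p ** A) $ i $ j = A $ p i $ j"
proof -
  have "(perm_mat p ** A) $ i $ j = (\<Sum>k\<in>UNIV. if k = p i then A $ k $ j else 0)"
    unfolding matrix_mult_nth perm_mat_def vec_lambda_beta by (rule sum.cong) auto
  then show ?thesis by simp
qed

lemma mult_cadj_perm_mat: "(A ** cadj (perm_mat p)) $ i $ j = A $ i $ p j"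
  using perm_mat_mult[of p "cadj A" j i] by (metis cadj_cadj cadj_mult cadj_nth complex_cnj_cancel_iff)

lemma conj_by_perm_nth: "conj_by (perm_mat p) P $ a $ b = P $ p a $ p b"
  by (simp add: conj_by_def perm_mat_mult mult_cadj_perm_mat)

lemma unitary_perm_mat:
  assumes "bij p" shows "unitary_mat (perm_mat p)"
proof -
  have "perm_mat p ** cadj (perm_mat p) = mat 1"
    using bij_is_inj[OF assms] unfolding vec_eq_iff mult_cadj_perm_mat
    by (auto simp: perm_mat_def dest: injD)
  then show ?thesis
    using unitary_if_left_inverse[of "cadj (perm_mat p)"] unitary_cadj[of "cadj (perm_mat p)"] by simp
qed

text \<open>The second transposition exchanges \<open>q c\<close> and \<open>c'\<close>; both differ
  from \<open>a'\<close>, so the value at \<open>a\<close> stays.\<close>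

lemma bij_with_two_values:
  assumes "a \<noteq> c" "a' \<noteq> c'"
  obtains p :: "'n \<Rightarrow> 'n" where "bij p" "p a = a'" "p c = c'"
proof -
  define q where "q = Transposition.transpose a a'"
  define p where "p = Transposition.transpose (q c) c' \<circ> q"
  have "bij p" by (simp add: p_def q_def bij_comp)
  moreover have "q c \<noteq> a'" using assms(1) unfolding q_def
    by (metis transpose_apply_second transpose_eq_iff)
  then have "p a = a'" using assms by (simp add: p_def q_def Transposition.transpose_def)
  moreover have "p c = c'" by (simp add: p_def)
  ultimately show ?thesis using that by blast
qed

text \<open>The rotation by 45 degrees. Phases and permutations never mix diagonal with off-diagonal
  entries; this conjugation does, and so supplies the missing relation between second
  moments.\<close>

lemma conj_by_rot_nth:
  fixes P :: "complex^'n::finite^'n"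
  assumes "a \<noteq> c" and s: "s = 1 / sqrt 2"
  shows "conj_by (cadj (rot a c 1 s s)) P $ a $ c = (P $ c $ c - P $ a $ a + P $ a $ c - P $ c $ a) / 2"
proof -
  let ?R = "rot a c 1 s s"
  have PR: "(P ** ?R) $ k $ c = of_real s * (P $ k $ c - P $ k $ a)" for k
  proof -
    have "(P ** ?R) $ k $ c = cnj (\<Sum>l\<in>UNIV. cnj (?R $ l $ c) * cnj (P $ k $ l))"
      by (simp add: matrix_mult_nth mult.commute)
    also have "\<dots> = of_real s * (P $ k $ c - P $ k $ a)"
      unfolding rot_sum[OF assms(1)] using assms(1) by (simp add: algebra_simps)
    finally show ?thesis .
  qed
  have "conj_by (cadj ?R) P $ a $ c = (\<Sum>k\<in>UNIV. cnj (?R $ k $ a) * (P ** ?R) $ k $ c)"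
    by (simp add: conj_by_def matrix_mul_assoc[symmetric] matrix_mult_nth[of "cadj ?R"])
  also have "\<dots> = (of_real s * of_real s) * (P $ c $ c - P $ a $ a + P $ a $ c - P $ c $ a)"
    unfolding rot_sum[OF assms(1)] PR by (simp add: algebra_simps)
  also have "of_real s * of_real s = (1 / 2 :: complex)"
  proof -
    have "s * s = 1 / 2" by (simp add: s)
    then show ?thesis by (metis of_real_mult of_real_divide of_real_1 of_real_numeral)
  qed
  finally show ?thesis by simp
qed

context haar
begin

text \<open>Translating \<open>U\<close> by \<open>V\<close> from the left conjugates
  \<open>conj_by U N\<close> by \<open>V\<close>, so all moments of \<open>conj_by U N\<close> are
  invariant under unitary conjugation.\<close>

lemma integral_conj_by_invariant:
  fixes f :: "complex^'n^'n \<Rightarrow> complex"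
  assumes "unitary_mat V" and f: "continuous_on UNIV f"
  shows "(\<integral>U. f (conj_by V (conj_by U N)) \<partial>\<mu>) = (\<integral>U. f (conj_by U N) \<partial>\<mu>)"
proof -
  have "continuous_on UNIV (\<lambda>U. conj_by U N)"
    by (rule continuous_on_matrixI) (rule continuous_conj_by)
  then have "continuous_on UNIV (\<lambda>U. f (conj_by U N))"
    using f continuous_on_compose2 by blast
  from integral_left_mult[OF assms(1) this] show ?thesis by (simp add: conj_by_mult)
qed

text \<open>The phase \<i> at one index removes the off-diagonal part, transpositions equalize the
  diagonal, and the trace, which conjugation preserves, gives its value.\<close>

lemma first_moment:
  "(\<integral>U. conj_by U N $ a $ b \<partial>\<mu>) = (if a = b then trace N / of_nat CARD('n) else 0)"
proof -
  define m where "m = (\<lambda>a b. \<integral>U. conj_by U N $ a $ b \<partial>\<mu>)"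
  have int: "integrable \<mu> (\<lambda>U. conj_by U N $ a $ b)" for a b
    by (intro integrable_continuous continuous_conj_by)
  have off: "m a b = 0" if "a \<noteq> b" for a b
  proof -
    define g where "g = (\<lambda>i. if i = a then \<i> else 1)"
    have "m a b = (\<integral>U. conj_by (diag_mat g) (conj_by U N) $ a $ b \<partial>\<mu>)"
      unfolding m_def by (rule integral_conj_by_invariant[where f="\<lambda>P. P $ a $ b", symmetric])
        (auto intro!: unitary_diag_mat continuous_intros simp: g_def)
    also have "\<dots> = \<i> * m a b"
      using that by (simp add: conj_by_diag_mat_nth g_def m_def)
    finally have "(1 - \<i>) * m a b = 0" by (simp add: algebra_simps)
    then show ?thesis by (simp add: complex_eq_iff)
  qed
  have same: "m a a = m b b" for a b
  proof -
    let ?p = "Transposition.transpose a b"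
    have "m a a = (\<integral>U. conj_by (perm_mat ?p) (conj_by U N) $ a $ a \<partial>\<mu>)"
      unfolding m_def by (rule integral_conj_by_invariant[where f="\<lambda>P. P $ a $ a", symmetric])
        (auto intro!: unitary_perm_mat continuous_intros)
    also have "\<dots> = m b b" by (simp add: conj_by_perm_nth m_def)
    finally show ?thesis .
  qed
  have "(\<Sum>c\<in>UNIV. m c c) = (\<integral>U. trace (conj_by U N) \<partial>\<mu>)"
    unfolding m_def trace_def by (rule Bochner_Integration.integral_sum[symmetric]) (rule int)
  also have "\<dots> = (\<integral>U. trace N \<partial>\<mu>)"
  proof (rule integral_cong_AE)
    show "(\<lambda>U. trace (conj_by U N)) \<in> borel_measurable \<mu>"
      unfolding trace_def by (intro borel_measurable_sum borel_measurable_integrable int)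
    show "AE U in \<mu>. trace (conj_by U N) = trace N"
      using AE_unitary by eventually_elim (rule trace_conj_by)
  qed simp
  finally have "(\<Sum>c\<in>UNIV. m c c) = trace N" by (simp add: prob_space)
  moreover have "(\<Sum>c\<in>UNIV. m c c) = (\<Sum>c\<in>(UNIV::'n set). m a a)"
    by (intro sum.cong refl same)
  ultimately have "of_nat CARD('n) * m a a = trace N" by simp
  then have "m a a = trace N / of_nat CARD('n)" by (simp add: field_simps)
  with off show ?thesis by (auto simp: m_def)
qed

text \<open>Diagonal phases leave only the two index patterns shown, which overlap when all four
  indices agree; permutations make each kind of entry constant; and one rotation ties the value on
  the overlap to the sum of the other two.\<close>

lemma second_moment_form:
  "\<exists>s1 s2. \<forall>a b c d. (\<integral>U. conj_by U N $ a $ b * cnj (conj_by U N $ c $ d) \<partial>\<mu>)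
    = (if a = c \<and> b = d then s2 else 0) + (if a = b \<and> c = d then s1 else 0)"
proof -
  define S where "S = (\<lambda>a b c d. \<integral>U. conj_by U N $ a $ b * cnj (conj_by U N $ c $ d) \<partial>\<mu>)"
  have int: "integrable \<mu> (\<lambda>U. conj_by U N $ a $ b * cnj (conj_by U N $ c $ d))" for a b c d
    by (intro integrable_continuous continuous_intros continuous_conj_by)
  have inv: "S a b c d = (\<integral>U. conj_by V (conj_by U N) $ a $ b * cnj (conj_by V (conj_by U N) $ c $ d) \<partial>\<mu>)"
    if "unitary_mat V" for V a b c d
    unfolding S_def
    by (rule integral_conj_by_invariant[where f="\<lambda>P. P $ a $ b * cnj (P $ c $ d)", OF that, symmetric])
      (intro continuous_intros)
  have phase: "S a b c d = g a * cnj (g b) * cnj (g c) * g d * S a b c d"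
    if "\<And>i. cmod (g i) = 1" for g a b c d
  proof -
    have "S a b c d = (\<integral>U. (g a * cnj (g b) * cnj (g c) * g d) *
        (conj_by U N $ a $ b * cnj (conj_by U N $ c $ d)) \<partial>\<mu>)"
      by (subst inv[OF unitary_diag_mat[of g, OF that]]) (simp add: conj_by_diag_mat_nth mult_ac)
    then show ?thesis by (simp add: S_def)
  qed
  have zero: "S a b c d = 0" if "a \<noteq> b" "\<not> (c = a \<and> d = b)" for a b c d
  proof -
    \<comment> \<open>An index at which the phase does not cancel: the total factor is \<i>, -1 or -
      \<i>, never 1.\<close>
    define k where "k = (if c \<noteq> a then a else b)"
    define g where "g = (\<lambda>i. if i = k then \<i> else 1)"
    have "g a * cnj (g b) * cnj (g c) * g d \<noteq> 1"
      using that by (auto simp: g_def k_def complex_eq_iff)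
    moreover have "S a b c d = g a * cnj (g b) * cnj (g c) * g d * S a b c d"
      by (rule phase) (simp add: g_def)
    ultimately show ?thesis by (metis mult_cancel_right1)
  qed
  have sym: "S c d a b = cnj (S a b c d)" for a b c d
    unfolding S_def by (subst Bochner_Integration.integral_cnj[symmetric]) (simp add: mult.commute)
  have zero': "S a b c d = 0" if "c \<noteq> d" "\<not> (c = a \<and> d = b)" for a b c d
    using zero[of c d a b] that sym[of a b c d] by auto
  have perm: "S a b c d = S (p a) (p b) (p c) (p d)" if "bij p" for p a b c d
    by (subst inv[OF unitary_perm_mat[OF that]]) (simp add: conj_by_perm_nth S_def)
  \<comment> \<open>Invariance of \<open>S a c a c\<close> under the 45 degree rotation expands into
    sixteen terms, of which the phases leave six. The term \<open>S a c a c\<close> is among them,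
    so the coefficient 4 on the left drops to 3.\<close>
  have rel: "S a a a a + S c c c c - S a a c c - S c c a a + S c a c a = 3 * S a c a c" if "a \<noteq> c" for a c
  proof -
    define s where "s = 1 / sqrt (2::real)"
    have s2: "s\<^sup>2 + s\<^sup>2 = 1" by (simp add: s_def power_divide)
    define I where "I = (\<lambda>U a b c d. conj_by U N $ a $ b * cnj (conj_by U N $ c $ d))"
    have i: "integrable \<mu> (\<lambda>U. I U a b c d)" for a b c d unfolding I_def by (rule int)
    have Si: "(\<integral>U. I U a b c d \<partial>\<mu>) = S a b c d" for a b c d by (simp add: I_def S_def)
    have "4 * S a c a c = (\<integral>U. 4 * (conj_by (cadj (rot a c 1 s s)) (conj_by U N) $ a $ c *
         cnj (conj_by (cadj (rot a c 1 s s)) (conj_by U N) $ a $ c)) \<partial>\<mu>)"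
      by (subst inv[OF unitary_cadj[OF rot_unitary[OF that _ s2, of 1]]]) simp_all
    also have "\<dots> = (\<integral>U. (I U c c c c - I U c c a a + I U c c a c - I U c c c a)
       - (I U a a c c - I U a a a a + I U a a a c - I U a a c a)
       + (I U a c c c - I U a c a a + I U a c a c - I U a c c a)
       - (I U c a c c - I U c a a a + I U c a a c - I U c a c a) \<partial>\<mu>)"
    proof (rule Bochner_Integration.integral_cong[OF refl])
      have q: "4 * ((x / 2) * cnj (x / 2)) = x * cnj x" for x :: complex by simp
      show "4 * (conj_by (cadj (rot a c 1 s s)) (conj_by U N) $ a $ c *
          cnj (conj_by (cadj (rot a c 1 s s)) (conj_by U N) $ a $ c)) =
        (I U c c c c - I U c c a a + I U c c a c - I U c c c a)
         - (I U a a c c - I U a a a a + I U a a a c - I U a a c a)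
         + (I U a c c c - I U a c a a + I U a c a c - I U a c c a)
         - (I U c a c c - I U c a a a + I U c a a c - I U c a c a)" for U
        unfolding conj_by_rot_nth[OF that s_def] q by (simp add: I_def algebra_simps)
    qed
    also have "\<dots> = (S c c c c - S c c a a + S c c a c - S c c c a)
       - (S a a c c - S a a a a + S a a a c - S a a c a)
       + (S a c c c - S a c a a + S a c a c - S a c c a)
       - (S c a c c - S c a a a + S c a a c - S c a c a)"
      by (simp add: i Si)
    finally show ?thesis using that zero zero' by (simp add: algebra_simps)
  qed
  show ?thesis
  proof (cases "CARD('n) = 1")
    \<comment> \<open>In dimension one the two index patterns coincide, and the whole value may be
      given to \<open>s1\<close>.\<close>
    case True
    then have "a = b" for a b :: 'n by (metis UNIV_I card_1_singletonE singletonD)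
    then have "S a b c d = S x x x x" for a b c d x by metis
    then have "S a b c d = (if a = c \<and> b = d then 0 else 0) + (if a = b \<and> c = d then S x x x x else 0)" for a b c d x
      using \<open>\<And>a b :: 'n. a = b\<close> by auto
    then show ?thesis unfolding S_def by blast
  next
    case False
    have "\<exists>x y :: 'n. x \<noteq> y"
    proof (rule ccontr)
      assume "\<nexists>x y :: 'n. x \<noteq> y"
      then have "(UNIV :: 'n set) = {undefined}" by auto
      then show False using False by (metis card_1_singleton_iff One_nat_def)
    qed
    then obtain x y :: 'n where xy: "x \<noteq> y" by blast
    have e2: "S a b a b = S x y x y" if "a \<noteq> b" for a b
      using bij_with_two_values[OF that xy] perm by metis
    have e1: "S a a b b = S x x y y" if "a \<noteq> b" for a b
      using bij_with_two_values[OF that xy] perm by metis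
    have e0: "S a a a a = S x x x x" for a
      using perm[of "Transposition.transpose a x" a a a a] by simp
    have "2 * S x x x x = 2 * (S x y x y + S x x y y)"
      using rel[OF xy] e0[of y] e2[of y x] e1[of y x] xy by (simp add: algebra_simps)
    then have s0: "S x x x x = S x y x y + S x x y y"
      by (metis mult_left_cancel zero_neq_numeral)
    have "S a b c d = (if a = c \<and> b = d then S x y x y else 0) + (if a = b \<and> c = d then S x x y y else 0)" for a b c d
    proof (cases "a = b")
      case ab: True
      show ?thesis
      proof (cases "c = d")
        case True
        then show ?thesis using ab e0[of a] e1[of a c] s0 by auto
      next
        case False
        then show ?thesis using ab zero'[of c d a b] by auto
      qed
    next
      case False
      then show ?thesis using zero[of a b c d] e2[of a b] by auto
    qed
    then show ?thesis unfolding S_def by blast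
  qed
qed

text \<open>The two constants of \<open>second_moment_form\<close> are found by testing it: the
  identity in place of \<tau> detects that \<open>N\<close> is traceless, and the sum of all squared
  entries detects the norm of \<open>N\<close>. Stated as a product with
  \<open>d\<^sup>2 - 1\<close>, so that d = 1 needs no exception.\<close>

lemma second_moment_traceless:
  assumes \<tau>: "trace \<tau> = 0" and N: "trace N = 0"
  shows "((real CARD('n))\<^sup>2 - 1) * (\<integral>U. (cmod (trace (\<tau> ** conj_by U N)))\<^sup>2 \<partial>\<mu>) = (norm \<tau>)\<^sup>2 * (norm N)\<^sup>2"
proof -
  let ?d = "of_nat CARD('n) :: complex"
  obtain s1 s2 where S: "\<And>a b c d. (\<integral>U. conj_by U N $ a $ b * cnj (conj_by U N $ c $ d) \<partial>\<mu>)
    = (if a = c \<and> b = d then s2 else 0) + (if a = b \<and> c = d then s1 else 0)"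
    using second_moment_form[of N] by blast
  have int: "integrable \<mu> (\<lambda>U. conj_by U N $ a $ b * cnj (conj_by U N $ c $ d))" for a b c d
    by (intro integrable_continuous continuous_intros continuous_conj_by)
  have delta: "(\<Sum>c\<in>UNIV. \<Sum>d\<in>UNIV. f c d * (if a = c \<and> b = d then y else 0)) = f a b * y"
    for a b :: 'n and f and y :: complex
  proof -
    have "(\<Sum>c\<in>UNIV. \<Sum>d\<in>UNIV. f c d * (if a = c \<and> b = d then y else 0)) =
      (\<Sum>c\<in>UNIV. if a = c then (\<Sum>d\<in>UNIV. if b = d then f c d * y else 0) else 0)"
    proof (rule sum.cong[OF refl])
      fix c
      show "(\<Sum>d\<in>UNIV. f c d * (if a = c \<and> b = d then y else 0)) =
        (if a = c then (\<Sum>d\<in>UNIV. if b = d then f c d * y else 0) else 0)"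
        by (cases "a = c") (simp_all add: if_distrib[of "\<lambda>x. _ * x"] cong: if_cong)
    qed
    then show ?thesis by simp
  qed
  have T: "(\<integral>U. trace (\<tau> ** conj_by U N) * cnj (trace (\<tau> ** conj_by U N)) \<partial>\<mu>)
     = s2 * of_real ((norm \<tau>)\<^sup>2) + s1 * (trace \<tau> * cnj (trace \<tau>))" for \<tau>
  proof -
    have "(\<integral>U. trace (\<tau> ** conj_by U N) * cnj (trace (\<tau> ** conj_by U N)) \<partial>\<mu>) =
      (\<integral>U. (\<Sum>b\<in>UNIV. \<Sum>a\<in>UNIV. \<Sum>d\<in>UNIV. \<Sum>c\<in>UNIV. (\<tau> $ b $ a * cnj (\<tau> $ d $ c)) * (conj_by U N $ a $ b * cnj (conj_by U N $ c $ d))) \<partial>\<mu>)"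
      unfolding trace_mult cnj_sum unfolding sum_distrib_right unfolding sum_distrib_left
      by (simp only: complex_cnj_mult mult_ac)
    also have "\<dots> = (\<Sum>b\<in>UNIV. \<Sum>a\<in>UNIV. \<Sum>d\<in>UNIV. \<Sum>c\<in>UNIV. (\<tau> $ b $ a * cnj (\<tau> $ d $ c)) *
        ((if a = c \<and> b = d then s2 else 0) + (if a = b \<and> c = d then s1 else 0)))"
      by (subst Bochner_Integration.integral_sum,
          intro Bochner_Integration.integrable_sum integrable_mult_right int, rule sum.cong[OF refl])+
        (simp only: integral_mult_right_zero S)
    also have "\<dots> = (\<Sum>b\<in>UNIV. \<Sum>a\<in>UNIV. (\<Sum>d\<in>UNIV. \<Sum>c\<in>UNIV. (\<tau> $ b $ a * cnj (\<tau> $ d $ c)) * (if b = d \<and> a = c then s2 else 0))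
       + (\<Sum>d\<in>UNIV. \<Sum>c\<in>UNIV. (\<tau> $ b $ a * cnj (\<tau> $ d $ c)) * (if a = b \<and> c = d then s1 else 0)))"
      unfolding distrib_left sum.distrib by (simp only: conj_commute)
    also have "\<dots> = (\<Sum>b\<in>UNIV. \<Sum>a\<in>UNIV. \<tau> $ b $ a * cnj (\<tau> $ b $ a) * s2
       + (if a = b then \<tau> $ b $ a * (\<Sum>d\<in>UNIV. \<Sum>c\<in>UNIV. if c = d then cnj (\<tau> $ d $ c) * s1 else 0) else 0))"
    proof (intro sum.cong refl arg_cong2[of _ _ _ _ "(+)"])
      fix a b
      show "(\<Sum>d\<in>UNIV. \<Sum>c\<in>UNIV. (\<tau> $ b $ a * cnj (\<tau> $ d $ c)) * (if b = d \<and> a = c then s2 else 0))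
        = \<tau> $ b $ a * cnj (\<tau> $ b $ a) * s2" by (rule delta)
      show "(\<Sum>d\<in>UNIV. \<Sum>c\<in>UNIV. (\<tau> $ b $ a * cnj (\<tau> $ d $ c)) * (if a = b \<and> c = d then s1 else 0))
        = (if a = b then \<tau> $ b $ a * (\<Sum>d\<in>UNIV. \<Sum>c\<in>UNIV. if c = d then cnj (\<tau> $ d $ c) * s1 else 0) else 0)"
        by (cases "a = b") (simp_all add: sum_distrib_left if_distrib mult.assoc cong: if_cong)
    qed
    also have "\<dots> = s2 * of_real ((norm \<tau>)\<^sup>2) + s1 * (trace \<tau> * cnj (trace \<tau>))"
    proof -
      have n: "of_real ((norm \<tau>)\<^sup>2) = (\<Sum>b\<in>UNIV. \<Sum>a\<in>UNIV. \<tau> $ b $ a * cnj (\<tau> $ b $ a))"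
        by (simp only: frobenius_norm of_real_sum complex_norm_square)
      have t: "trace \<tau> * cnj (trace \<tau>) = (\<Sum>b\<in>UNIV. \<Sum>d\<in>UNIV. \<tau> $ b $ b * cnj (\<tau> $ d $ d))"
        by (simp add: trace_def sum_product)
      show ?thesis unfolding n t
        by (simp add: sum.distrib sum_distrib_left sum_distrib_right mult_ac)
    qed
    finally show ?thesis .
  qed
  have sq: "(\<integral>U. trace (\<tau> ** conj_by U N) * cnj (trace (\<tau> ** conj_by U N)) \<partial>\<mu>)
    = of_real (\<integral>U. (cmod (trace (\<tau> ** conj_by U N)))\<^sup>2 \<partial>\<mu>)" for \<tau>
    unfolding complex_norm_square[symmetric] by (rule integral_complex_of_real)
  have 1: "of_real (\<integral>U. (cmod (trace (\<tau> ** conj_by U N)))\<^sup>2 \<partial>\<mu>) = s2 * of_real ((norm \<tau>)\<^sup>2)"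
    using T[of \<tau>] \<tau> unfolding sq by simp
  have s1: "s2 + s1 * ?d = 0"
  proof -
    have "(\<integral>U. trace (mat 1 ** conj_by U N) * cnj (trace (mat 1 ** conj_by U N)) \<partial>\<mu>) = (\<integral>U. 0 \<partial>\<mu>)"
    proof (rule integral_cong_AE)
      show "(\<lambda>U. trace (mat 1 ** conj_by U N) * cnj (trace (mat 1 ** conj_by U N))) \<in> borel_measurable \<mu>"
        unfolding trace_def by (intro measurable_continuous) (simp, intro continuous_intros continuous_conj_by)
      show "AE U in \<mu>. trace (mat 1 ** conj_by U N) * cnj (trace (mat 1 ** conj_by U N)) = 0"
        using AE_unitary by eventually_elim (simp add: trace_conj_by N)
    qed simp
    moreover have "(norm (mat 1 :: complex^'n^'n))\<^sup>2 = real CARD('n)"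
      by (simp add: diag_mat_one[symmetric] norm_diag_mat_sq)
    ultimately have "s2 * ?d + s1 * (?d * ?d) = 0"
      using T[of "mat 1"] by (simp add: trace_def)
    then have "?d * (s2 + s1 * ?d) = 0" by (simp add: algebra_simps)
    then show ?thesis by simp
  qed
  have s2: "of_real ((norm N)\<^sup>2) = s2 * ?d * ?d + s1 * ?d"
  proof -
    have "(\<integral>U. of_real ((norm (conj_by U N))\<^sup>2) \<partial>\<mu>) = (\<integral>U. complex_of_real ((norm N)\<^sup>2) \<partial>\<mu>)"
    proof (rule integral_cong_AE)
      show "(\<lambda>U. complex_of_real ((norm (conj_by U N))\<^sup>2)) \<in> borel_measurable \<mu>"
        unfolding frobenius_norm by (intro measurable_continuous continuous_intros continuous_conj_by)
      show "AE U in \<mu>. complex_of_real ((norm (conj_by U N))\<^sup>2) = complex_of_real ((norm N)\<^sup>2)"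
        using AE_unitary by eventually_elim (simp add: norm_conj_by)
    qed simp
    then have "complex_of_real ((norm N)\<^sup>2) = (\<integral>U. of_real ((norm (conj_by U N))\<^sup>2) \<partial>\<mu>)"
      by (simp add: prob_space)
    also have "\<dots> = (\<integral>U. (\<Sum>a\<in>UNIV. \<Sum>b\<in>UNIV. conj_by U N $ a $ b * cnj (conj_by U N $ a $ b)) \<partial>\<mu>)"
      unfolding frobenius_norm of_real_sum complex_norm_square ..
    also have "\<dots> = (\<Sum>a\<in>(UNIV::'n set). \<Sum>b\<in>(UNIV::'n set). s2 + (if a = b then s1 else 0))"
      by (simp add: Bochner_Integration.integral_sum Bochner_Integration.integrable_sum int S)
    also have "\<dots> = s2 * ?d * ?d + s1 * ?d" by (simp add: sum.distrib algebra_simps)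
    finally show ?thesis .
  qed
  have "complex_of_real (((real CARD('n))\<^sup>2 - 1) * (\<integral>U. (cmod (trace (\<tau> ** conj_by U N)))\<^sup>2 \<partial>\<mu>))
     = (?d * ?d - 1) * s2 * of_real ((norm \<tau>)\<^sup>2)"
    using 1 by (simp add: power2_eq_square)
  also have "(?d * ?d - 1) * s2 = of_real ((norm N)\<^sup>2)"
    unfolding s2 using s1 by algebra
  finally show ?thesis by (simp only: mult.commute flip: of_real_mult) (simp only: of_real_eq_iff)
qed

text \<open>\<open>r\<close> projects orthogonally onto the traceless matrices. Removing the scalar
  parts absorbs the product of traces, does not increase norms, and leaves the traceless case, where
  \<open>d\<^sup>2 / (d\<^sup>2 - 1) \<le> 4 / 3\<close> for d \<ge> 2.\<close>

lemma second_moment_le: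
  "(\<integral>U. (cmod (of_nat CARD('n) * trace (\<tau> ** conj_by U N) - trace \<tau> * trace N))\<^sup>2 \<partial>\<mu>)
    \<le> 4 / 3 * (norm \<tau>)\<^sup>2 * (norm N)\<^sup>2"
proof -
  let ?d = "of_nat CARD('n) :: complex"
  define r where "r = (\<lambda>A :: complex^'n^'n. A - (\<chi> i j. if i = j then trace A / ?d else 0))"
  have tr: "trace (r A) = 0" for A by (simp add: r_def trace_def sum_subtractf)
  have dgr: "r A = A - diag_mat (\<lambda>_. trace A / ?d)" for A by (simp add: r_def diag_mat_def)
  have nr: "(norm (r A))\<^sup>2 \<le> (norm A)\<^sup>2" for A
  proof -
    have "(norm A)\<^sup>2 = (norm (r A + diag_mat (\<lambda>_. trace A / ?d)))\<^sup>2" by (simp add: dgr)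
    also have "\<dots> = (norm (r A))\<^sup>2 + (norm (diag_mat (\<lambda>_. trace A / ?d) :: complex^'n^'n))\<^sup>2 + 2 * (r A \<bullet> diag_mat (\<lambda>_. trace A / ?d))"
      by (simp add: power2_norm_eq_inner inner_add_left inner_add_right inner_commute)
    also have "r A \<bullet> diag_mat (\<lambda>_. y) = Re (trace (r A) * cnj y)" for y
    proof -
      have "(\<Sum>j\<in>UNIV. (r A $ i $ j) \<bullet> (if i = j then y else 0)) = (r A $ i $ i) \<bullet> y" for i
      proof -
        have "(\<Sum>j\<in>UNIV. (r A $ i $ j) \<bullet> (if i = j then y else 0)) = (\<Sum>j\<in>UNIV. if i = j then (r A $ i $ j) \<bullet> y else 0)"
          by (rule sum.cong) auto
        then show ?thesis by simp
      qed
      then show ?thesis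
        by (simp add: inner_vec_def diag_mat_nth trace_def inner_complex_def sum_distrib_right sum.distrib)
    qed
    finally show ?thesis by (simp add: tr)
  qed
  have eq: "?d * trace (\<tau> ** conj_by U N) - trace \<tau> * trace N = ?d * trace (r \<tau> ** conj_by U (r N))"
    if U: "unitary_mat U" for U
  proof -
    have dgU: "conj_by U (A - diag_mat (\<lambda>_. y)) = conj_by U A - diag_mat (\<lambda>_. y)" for A y
    proof -
      have "conj_by U (A - diag_mat (\<lambda>_. y)) = conj_by U A - spectral U (\<lambda>_. y)"
        by (simp add: conj_by_def spectral_def vec_eq_iff matrix_mult_nth sum_subtractf algebra_simps)
      also have "spectral U (\<lambda>_. y) = diag_mat (\<lambda>_. y)"
      proof -
        have "spectral U (\<lambda>_. y) $ i $ j = y * (U ** cadj U) $ i $ j" for i j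
          by (simp add: spectral_nth matrix_mult_nth sum_distrib_left mult_ac)
        then show ?thesis using U by (simp add: unitary_mat_def vec_eq_iff diag_mat_nth)
      qed
      finally show ?thesis .
    qed
    have m: "trace ((A - diag_mat (\<lambda>_. x)) ** (B - diag_mat (\<lambda>_. y))) = trace (A ** B) - y * trace A - x * trace B + ?d * x * y"
      for A B :: "complex^'n^'n" and x y
    proof -
      have "(A - diag_mat (\<lambda>_. x)) ** (B - diag_mat (\<lambda>_. y)) = A ** B - A ** diag_mat (\<lambda>_. y) - diag_mat (\<lambda>_. x) ** B + diag_mat (\<lambda>_. x) ** diag_mat (\<lambda>_. y)"
        by (simp add: vec_eq_iff matrix_mult_nth sum_subtractf sum.distrib algebra_simps)
      moreover have "trace (A ** diag_mat (\<lambda>_. y)) = y * trace A" "trace (diag_mat (\<lambda>_. x) ** B) = x * trace B"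
        by (simp_all add: trace_def mult_diag_mat_nth diag_mat_mult_nth sum_distrib_left mult.commute)
      ultimately show ?thesis by (simp add: trace_add trace_sub diag_mat_mult trace_diag_mat)
    qed
    have "trace (conj_by U N) = trace N" by (rule trace_conj_by[OF U])
    then show ?thesis
      unfolding dgr dgU m by (simp add: field_simps)
  qed
  have ce: "continuous_on UNIV (\<lambda>U. trace (A ** conj_by U B))" for A B
    unfolding trace_mult by (intro continuous_intros continuous_conj_by)
  have "(\<integral>U. (cmod (?d * trace (\<tau> ** conj_by U N) - trace \<tau> * trace N))\<^sup>2 \<partial>\<mu>) =
     (\<integral>U. (real CARD('n))\<^sup>2 * (cmod (trace (r \<tau> ** conj_by U (r N))))\<^sup>2 \<partial>\<mu>)"
  proof (rule integral_cong_AE)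
    show "AE U in \<mu>. (cmod (?d * trace (\<tau> ** conj_by U N) - trace \<tau> * trace N))\<^sup>2 =
        (real CARD('n))\<^sup>2 * (cmod (trace (r \<tau> ** conj_by U (r N))))\<^sup>2"
      using AE_unitary by eventually_elim (simp add: eq norm_mult power_mult_distrib)
  qed (intro measurable_continuous continuous_intros ce)+
  also have "\<dots> = (real CARD('n))\<^sup>2 * (\<integral>U. (cmod (trace (r \<tau> ** conj_by U (r N))))\<^sup>2 \<partial>\<mu>)" by simp
  also have "\<dots> \<le> 4 / 3 * ((norm (r \<tau>))\<^sup>2 * (norm (r N))\<^sup>2)"
  proof (cases "CARD('n) = 1")
    case True
    then obtain x :: 'n where "UNIV = {x}" using card_1_singletonE by blast
    then have one: "i = x" for i by blast
    have "r N = 0"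
    proof -
      have "r N $ x $ x = 0" using tr[of N] unfolding trace_def \<open>UNIV = {x}\<close> by simp
      then have "r N $ i $ j = 0" for i j using one[of i] one[of j] by simp
      then show ?thesis by (simp add: vec_eq_iff)
    qed
    then have "conj_by U (r N) = 0" for U by (simp add: conj_by_def)
    then show ?thesis by (simp add: trace_def)
  next
    case False
    moreover have "CARD('n) \<noteq> 0" by simp
    ultimately have "2 \<le> CARD('n)" by linarith
    then have "(2::real)\<^sup>2 \<le> (real CARD('n))\<^sup>2" by (intro power_mono) auto
    then have d: "4 \<le> (real CARD('n))\<^sup>2" by simp
    define I where "I = (\<integral>U. (cmod (trace (r \<tau> ** conj_by U (r N))))\<^sup>2 \<partial>\<mu>)"
    have "I \<ge> 0" unfolding I_def by simp
    have "(real CARD('n))\<^sup>2 * I \<le> 4 / 3 * ((real CARD('n))\<^sup>2 - 1) * I"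
      using d \<open>I \<ge> 0\<close> by (intro mult_right_mono) auto
    also have "\<dots> = 4 / 3 * (((real CARD('n))\<^sup>2 - 1) * I)" by simp
    also have "((real CARD('n))\<^sup>2 - 1) * I = (norm (r \<tau>))\<^sup>2 * (norm (r N))\<^sup>2"
      unfolding I_def by (rule second_moment_traceless[OF tr tr])
    finally show ?thesis unfolding I_def .
  qed
  also have "\<dots> \<le> 4 / 3 * ((norm \<tau>)\<^sup>2 * (norm N)\<^sup>2)"
    using nr[of \<tau>] nr[of N] by (intro mult_left_mono mult_mono) auto
  finally show ?thesis by (simp add: mult_ac)
qed

end

section \<open>The decoupling map as a bilinear form\<close>

lemma sum_UNIV_prod: "(\<Sum>p\<in>UNIV. f p) = (\<Sum>a\<in>UNIV. \<Sum>b\<in>UNIV. f (a, b))"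
  by (simp add: sum.cartesian_product UNIV_Times_UNIV[symmetric] del: UNIV_Times_UNIV)

lemma kron_nth: "kron A B $ p $ q = A $ fst p $ fst q * B $ snd p $ snd q"
  by (simp add: kron_def)

lemma cadj_kron: "cadj (kron A B) = kron (cadj A) (cadj B)"
  by (simp add: vec_eq_iff kron_nth)

lemma kron_mult: "kron A B ** kron C D = kron (A ** C) (B ** D)"
  by (simp add: vec_eq_iff kron_nth matrix_mult_nth sum_UNIV_prod sum_product mult_ac)

lemma kron_mat_1: "kron (mat 1) (mat 1) = mat 1"
  by (auto simp: vec_eq_iff kron_nth)

lemma kron_diag_mat: "kron (diag_mat g) (diag_mat h) = diag_mat (\<lambda>p. g (fst p) * h (snd p))"
  by (auto simp: vec_eq_iff kron_nth diag_mat_nth)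

lemma unitary_kron: "unitary_mat U \<Longrightarrow> unitary_mat V \<Longrightarrow> unitary_mat (kron U V)"
  by (simp add: unitary_mat_def cadj_kron kron_mult kron_mat_1)

lemma kron_spectral: "kron (spectral U g) (spectral V h) = spectral (kron U V) (\<lambda>p. g (fst p) * h (snd p))"
  by (simp add: spectral_def cadj_kron kron_mult kron_diag_mat[symmetric])

lemma kron_mat_1_left_nth:
  "(kron (mat 1) S ** X) $ p $ q = (\<Sum>f\<in>UNIV. S $ snd p $ f * X $ (fst p, f) $ q)"
proof -
  have "(kron (mat 1) S ** X) $ p $ q =
      (\<Sum>a\<in>UNIV. if fst p = a then (\<Sum>f\<in>UNIV. S $ snd p $ f * X $ (a, f) $ q) else 0)"
    unfolding matrix_mult_nth sum_UNIV_prod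
  proof (rule sum.cong[OF refl])
    fix a
    show "(\<Sum>f\<in>UNIV. kron (mat 1) S $ p $ (a, f) * X $ (a, f) $ q) =
      (if fst p = a then (\<Sum>f\<in>UNIV. S $ snd p $ f * X $ (a, f) $ q) else 0)"
      by (cases "fst p = a") (simp_all add: kron_nth)
  qed
  then show ?thesis by simp
qed

lemma kron_mat_1_right_nth:
  "(kron U (mat 1) ** X) $ p $ q = (\<Sum>i\<in>UNIV. U $ fst p $ i * X $ (i, snd p) $ q)"
proof -
  have "(kron U (mat 1) ** X) $ p $ q =
      (\<Sum>i\<in>UNIV. \<Sum>f\<in>UNIV. if snd p = f then U $ fst p $ i * X $ (i, f) $ q else 0)"
    unfolding matrix_mult_nth sum_UNIV_prod
    by (rule sum.cong[OF refl], rule sum.cong[OF refl]) (simp add: kron_nth)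
  then show ?thesis by simp
qed

definition block :: "complex^('a::finite\<times>'e::finite)^('a\<times>'e) \<Rightarrow> 'e \<Rightarrow> 'e \<Rightarrow> complex^'a^'a" where
  "block X e f = (\<chi> i j. X $ (i, e) $ (j, f))"

text \<open>The transposition turns the entrywise pairing in \<open>choi_map\<close> into the trace
  of a product.\<close>

definition block_transpose :: "complex^('a::finite\<times>'c::finite)^('a\<times>'c) \<Rightarrow> 'c \<Rightarrow> 'c \<Rightarrow> complex^'a^'a" where
  "block_transpose Y c d = (\<chi> i j. Y $ (j, c) $ (i, d))"

definition twirl :: "complex^'a::finite^'a \<Rightarrow> complex^('a\<times>'e::finite)^('a\<times>'e) \<Rightarrow> complex^('a\<times>'e)^('a\<times>'e)" where
  "twirl U X = kron U (mat 1) ** X ** cadj (kron U (mat 1))"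

lemma twirl_nth: "twirl U X $ (a, e) $ (b, f) = conj_by U (block X e f) $ a $ b"
proof -
  have "twirl U X $ (a, e) $ (b, f) = cnj ((kron U (mat 1) ** cadj (kron U (mat 1) ** X)) $ (b, f) $ (a, e))"
  proof -
    have "twirl U X = cadj (kron U (mat 1) ** cadj (kron U (mat 1) ** X))"
      by (simp add: twirl_def cadj_mult)
    then show ?thesis by (simp only: cadj_nth)
  qed
  also have "\<dots> = (\<Sum>j\<in>UNIV. \<Sum>i\<in>UNIV. U $ a $ i * X $ (i, e) $ (j, f) * cnj (U $ b $ j))"
    by (simp add: kron_mat_1_right_nth sum_distrib_left mult_ac)
  finally show ?thesis by (simp add: conj_by_nth block_def)
qed

text \<open>If \<open>Y\<close> is the Choi state of a channel then \<open>choi_map Y\<close> is the channel tensored with the identity.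
  The formula is symmetric in the two arguments, so state and channel are treated alike below.\<close>

definition choi_map :: "complex^('a::finite\<times>'c::finite)^('a\<times>'c) \<Rightarrow> complex^('a\<times>'e::finite)^('a\<times>'e) \<Rightarrow> complex^('c\<times>'e)^('c\<times>'e)" where
  "choi_map Y X = (\<chi> p q. of_nat CARD('a) * (\<Sum>a\<in>UNIV. \<Sum>b\<in>UNIV. Y $ (a, fst p) $ (b, fst q) * X $ (a, snd p) $ (b, snd q)))"

text \<open>Defined for arbitrary matrices and bilinear in \<open>Y\<close> and \<open>X\<close>,
  because the interpolation leaves the set of states.\<close>

definition decouple :: "complex^('a::finite\<times>'c::finite)^('a\<times>'c) \<Rightarrow> complex^('a\<times>'e::finite)^('a\<times>'e) \<Rightarrow> complex^'a^'a \<Rightarrow> complex^('c\<times>'e)^('c\<times>'e)" where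
  "decouple Y X U = choi_map Y (twirl U X) - kron (ptr1 Y) (ptr1 X)"

lemma cadj_choi_map: "cadj (choi_map Y X) = choi_map (cadj Y) (cadj X)"
  unfolding vec_eq_iff choi_map_def cadj_nth vec_lambda_beta
  by (intro allI, subst sum.swap) simp

lemma cadj_ptr1: "cadj (ptr1 X) = ptr1 (cadj X)"
  by (simp add: vec_eq_iff ptr1_def)

lemma cadj_twirl: "cadj (twirl U X) = twirl U (cadj X)"
  by (simp add: twirl_def cadj_mult matrix_mul_assoc)

lemma choi_map_left_1: "choi_map (kron (mat 1) R ** Y) X = kron R (mat 1) ** choi_map Y X"
proof -
  have "choi_map (kron (mat 1) R ** Y) X $ p $ q = (kron R (mat 1) ** choi_map Y X) $ p $ q" for p q
  proof -
    have "(\<Sum>a\<in>UNIV. \<Sum>b\<in>UNIV. (\<Sum>f\<in>UNIV. R $ fst p $ f * Y $ (a, f) $ (b, fst q)) * X $ (a, snd p) $ (b, snd q))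
      = (\<Sum>a\<in>UNIV. \<Sum>f\<in>UNIV. \<Sum>b\<in>UNIV. R $ fst p $ f * Y $ (a, f) $ (b, fst q) * X $ (a, snd p) $ (b, snd q))"
      unfolding sum_distrib_right by (rule sum.cong[OF refl], rule sum.swap)
    also have "\<dots> = (\<Sum>f\<in>UNIV. \<Sum>a\<in>UNIV. \<Sum>b\<in>UNIV. R $ fst p $ f * Y $ (a, f) $ (b, fst q) * X $ (a, snd p) $ (b, snd q))"
      by (rule sum.swap)
    finally have eq: "(\<Sum>a\<in>UNIV. \<Sum>b\<in>UNIV. (\<Sum>f\<in>UNIV. R $ fst p $ f * Y $ (a, f) $ (b, fst q)) * X $ (a, snd p) $ (b, snd q)) = \<dots>" .
    have l: "choi_map (kron (mat 1) R ** Y) X $ p $ q = of_nat CARD('c) *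
        (\<Sum>a\<in>UNIV. \<Sum>b\<in>UNIV. (\<Sum>f\<in>UNIV. R $ fst p $ f * Y $ (a, f) $ (b, fst q)) * X $ (a, snd p) $ (b, snd q))"
      by (simp add: choi_map_def kron_mat_1_left_nth)
    have r: "(kron R (mat 1) ** choi_map Y X) $ p $ q = of_nat CARD('c) *
        (\<Sum>f\<in>UNIV. \<Sum>a\<in>UNIV. \<Sum>b\<in>UNIV. R $ fst p $ f * Y $ (a, f) $ (b, fst q) * X $ (a, snd p) $ (b, snd q))"
      by (simp add: choi_map_def kron_mat_1_right_nth sum_distrib_left mult_ac)
    show ?thesis unfolding l r eq ..
  qed
  then show ?thesis by (simp add: vec_eq_iff)
qed

lemma choi_map_left_2: "choi_map Y (kron (mat 1) S ** X) = kron (mat 1) S ** choi_map Y X"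
proof -
  have "choi_map Y (kron (mat 1) S ** X) $ p $ q = (kron (mat 1) S ** choi_map Y X) $ p $ q" for p q
  proof -
    have "(\<Sum>a\<in>UNIV. \<Sum>b\<in>UNIV. Y $ (a, fst p) $ (b, fst q) * (\<Sum>f\<in>UNIV. S $ snd p $ f * X $ (a, f) $ (b, snd q)))
      = (\<Sum>a\<in>UNIV. \<Sum>f\<in>UNIV. \<Sum>b\<in>UNIV. Y $ (a, fst p) $ (b, fst q) * (S $ snd p $ f * X $ (a, f) $ (b, snd q)))"
      unfolding sum_distrib_left by (rule sum.cong[OF refl], rule sum.swap)
    also have "\<dots> = (\<Sum>f\<in>UNIV. \<Sum>a\<in>UNIV. \<Sum>b\<in>UNIV. Y $ (a, fst p) $ (b, fst q) * (S $ snd p $ f * X $ (a, f) $ (b, snd q)))"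
      by (rule sum.swap)
    finally have eq: "(\<Sum>a\<in>UNIV. \<Sum>b\<in>UNIV. Y $ (a, fst p) $ (b, fst q) * (\<Sum>f\<in>UNIV. S $ snd p $ f * X $ (a, f) $ (b, snd q))) = \<dots>" .
    have l: "choi_map Y (kron (mat 1) S ** X) $ p $ q = of_nat CARD('c) *
        (\<Sum>a\<in>UNIV. \<Sum>b\<in>UNIV. Y $ (a, fst p) $ (b, fst q) * (\<Sum>f\<in>UNIV. S $ snd p $ f * X $ (a, f) $ (b, snd q)))"
      by (simp add: choi_map_def kron_mat_1_left_nth)
    have r: "(kron (mat 1) S ** choi_map Y X) $ p $ q = of_nat CARD('c) *
        (\<Sum>f\<in>UNIV. \<Sum>a\<in>UNIV. \<Sum>b\<in>UNIV. Y $ (a, fst p) $ (b, fst q) * (S $ snd p $ f * X $ (a, f) $ (b, snd q)))"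
      by (simp add: choi_map_def kron_mat_1_left_nth sum_distrib_left mult_ac)
    show ?thesis unfolding l r eq ..
  qed
  then show ?thesis by (simp add: vec_eq_iff)
qed

lemma choi_map_left: "choi_map (kron (mat 1) R ** Y) (kron (mat 1) S ** X) = kron R S ** choi_map Y X"
  by (simp add: choi_map_left_1 choi_map_left_2 matrix_mul_assoc kron_mult)

text \<open>Taking adjoints reverses products, so the version for factors on the right follows from
  the one for factors on the left.\<close>

lemma choi_map_right: "choi_map (Y ** kron (mat 1) R) (X ** kron (mat 1) S) = choi_map Y X ** kron R S"
proof -
  have "cadj (choi_map (Y ** kron (mat 1) R) (X ** kron (mat 1) S)) = cadj (choi_map Y X ** kron R S)"
    by (simp add: cadj_choi_map cadj_mult cadj_kron choi_map_left)
  then show ?thesis by (metis cadj_cadj)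
qed

lemma ptr1_left: "ptr1 (kron (mat 1) S ** X) = S ** ptr1 X"
proof -
  have "ptr1 (kron (mat 1) S ** X) $ e $ f = (S ** ptr1 X) $ e $ f" for e f
    unfolding ptr1_def kron_mat_1_left_nth matrix_mult_nth[of S]
    by (simp add: sum_distrib_left) (rule sum.swap)
  then show ?thesis by (simp add: vec_eq_iff)
qed

lemma ptr1_right: "ptr1 (X ** kron (mat 1) S) = ptr1 X ** S"
proof -
  have "cadj (ptr1 (X ** kron (mat 1) S)) = cadj (ptr1 X ** S)"
    by (simp add: cadj_ptr1 cadj_mult cadj_kron ptr1_left)
  then show ?thesis by (metis cadj_cadj)
qed

lemma twirl_left: "twirl U (kron (mat 1) S ** X) = kron (mat 1) S ** twirl U X"
  by (simp add: twirl_def matrix_mul_assoc kron_mult)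

lemma twirl_right: "twirl U (X ** kron (mat 1) S) = twirl U X ** kron (mat 1) S"
proof -
  have "cadj (twirl U (X ** kron (mat 1) S)) = cadj (twirl U X ** kron (mat 1) S)"
    by (simp add: cadj_twirl cadj_mult cadj_kron twirl_left)
  then show ?thesis by (metis cadj_cadj)
qed

lemma matrix_diff_left: "A ** (B - C) = A ** B - A ** (C :: complex^'k::finite^'n::finite)"
  by (simp add: vec_eq_iff matrix_mult_nth sum_subtractf right_diff_distrib)

lemma matrix_diff_right: "(B - C) ** A = B ** A - (C :: complex^'k::finite^'n::finite) ** A"
  by (simp add: vec_eq_iff matrix_mult_nth sum_subtractf left_diff_distrib)

text \<open>The weights act on the second factors, which neither the unitary nor the sum over the
  common first index touches; they therefore come out as one product weight on each side.\<close>

lemma decouple_weighted: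
  "decouple (kron (mat 1) R ** Y ** kron (mat 1) R') (kron (mat 1) S ** X ** kron (mat 1) S') U
    = kron R S ** decouple Y X U ** kron R' S'"
  by (simp add: decouple_def twirl_left twirl_right choi_map_left choi_map_right ptr1_left ptr1_right
      matrix_diff_left matrix_diff_right kron_mult)

text \<open>Each entry is the centered expression estimated in \<open>second_moment_le\<close>, for
  one block of \<open>Y\<close> and one block of \<open>X\<close>.\<close>

lemma decouple_nth:
  fixes Y :: "complex^('a::finite\<times>'c::finite)^('a\<times>'c)"
  shows "decouple Y X U $ p $ q = of_nat CARD('a) * trace (block_transpose Y (fst p) (fst q) ** conj_by U (block X (snd p) (snd q)))
    - trace (block_transpose Y (fst p) (fst q)) * trace (block X (snd p) (snd q))"
proof -
  have "trace (block_transpose Y (fst p) (fst q) ** conj_by U (block X (snd p) (snd q)))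
    = (\<Sum>a\<in>UNIV. \<Sum>b\<in>UNIV. Y $ (a, fst p) $ (b, fst q) * twirl U X $ (a, snd p) $ (b, snd q))"
    unfolding trace_mult twirl_nth block_transpose_def by (subst sum.swap) simp
  then show ?thesis
    by (simp add: decouple_def choi_map_def kron_nth ptr1_def trace_def block_transpose_def block_def)
qed

lemma continuous_on_decouple: "continuous_on UNIV (decouple Y X)"
  unfolding decouple_nth trace_mult
  by (rule continuous_on_matrixI) (simp add: decouple_nth trace_mult, intro continuous_intros continuous_conj_by)

lemma norm_block_sum: "(\<Sum>e\<in>UNIV. \<Sum>f\<in>UNIV. (norm (block X e f))\<^sup>2) = (norm X)\<^sup>2"
proof -
  let ?F = "\<lambda>i e j f. (cmod (X $ (i, e) $ (j, f)))\<^sup>2"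
  have "(norm X)\<^sup>2 = (\<Sum>i\<in>UNIV. \<Sum>e\<in>UNIV. \<Sum>j\<in>UNIV. \<Sum>f\<in>UNIV. ?F i e j f)"
    by (simp add: frobenius_norm sum_UNIV_prod)
  also have "\<dots> = (\<Sum>e\<in>UNIV. \<Sum>i\<in>UNIV. \<Sum>j\<in>UNIV. \<Sum>f\<in>UNIV. ?F i e j f)"
    by (rule sum.swap)
  also have "\<dots> = (\<Sum>e\<in>UNIV. \<Sum>i\<in>UNIV. \<Sum>f\<in>UNIV. \<Sum>j\<in>UNIV. ?F i e j f)"
    by (rule sum.cong[OF refl], rule sum.cong[OF refl], rule sum.swap)
  also have "\<dots> = (\<Sum>e\<in>UNIV. \<Sum>f\<in>UNIV. \<Sum>i\<in>UNIV. \<Sum>j\<in>UNIV. ?F i e j f)"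
    by (rule sum.cong[OF refl], rule sum.swap)
  finally show ?thesis by (simp add: frobenius_norm block_def)
qed

lemma norm_block_transpose: "norm (block_transpose Y c d) = norm (block Y c d)"
proof -
  have "(norm (block_transpose Y c d))\<^sup>2 = (norm (block Y c d))\<^sup>2"
    unfolding frobenius_norm block_transpose_def block_def by (subst sum.swap) simp
  then show ?thesis by simp
qed

text \<open>A Hoelder bound with two Schatten-4 weights around a contraction. In the eigenbasis of
  the weights, the product of the squares of two weights is at most half the sum of their fourth
  powers, and the rows and columns of a contraction have square sums at most 1.\<close>

lemma norm_weighted_le:
  assumes G: "contraction G" and V: "unitary_mat V"
  shows "(norm (spectral V g ** G ** spectral V g))\<^sup>2 \<le> (\<Sum>i\<in>UNIV. (cmod (g i))^4)"
proof -
  define H where "H = cadj V ** G ** V"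
  have H: "contraction H" unfolding H_def
    by (intro contraction_mult unitary_contraction unitary_cadj V G)
  have "spectral V g ** G ** spectral V g = V ** (diag_mat g ** H ** diag_mat g) ** cadj V"
    by (simp add: spectral_def H_def matrix_mul_assoc)
  then have "(norm (spectral V g ** G ** spectral V g))\<^sup>2 = (norm (diag_mat g ** H ** diag_mat g))\<^sup>2"
    by (simp add: norm_mult_unitary norm_unitary_mult unitary_cadj V)
  also have "\<dots> = (\<Sum>i\<in>UNIV. \<Sum>j\<in>UNIV. (cmod (g i) * cmod (H $ i $ j) * cmod (g j))\<^sup>2)"
    unfolding frobenius_norm by (simp add: mult_diag_mat_nth diag_mat_mult_nth norm_mult)
  also have "\<dots> \<le> (\<Sum>i\<in>UNIV. \<Sum>j\<in>UNIV. (cmod (H $ i $ j))\<^sup>2 * ((cmod (g i))^4 / 2) + (cmod (H $ i $ j))\<^sup>2 * ((cmod (g j))^4 / 2))"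
  proof (intro sum_mono)
    fix i j
    have "0 \<le> ((cmod (g i))\<^sup>2 - (cmod (g j))\<^sup>2)\<^sup>2" by simp
    then have "(cmod (g i))\<^sup>2 * (cmod (g j))\<^sup>2 \<le> (cmod (g i))^4 / 2 + (cmod (g j))^4 / 2"
      by (simp add: power2_eq_square power4_eq_xxxx algebra_simps)
    then have "(cmod (H $ i $ j))\<^sup>2 * ((cmod (g i))\<^sup>2 * (cmod (g j))\<^sup>2) \<le> (cmod (H $ i $ j))\<^sup>2 * ((cmod (g i))^4 / 2 + (cmod (g j))^4 / 2)"
      by (rule mult_left_mono) simp
    then show "(cmod (g i) * cmod (H $ i $ j) * cmod (g j))\<^sup>2 \<le>
      (cmod (H $ i $ j))\<^sup>2 * ((cmod (g i))^4 / 2) + (cmod (H $ i $ j))\<^sup>2 * ((cmod (g j))^4 / 2)"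
      by (simp add: power_mult_distrib distrib_left mult_ac)
  qed
  also have "\<dots> = (\<Sum>i\<in>UNIV. (\<Sum>j\<in>UNIV. (cmod (H $ i $ j))\<^sup>2) * ((cmod (g i))^4 / 2))
      + (\<Sum>j\<in>UNIV. (\<Sum>i\<in>UNIV. (cmod (H $ i $ j))\<^sup>2) * ((cmod (g j))^4 / 2))"
    unfolding sum.distrib sum_distrib_right by (subst (2) sum.swap) simp
  also have "\<dots> \<le> (\<Sum>i\<in>UNIV. 1 * ((cmod (g i))^4 / 2)) + (\<Sum>j\<in>UNIV. 1 * ((cmod (g j))^4 / 2))"
    by (intro add_mono sum_mono mult_right_mono contraction_row contraction_col H) auto
  also have "\<dots> = (\<Sum>i\<in>UNIV. (cmod (g i))^4)" by (simp flip: sum.distrib)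
  finally show ?thesis .
qed

text \<open>For rank-one \<open>Y\<close> and \<open>X\<close>, twirling and applying
  \<open>choi_map\<close> gives a matrix of rank at most one, up to the dimension factor; this is
  the formula for the vectors that span it.\<close>

definition contract_vec :: "complex^('a::finite\<times>'c::finite) \<Rightarrow> complex^('a\<times>'e::finite) \<Rightarrow> complex^'a^'a \<Rightarrow> complex^('c\<times>'e)" where
  "contract_vec w v U = (\<chi> p. \<Sum>a\<in>UNIV. w $ (a, fst p) * (\<Sum>i\<in>UNIV. U $ a $ i * v $ (i, snd p)))"

lemma continuous_on_contract_vec: "continuous_on UNIV (contract_vec w v)"
  unfolding contract_vec_def by (intro continuous_on_vec_lambda continuous_intros)

lemma cmod_sum_cnj_le:
  fixes x y :: "complex^'n::finite"
  shows "cmod (\<Sum>q\<in>UNIV. x $ q * cnj (y $ q)) \<le> norm x * norm y"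
proof -
  have "cmod (\<Sum>q\<in>UNIV. x $ q * cnj (y $ q)) \<le> (\<Sum>q\<in>UNIV. cmod (x $ q) * cmod (y $ q))"
    by (rule sum_norm_le) (simp add: norm_mult)
  also have "\<dots> \<le> norm x * norm y"
    using L2_set_mult_ineq[of "\<lambda>q. cmod (x $ q)" "\<lambda>q. cmod (y $ q)" UNIV] by (simp add: norm_vec_def)
  finally show ?thesis .
qed

lemma choi_map_rank_one_sum:
  fixes A :: "complex^'k::finite^('a::finite\<times>'e::finite)" and A' :: "complex^'l::finite^('a\<times>'c::finite)"
  shows "choi_map (A' ** diag_mat n ** B') (twirl U (A ** diag_mat m ** B)) $ p $ q =
    (\<Sum>l\<in>UNIV. \<Sum>k\<in>UNIV. of_nat CARD('a) * n l * m k *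
      (contract_vec (\<chi> r. A' $ r $ l) (\<chi> r. A $ r $ k) U $ p *
       cnj (contract_vec (\<chi> r. cnj (B' $ l $ r)) (\<chi> r. cnj (B $ k $ r)) U $ q)))"
proof -
  obtain c e c' e' where pq: "p = (c, e)" "q = (c', e')" by (cases p, cases q) blast
  have tw: "twirl U (A ** diag_mat m ** B) $ (a, e) $ (b, e') =
     (\<Sum>k\<in>UNIV. m k * ((\<Sum>i\<in>UNIV. U $ a $ i * A $ (i, e) $ k) * cnj (\<Sum>j\<in>UNIV. U $ b $ j * cnj (B $ k $ (j, e')))))" for a b
  proof -
    let ?F = "\<lambda>j i k. m k * ((U $ a $ i * A $ (i, e) $ k) * (cnj (U $ b $ j) * B $ k $ (j, e')))"
    have "twirl U (A ** diag_mat m ** B) $ (a, e) $ (b, e') =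
      (\<Sum>j\<in>UNIV. \<Sum>i\<in>UNIV. \<Sum>k\<in>UNIV. ?F j i k)"
      unfolding twirl_nth conj_by_nth block_def vec_lambda_beta matrix_mult_nth[of "A ** diag_mat m"] mult_diag_mat_nth
      by (simp add: sum_distrib_left sum_distrib_right mult_ac)
    also have "\<dots> = (\<Sum>j\<in>UNIV. \<Sum>k\<in>UNIV. \<Sum>i\<in>UNIV. ?F j i k)"
      by (rule sum.cong[OF refl], rule sum.swap)
    also have "\<dots> = (\<Sum>k\<in>UNIV. \<Sum>j\<in>UNIV. \<Sum>i\<in>UNIV. ?F j i k)"
      by (rule sum.swap)
    finally show ?thesis
      by (simp add: sum_distrib_left sum_distrib_right)
  qed
  have four: "(\<Sum>a\<in>UNIV. \<Sum>b\<in>UNIV. (\<Sum>l\<in>UNIV. n l * (x l a * y l b)) * (\<Sum>k\<in>UNIV. m k * (f k a * g k b))) =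
     (\<Sum>l\<in>UNIV. \<Sum>k\<in>UNIV. n l * m k * ((\<Sum>a\<in>UNIV. x l a * f k a) * (\<Sum>b\<in>UNIV. y l b * g k b)))"
    for x y :: "'l \<Rightarrow> 'a \<Rightarrow> complex" and f g :: "'k \<Rightarrow> 'a \<Rightarrow> complex"
  proof -
    let ?F = "\<lambda>a b l k. n l * m k * ((x l a * f k a) * (y l b * g k b))"
    have "(\<Sum>a\<in>UNIV. \<Sum>b\<in>UNIV. (\<Sum>l\<in>UNIV. n l * (x l a * y l b)) * (\<Sum>k\<in>UNIV. m k * (f k a * g k b))) =
      (\<Sum>a\<in>UNIV. \<Sum>b\<in>UNIV. \<Sum>l\<in>UNIV. \<Sum>k\<in>UNIV. ?F a b l k)"
      unfolding sum_product by (simp only: mult_ac)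
    also have "\<dots> = (\<Sum>a\<in>UNIV. \<Sum>l\<in>UNIV. \<Sum>b\<in>UNIV. \<Sum>k\<in>UNIV. ?F a b l k)"
      by (rule sum.cong[OF refl], rule sum.swap)
    also have "\<dots> = (\<Sum>l\<in>UNIV. \<Sum>a\<in>UNIV. \<Sum>b\<in>UNIV. \<Sum>k\<in>UNIV. ?F a b l k)"
      by (rule sum.swap)
    also have "\<dots> = (\<Sum>l\<in>UNIV. \<Sum>a\<in>UNIV. \<Sum>k\<in>UNIV. \<Sum>b\<in>UNIV. ?F a b l k)"
      by (rule sum.cong[OF refl], rule sum.cong[OF refl], rule sum.swap)
    also have "\<dots> = (\<Sum>l\<in>UNIV. \<Sum>k\<in>UNIV. \<Sum>a\<in>UNIV. \<Sum>b\<in>UNIV. ?F a b l k)"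
      by (rule sum.cong[OF refl], rule sum.swap)
    finally show ?thesis by (simp only: sum_product) (simp only: sum_distrib_left)
  qed
  have Y: "(A' ** diag_mat n ** B') $ (a, c) $ (b, c') = (\<Sum>l\<in>UNIV. n l * (A' $ (a, c) $ l * B' $ l $ (b, c')))" for a b
    by (simp add: matrix_mult_nth[of "A' ** diag_mat n"] mult_diag_mat_nth mult_ac)
  show ?thesis unfolding pq choi_map_def vec_lambda_beta fst_conv snd_conv tw Y four
    by (simp add: contract_vec_def sum_distrib_left mult_ac)
qed

text \<open>The estimate \<open>2 * x * y \<le> x\<^sup>2 + y\<^sup>2\<close> separates the two
  vectors of each rank-one term. The right-hand side is free of \<open>G\<close>, so it can be
  integrated even when \<open>G\<close> varies with \<open>U\<close>.\<close>

lemma trace_choi_map_le: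
  fixes A :: "complex^'k::finite^('a::finite\<times>'e::finite)" and A' :: "complex^'l::finite^('a\<times>'c::finite)"
  assumes G: "contraction G" and m: "\<And>k. m k \<ge> 0" and n: "\<And>l. n l \<ge> 0"
  shows "cmod (trace (G ** choi_map (A' ** diag_mat (\<lambda>l. of_real (n l)) ** B') (twirl U (A ** diag_mat (\<lambda>k. of_real (m k)) ** B))))
    \<le> (\<Sum>l\<in>UNIV. \<Sum>k\<in>UNIV. real CARD('a) * n l * m k *
      ((norm (contract_vec (\<chi> r. A' $ r $ l) (\<chi> r. A $ r $ k) U))\<^sup>2 / 2 +
       (norm (contract_vec (\<chi> r. cnj (B' $ l $ r)) (\<chi> r. cnj (B $ k $ r)) U))\<^sup>2 / 2))"
proof -
  define x where "x = (\<lambda>l k. contract_vec (\<chi> r. A' $ r $ l) (\<chi> r. A $ r $ k) U)"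
  define y where "y = (\<lambda>l k. contract_vec (\<chi> r. cnj (B' $ l $ r)) (\<chi> r. cnj (B $ k $ r)) U)"
  define C where "C = (\<lambda>l k. of_nat CARD('a) * of_real (n l) * of_real (m k) :: complex)"
  let ?F = "\<lambda>q p l k. C l k * (G $ q $ p * (x l k $ p * cnj (y l k $ q)))"
  have "trace (G ** choi_map (A' ** diag_mat (\<lambda>l. of_real (n l)) ** B') (twirl U (A ** diag_mat (\<lambda>k. of_real (m k)) ** B))) =
     (\<Sum>q\<in>UNIV. \<Sum>p\<in>UNIV. \<Sum>l\<in>UNIV. \<Sum>k\<in>UNIV. ?F q p l k)"
    unfolding trace_mult choi_map_rank_one_sum C_def
    by (simp add: sum_distrib_left mult_ac x_def y_def)
  also have "\<dots> = (\<Sum>q\<in>UNIV. \<Sum>l\<in>UNIV. \<Sum>p\<in>UNIV. \<Sum>k\<in>UNIV. ?F q p l k)"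
    by (rule sum.cong[OF refl], rule sum.swap)
  also have "\<dots> = (\<Sum>l\<in>UNIV. \<Sum>q\<in>UNIV. \<Sum>p\<in>UNIV. \<Sum>k\<in>UNIV. ?F q p l k)"
    by (rule sum.swap)
  also have "\<dots> = (\<Sum>l\<in>UNIV. \<Sum>q\<in>UNIV. \<Sum>k\<in>UNIV. \<Sum>p\<in>UNIV. ?F q p l k)"
    by (rule sum.cong[OF refl], rule sum.cong[OF refl], rule sum.swap)
  also have "\<dots> = (\<Sum>l\<in>UNIV. \<Sum>k\<in>UNIV. \<Sum>q\<in>UNIV. \<Sum>p\<in>UNIV. ?F q p l k)"
    by (rule sum.cong[OF refl], rule sum.swap)
  also have "\<dots> = (\<Sum>l\<in>UNIV. \<Sum>k\<in>UNIV. C l k * (\<Sum>q\<in>UNIV. (G *v x l k) $ q * cnj (y l k $ q)))"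
    by (simp add: matrix_vector_mult_def sum_distrib_left sum_distrib_right mult_ac)
  also have "cmod \<dots> \<le> (\<Sum>l\<in>UNIV. \<Sum>k\<in>UNIV. real CARD('a) * n l * m k * ((norm (x l k))\<^sup>2 / 2 + (norm (y l k))\<^sup>2 / 2))"
  proof (rule sum_norm_le, rule sum_norm_le)
    fix l k
    have "cmod (\<Sum>q\<in>UNIV. (G *v x l k) $ q * cnj (y l k $ q)) \<le> norm (G *v x l k) * norm (y l k)"
      by (rule cmod_sum_cnj_le)
    also have "\<dots> \<le> norm (x l k) * norm (y l k)"
      using G by (intro mult_right_mono) (auto simp: contraction_def)
    also have "\<dots> \<le> (norm (x l k))\<^sup>2 / 2 + (norm (y l k))\<^sup>2 / 2"
      using sum_squares_bound[of "norm (x l k)" "norm (y l k)"] by simp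
    finally have "cmod (\<Sum>q\<in>UNIV. (G *v x l k) $ q * cnj (y l k $ q)) \<le> (norm (x l k))\<^sup>2 / 2 + (norm (y l k))\<^sup>2 / 2" .
    moreover have "cmod (C l k) = real CARD('a) * n l * m k"
      using m n by (simp add: C_def norm_mult)
    ultimately show "cmod (C l k * (\<Sum>q\<in>UNIV. (G *v x l k) $ q * cnj (y l k $ q))) \<le>
      real CARD('a) * n l * m k * ((norm (x l k))\<^sup>2 / 2 + (norm (y l k))\<^sup>2 / 2)"
      unfolding norm_mult using m n by (intro mult_mono) auto
  qed
  finally show ?thesis by (simp add: x_def y_def)
qed

text \<open>Provides the finite nets behind the measurable choice in
  \<open>integral_trnorm_le\<close>.\<close>

lemma compact_contractions: "compact {A :: complex^'n::finite^'m::finite. contraction A}"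
proof -
  have cl: "closed {A :: complex^'n^'m. norm (A *v x) \<le> norm x}" for x
  proof -
    have c: "continuous_on UNIV (\<lambda>A :: complex^'n^'m. norm (A *v x))"
    proof (rule continuous_on_norm)
      have "continuous_on UNIV (\<lambda>A :: complex^'n^'m. \<chi> i. \<Sum>j\<in>UNIV. A $ i $ j * x $ j)"
        by (intro continuous_on_vec_lambda continuous_on_sum continuous_on_mult continuous_on_const
            continuous_on_matrix_entry continuous_on_id)
      then show "continuous_on UNIV (\<lambda>A :: complex^'n^'m. A *v x)"
        by (simp only: matrix_vector_mult_def)
    qed
    show ?thesis by (rule closed_Collect_le[OF c continuous_on_const])
  qed
  have eq: "{A :: complex^'n^'m. contraction A} = (\<Inter>x. {A. norm (A *v x) \<le> norm x})"
    unfolding contraction_def by blast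
  have "closed {A :: complex^'n^'m. contraction A}"
    unfolding eq by (intro closed_INT ballI cl)
  moreover have "bounded {A :: complex^'n^'m. contraction A}"
    unfolding bounded_iff
  proof (intro exI ballI)
    fix A :: "complex^'n^'m" assume "A \<in> {A. contraction A}"
    then show "norm A \<le> norm (mat 1 :: complex^'n^'n)"
      using norm_contraction_mult[of A "mat 1"] by simp
  qed
  ultimately show ?thesis by (simp add: compact_eq_bounded_closed)
qed

context haar
begin

text \<open>The squared norm is linear in the matrices \<open>conj_by U (N e)\<close>, so the first
  moment determines its mean. The division by the dimension cancels the dimension factor in
  \<open>choi_map\<close>.\<close>

lemma integral_norm_contract_vec:
  "(\<integral>U. (norm (contract_vec w v U :: complex^('c::finite \<times> 'e::finite)))\<^sup>2 \<partial>\<mu>) = (norm w)\<^sup>2 * (norm v)\<^sup>2 / real CARD('n)"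
proof -
  define N where "N = (\<lambda>e. \<chi> i j. v $ (i, e) * cnj (v $ (j, e)))"
  have int: "integrable \<mu> (\<lambda>U. conj_by U M $ a $ b)" for M a b
    by (intro integrable_continuous continuous_conj_by)
  have sq: "of_real ((norm (contract_vec w v U))\<^sup>2) =
      (\<Sum>c\<in>UNIV. \<Sum>e\<in>UNIV. \<Sum>a\<in>UNIV. \<Sum>b\<in>UNIV. (w $ (a, c) * cnj (w $ (b, c))) * conj_by U (N e) $ a $ b)" for U
  proof -
    have N: "(\<Sum>i\<in>UNIV. U $ a $ i * v $ (i, e)) * cnj (\<Sum>j\<in>UNIV. U $ b $ j * v $ (j, e)) = conj_by U (N e) $ a $ b" for a b e
      unfolding conj_by_nth N_def cnj_sum sum_product by (subst sum.swap) (simp add: mult_ac)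
    have "of_real ((norm (contract_vec w v U))\<^sup>2) = (\<Sum>c\<in>UNIV. \<Sum>e\<in>UNIV. contract_vec w v U $ (c, e) * cnj (contract_vec w v U $ (c, e)))"
      by (simp only: norm_vec_sq sum_UNIV_prod of_real_sum complex_norm_square)
    also have "\<dots> = (\<Sum>c\<in>UNIV. \<Sum>e\<in>UNIV. \<Sum>a\<in>UNIV. \<Sum>b\<in>UNIV. (w $ (a, c) * cnj (w $ (b, c))) *
       ((\<Sum>i\<in>UNIV. U $ a $ i * v $ (i, e)) * cnj (\<Sum>j\<in>UNIV. U $ b $ j * v $ (j, e))))"
    proof -
      have "(\<Sum>a\<in>UNIV. f a * g a) * cnj (\<Sum>a\<in>UNIV. f a * g a) =
        (\<Sum>a\<in>UNIV. \<Sum>b\<in>UNIV. (f a * cnj (f b)) * (g a * cnj (g b)))" for f g :: "'n \<Rightarrow> complex"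
        unfolding cnj_sum sum_product by (simp only: complex_cnj_mult mult_ac)
      from this[of "\<lambda>a. w $ (a, _)" "\<lambda>a. \<Sum>i\<in>UNIV. U $ a $ i * v $ (i, _)"]
      show ?thesis by (simp only: contract_vec_def vec_lambda_beta fst_conv snd_conv)
    qed
    finally show ?thesis unfolding N .
  qed
  have tr: "(\<Sum>e\<in>UNIV. trace (N e)) = of_real ((norm v)\<^sup>2)"
    unfolding norm_vec_sq sum_UNIV_prod of_real_sum complex_norm_square
    by (subst sum.swap) (simp add: N_def trace_def)
  have nw: "(\<Sum>c\<in>UNIV. \<Sum>a\<in>UNIV. w $ (a, c) * cnj (w $ (a, c))) = of_real ((norm w)\<^sup>2)"
    unfolding norm_vec_sq sum_UNIV_prod of_real_sum complex_norm_square by (rule sum.swap)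
  have "complex_of_real (\<integral>U. (norm (contract_vec w v U))\<^sup>2 \<partial>\<mu>) = (\<integral>U. of_real ((norm (contract_vec w v U))\<^sup>2) \<partial>\<mu>)"
    by (rule integral_complex_of_real[symmetric])
  also have "\<dots> = (\<Sum>c\<in>UNIV. \<Sum>e\<in>UNIV. \<Sum>a\<in>UNIV. \<Sum>b\<in>UNIV. (w $ (a, c) * cnj (w $ (b, c))) *
      (if a = b then trace (N e) / of_nat CARD('n) else 0))"
    unfolding sq
    by (subst Bochner_Integration.integral_sum,
          intro Bochner_Integration.integrable_sum integrable_mult_right int, rule sum.cong[OF refl])+
        (simp only: integral_mult_right_zero first_moment)
  also have "\<dots> = (\<Sum>c\<in>UNIV. \<Sum>a\<in>UNIV. w $ (a, c) * cnj (w $ (a, c))) * (\<Sum>e\<in>UNIV. trace (N e)) / of_nat CARD('n)"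
    by (simp add: if_distrib[of "\<lambda>x. _ * x"] sum_product sum_divide_distrib sum_distrib_left sum_distrib_right cong: if_cong)
      (rule sum.swap)
  also have "\<dots> = of_real ((norm w)\<^sup>2 * (norm v)\<^sup>2 / real CARD('n))"
    unfolding tr nw by simp
  finally show ?thesis by (simp only: of_real_eq_iff)
qed

text \<open>Averaging the twirl makes the first factor maximally mixed; the mean of the output is
  therefore the product that \<open>decouple\<close> subtracts.\<close>

lemma integral_choi_map:
  fixes Y :: "complex^('n\<times>'c::finite)^('n\<times>'c)" and X :: "complex^('n\<times>'e::finite)^('n\<times>'e)"
  shows "(\<integral>U. trace (G ** choi_map Y (twirl U X)) \<partial>\<mu>) = trace (G ** kron (ptr1 Y) (ptr1 X))"
proof -
  have int: "integrable \<mu> (\<lambda>U. twirl U X $ (a, e) $ (b, f))" for a b e f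
    unfolding twirl_nth by (intro integrable_continuous continuous_conj_by)
  have int': "integrable \<mu> (\<lambda>U. choi_map Y (twirl U X) $ p $ q)" for p q
    unfolding choi_map_def vec_lambda_beta
    by (intro integrable_mult_right Bochner_Integration.integrable_sum int)
  have ch: "(\<integral>U. choi_map Y (twirl U X) $ p $ q \<partial>\<mu>) = kron (ptr1 Y) (ptr1 X) $ p $ q" for p q
  proof -
    have "(\<integral>U. choi_map Y (twirl U X) $ p $ q \<partial>\<mu>) = of_nat CARD('n) *
      (\<Sum>a\<in>UNIV. \<Sum>b\<in>UNIV. Y $ (a, fst p) $ (b, fst q) * (\<integral>U. twirl U X $ (a, snd p) $ (b, snd q) \<partial>\<mu>))"
      unfolding choi_map_def vec_lambda_beta
      by (simp add: int Bochner_Integration.integral_sum Bochner_Integration.integrable_sum)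
    also have "\<dots> = kron (ptr1 Y) (ptr1 X) $ p $ q"
    proof -
      have "of_nat CARD('n) * (\<Sum>a\<in>UNIV. \<Sum>b\<in>UNIV. Y $ (a, fst p) $ (b, fst q) *
          (if a = b then t / of_nat CARD('n) else 0)) = (\<Sum>a\<in>UNIV. Y $ (a, fst p) $ (a, fst q)) * t" for t
        by (simp add: if_distrib[of "\<lambda>x. _ * x"] sum_distrib_left sum_distrib_right cong: if_cong)
      then show ?thesis unfolding twirl_nth first_moment
        by (simp add: kron_nth ptr1_def trace_def block_def)
    qed
    finally show ?thesis .
  qed
  show ?thesis unfolding trace_mult
    by (simp add: int' ch Bochner_Integration.integral_sum Bochner_Integration.integrable_sum)
qed

lemma integral_choi_map_bound:
  fixes A :: "complex^'k::finite^('n\<times>'e::finite)" and A' :: "complex^'l::finite^('n\<times>'c::finite)"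
    and B :: "complex^('n\<times>'e)^'k" and B' :: "complex^('n\<times>'c)^'l"
  assumes m: "\<And>k. m k \<ge> 0" and n: "\<And>l. n l \<ge> 0"
    and A: "contraction A" "contraction B" and A': "contraction A'" "contraction B'"
  shows "(\<integral>U. (\<Sum>l\<in>UNIV. \<Sum>k\<in>UNIV. real CARD('n) * n l * m k *
      ((norm (contract_vec (\<chi> r. A' $ r $ l) (\<chi> r. A $ r $ k) U))\<^sup>2 / 2 +
       (norm (contract_vec (\<chi> r. cnj (B' $ l $ r)) (\<chi> r. cnj (B $ k $ r)) U))\<^sup>2 / 2)) \<partial>\<mu>)
    \<le> (\<Sum>l\<in>UNIV. n l) * (\<Sum>k\<in>UNIV. m k)"
proof -
  have int: "integrable \<mu> (\<lambda>U. (norm (contract_vec w v U :: complex^('c \<times> 'e)))\<^sup>2 / 2)" for w v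
    by (intro integrable_continuous continuous_intros continuous_on_contract_vec) simp
  have le: "(norm w)\<^sup>2 * (norm v)\<^sup>2 / real CARD('n) / 2 \<le> 1 / real CARD('n) / 2"
    if "(norm w)\<^sup>2 \<le> 1" "(norm v)\<^sup>2 \<le> 1" for w :: "complex^('n \<times> 'c)" and v :: "complex^('n \<times> 'e)"
    using mult_mono[OF that] by (intro divide_right_mono) auto
  have cols: "(norm (\<chi> r. A' $ r $ l))\<^sup>2 \<le> 1" "(norm (\<chi> r. A $ r $ k))\<^sup>2 \<le> 1"
    "(norm (\<chi> r. cnj (B' $ l $ r)))\<^sup>2 \<le> 1" "(norm (\<chi> r. cnj (B $ k $ r)))\<^sup>2 \<le> 1" for l k
    using contraction_col[OF A(1)] contraction_col[OF A'(1)] contraction_row[OF A(2)] contraction_row[OF A'(2)]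
    by (simp_all add: norm_vec_sq)
  have "(\<integral>U. (\<Sum>l\<in>UNIV. \<Sum>k\<in>UNIV. real CARD('n) * n l * m k *
      ((norm (contract_vec (\<chi> r. A' $ r $ l) (\<chi> r. A $ r $ k) U))\<^sup>2 / 2 +
       (norm (contract_vec (\<chi> r. cnj (B' $ l $ r)) (\<chi> r. cnj (B $ k $ r)) U))\<^sup>2 / 2)) \<partial>\<mu>)
    = (\<Sum>l\<in>UNIV. \<Sum>k\<in>UNIV. real CARD('n) * n l * m k *
      ((norm (\<chi> r. A' $ r $ l))\<^sup>2 * (norm (\<chi> r. A $ r $ k))\<^sup>2 / real CARD('n) / 2 +
       (norm (\<chi> r. cnj (B' $ l $ r)))\<^sup>2 * (norm (\<chi> r. cnj (B $ k $ r)))\<^sup>2 / real CARD('n) / 2))"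
  proof -
    have "(\<integral>U. (\<Sum>l\<in>UNIV. \<Sum>k\<in>UNIV. c l k * (f l k U + g l k U)) \<partial>\<mu>) =
        (\<Sum>l\<in>UNIV. \<Sum>k\<in>UNIV. c l k * ((\<integral>U. f l k U \<partial>\<mu>) + (\<integral>U. g l k U \<partial>\<mu>)))"
      if "\<And>l k. integrable \<mu> (f l k)" "\<And>l k. integrable \<mu> (g l k)"
      for c :: "'l \<Rightarrow> 'k \<Rightarrow> real" and f g :: "'l \<Rightarrow> 'k \<Rightarrow> complex^'n^'n \<Rightarrow> real"
      using that by (simp add: Bochner_Integration.integral_sum Bochner_Integration.integrable_sum)
    note this[of "\<lambda>l k U. (norm (contract_vec (\<chi> r. A' $ r $ l) (\<chi> r. A $ r $ k) U :: complex^('c\<times>'e)))\<^sup>2 / 2"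
        "\<lambda>l k U. (norm (contract_vec (\<chi> r. cnj (B' $ l $ r)) (\<chi> r. cnj (B $ k $ r)) U :: complex^('c\<times>'e)))\<^sup>2 / 2"
        "\<lambda>l k. real CARD('n) * n l * m k", OF int int]
    then show ?thesis by (simp only: integral_divide_zero integral_norm_contract_vec)
  qed
  also have "\<dots> \<le> (\<Sum>l\<in>UNIV. \<Sum>k\<in>UNIV. real CARD('n) * n l * m k * (1 / real CARD('n) / 2 + 1 / real CARD('n) / 2))"
    using m n by (intro sum_mono mult_left_mono add_mono le cols mult_nonneg_nonneg) auto
  also have "\<dots> = (\<Sum>l\<in>UNIV. n l) * (\<Sum>k\<in>UNIV. m k)"
    by (simp add: sum_product)
  finally show ?thesis .
qed

text \<open>A nonnegative diagonal between two contractions is the form that the families take on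
  the left edge, with the sum of the diagonal as bound on the trace norm. The factor 2 comes from
  the triangle inequality: one share for the output, one for its mean.\<close>

lemma edge_zero:
  fixes A :: "complex^'k::finite^('n\<times>'e::finite)" and A' :: "complex^'l::finite^('n\<times>'c::finite)"
  assumes m: "\<And>k. m k \<ge> 0" and n: "\<And>l. n l \<ge> 0"
    and A: "contraction A" "contraction B" and A': "contraction A'" "contraction B'"
    and G: "\<And>U. contraction (G U)"
  shows "cmod (\<integral>U. trace (G U ** decouple (A' ** diag_mat (\<lambda>l. of_real (n l)) ** B') (A ** diag_mat (\<lambda>k. of_real (m k)) ** B) U) \<partial>\<mu>)
    \<le> 2 * ((\<Sum>l\<in>UNIV. n l) * (\<Sum>k\<in>UNIV. m k))"
proof -
  let ?Y = "A' ** diag_mat (\<lambda>l. complex_of_real (n l)) ** B'" and ?X = "A ** diag_mat (\<lambda>k. complex_of_real (m k)) ** B"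
  define b where "b = (\<lambda>U. \<Sum>l\<in>UNIV. \<Sum>k\<in>UNIV. real CARD('n) * n l * m k *
      ((norm (contract_vec (\<chi> r. A' $ r $ l) (\<chi> r. A $ r $ k) U :: complex^('c\<times>'e)))\<^sup>2 / 2 +
       (norm (contract_vec (\<chi> r. cnj (B' $ l $ r)) (\<chi> r. cnj (B $ k $ r)) U :: complex^('c\<times>'e)))\<^sup>2 / 2))"
  have ib: "integrable \<mu> b" unfolding b_def
    by (intro integrable_continuous continuous_intros continuous_on_contract_vec) simp_all
  have Ib: "(\<integral>U. b U \<partial>\<mu>) \<le> (\<Sum>l\<in>UNIV. n l) * (\<Sum>k\<in>UNIV. m k)"
    unfolding b_def by (rule integral_choi_map_bound[OF m n A A'])
  have ch: "cmod (trace (H ** choi_map ?Y (twirl U ?X))) \<le> b U" if "contraction H" for H U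
    unfolding b_def by (rule trace_choi_map_le[OF that m n])
  have b0: "b U \<ge> 0" for U using ch[of "mat 1" U] norm_ge_zero order_trans contraction_mat_1 by blast
  have s0: "(\<Sum>l\<in>UNIV. n l) * (\<Sum>k\<in>UNIV. m k) \<ge> 0" using m n by (simp add: sum_nonneg)
  \<comment> \<open>The product term is the mean of the channel term, so the same integrand
    \<open>b\<close> bounds it.\<close>
  have prod: "cmod (trace (H ** kron (ptr1 ?Y) (ptr1 ?X))) \<le> (\<Sum>l\<in>UNIV. n l) * (\<Sum>k\<in>UNIV. m k)"
    if "contraction H" for H
  proof -
    have "cmod (trace (H ** kron (ptr1 ?Y) (ptr1 ?X))) \<le> (\<integral>U. cmod (trace (H ** choi_map ?Y (twirl U ?X))) \<partial>\<mu>)"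
      unfolding integral_choi_map[symmetric] by (rule integral_norm_bound)
    also have "\<dots> \<le> (\<integral>U. b U \<partial>\<mu>)"
      by (rule integral_mono_AE') (auto simp: ib ch[OF that] b0)
    finally show ?thesis using Ib by linarith
  qed
  have "cmod (\<integral>U. trace (G U ** decouple ?Y ?X U) \<partial>\<mu>) \<le> (\<integral>U. cmod (trace (G U ** decouple ?Y ?X U)) \<partial>\<mu>)"
    by (rule integral_norm_bound)
  also have "\<dots> \<le> (\<integral>U. b U + (\<Sum>l\<in>UNIV. n l) * (\<Sum>k\<in>UNIV. m k) \<partial>\<mu>)"
  proof (rule integral_mono_AE')
    have "cmod (trace (G U ** decouple ?Y ?X U)) \<le> b U + (\<Sum>l\<in>UNIV. n l) * (\<Sum>k\<in>UNIV. m k)" for U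
    proof -
      have "trace (G U ** decouple ?Y ?X U) = trace (G U ** choi_map ?Y (twirl U ?X)) - trace (G U ** kron (ptr1 ?Y) (ptr1 ?X))"
        by (simp add: decouple_def matrix_diff_left trace_sub)
      then show ?thesis using ch[OF G, of U U] prod[OF G, of U] norm_triangle_ineq4 by (smt (verit))
    qed
    then show "AE U in \<mu>. cmod (trace (G U ** decouple ?Y ?X U)) \<le> b U + (\<Sum>l\<in>UNIV. n l) * (\<Sum>k\<in>UNIV. m k)" by simp
  qed (auto simp: ib b0 s0)
  also have "\<dots> = (\<integral>U. b U \<partial>\<mu>) + (\<Sum>l\<in>UNIV. n l) * (\<Sum>k\<in>UNIV. m k)"
    by (simp add: ib prob_space)
  also have "\<dots> \<le> 2 * ((\<Sum>l\<in>UNIV. n l) * (\<Sum>k\<in>UNIV. m k))" using Ib by (simp add: mult.commute)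
  finally show ?thesis .
qed

lemma integral_norm_decouple:
  fixes Y :: "complex^('n\<times>'c::finite)^('n\<times>'c)" and X :: "complex^('n\<times>'e::finite)^('n\<times>'e)"
  shows "(\<integral>U. norm (decouple Y X U) \<partial>\<mu>) \<le> 2 / sqrt 3 * (norm X * norm Y)"
proof -
  have i1: "integrable \<mu> (\<lambda>U. norm (decouple Y X U))"
    by (intro integrable_continuous continuous_intros continuous_on_decouple)
  have i2: "integrable \<mu> (\<lambda>U. (norm (decouple Y X U))\<^sup>2)"
    by (intro integrable_continuous continuous_intros continuous_on_decouple)
  have int: "integrable \<mu> (\<lambda>U. (cmod (decouple Y X U $ p $ q))\<^sup>2)" for p q
    by (intro integrable_continuous continuous_intros continuous_on_decouple)
  have "(\<integral>U. (norm (decouple Y X U))\<^sup>2 \<partial>\<mu>) = (\<Sum>p\<in>UNIV. \<Sum>q\<in>UNIV. (\<integral>U. (cmod (decouple Y X U $ p $ q))\<^sup>2 \<partial>\<mu>))"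
    unfolding frobenius_norm by (simp add: int Bochner_Integration.integral_sum Bochner_Integration.integrable_sum)
  also have "\<dots> \<le> (\<Sum>p\<in>UNIV. \<Sum>q\<in>UNIV. 4 / 3 * (norm (block_transpose Y (fst p) (fst q)))\<^sup>2 * (norm (block X (snd p) (snd q)))\<^sup>2)"
    unfolding decouple_nth by (intro sum_mono second_moment_le)
  also have "\<dots> = (\<Sum>c\<in>UNIV. \<Sum>e\<in>UNIV. \<Sum>c'\<in>UNIV. \<Sum>e'\<in>UNIV. 4 / 3 * ((norm (block Y c c'))\<^sup>2 * (norm (block X e e'))\<^sup>2))"
    by (simp add: sum_UNIV_prod norm_block_transpose mult.assoc)
  also have "\<dots> = 4 / 3 * ((\<Sum>c\<in>UNIV. \<Sum>c'\<in>UNIV. (norm (block Y c c'))\<^sup>2) * (\<Sum>e\<in>UNIV. \<Sum>e'\<in>UNIV. (norm (block X e e'))\<^sup>2))"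
    unfolding sum_product unfolding sum_distrib_left ..
  also have "\<dots> = 4 / 3 * ((norm Y)\<^sup>2 * (norm X)\<^sup>2)" by (simp only: norm_block_sum)
  finally have sq: "(\<integral>U. (norm (decouple Y X U))\<^sup>2 \<partial>\<mu>) \<le> 4 / 3 * ((norm Y)\<^sup>2 * (norm X)\<^sup>2)" .
  define c where "c = (\<integral>U. norm (decouple Y X U) \<partial>\<mu>)"
  \<comment> \<open>The variance is nonnegative: this is Jensen's inequality for the square.\<close>
  have "0 \<le> (\<integral>U. (norm (decouple Y X U) - c)\<^sup>2 \<partial>\<mu>)" by simp
  also have "\<dots> = (\<integral>U. (norm (decouple Y X U))\<^sup>2 - 2 * c * norm (decouple Y X U) + c\<^sup>2 \<partial>\<mu>)"
    by (simp add: power2_diff algebra_simps)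
  also have "\<dots> = (\<integral>U. (norm (decouple Y X U))\<^sup>2 \<partial>\<mu>) - 2 * c * c + c\<^sup>2"
    by (simp add: i1 i2 prob_space c_def)
  finally have "c\<^sup>2 \<le> 4 / 3 * ((norm Y)\<^sup>2 * (norm X)\<^sup>2)" using sq by (simp add: power2_eq_square)
  also have "\<dots> = (2 / sqrt 3 * (norm X * norm Y))\<^sup>2" by (simp add: power_mult_distrib power_divide)
  finally show ?thesis unfolding c_def by (rule power2_le_imp_le) simp
qed

text \<open>The weights leave \<open>decouple\<close> as one factor \<open>K\<close> on each side
  and move onto \<open>G\<close> by cyclicity of the trace. By \<open>norm_weighted_le\<close> the
  matrix \<open>K ** G U ** K\<close> has Hilbert-Schmidt norm at most 1, and what remains is the
  second moment bound.\<close>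

lemma edge_one:
  fixes Y :: "complex^('n\<times>'c::finite)^('n\<times>'c)" and X :: "complex^('n\<times>'e::finite)^('n\<times>'e)"
  assumes V: "unitary_mat V" "unitary_mat W"
    and g: "(\<Sum>i\<in>UNIV. (cmod (g i))^4) \<le> 1" and h: "(\<Sum>i\<in>UNIV. (cmod (h i))^4) \<le> 1"
    and G: "\<And>U. contraction (G U)"
  shows "cmod (\<integral>U. trace (G U ** decouple (kron (mat 1) (spectral V g) ** Y ** kron (mat 1) (spectral V g))
      (kron (mat 1) (spectral W h) ** X ** kron (mat 1) (spectral W h)) U) \<partial>\<mu>) \<le> 2 / sqrt 3 * (norm X * norm Y)"
proof -
  define K where "K = kron (spectral V g) (spectral W h)"
  have K: "K = spectral (kron V W) (\<lambda>p. g (fst p) * h (snd p))" by (simp add: K_def kron_spectral)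
  have "(\<Sum>p\<in>UNIV. (cmod (g (fst p) * h (snd p)))^4) = (\<Sum>i\<in>UNIV. (cmod (g i))^4) * (\<Sum>i\<in>UNIV. (cmod (h i))^4)"
    by (simp add: sum_UNIV_prod sum_product norm_mult power_mult_distrib)
  also have "\<dots> \<le> 1 * 1" using g h by (intro mult_mono sum_nonneg) auto
  finally have gh: "(\<Sum>p\<in>UNIV. (cmod (g (fst p) * h (snd p)))^4) \<le> 1" by simp
  have KG: "norm (K ** H ** K) \<le> 1" if "contraction H" for H
  proof -
    have "(norm (K ** H ** K))\<^sup>2 \<le> 1\<^sup>2"
      using norm_weighted_le[OF that unitary_kron[OF V], of "\<lambda>p. g (fst p) * h (snd p)"] gh
      unfolding K by simp
    then show ?thesis by (rule power2_le_imp_le) simp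
  qed
  have "cmod (\<integral>U. trace (G U ** (K ** decouple Y X U ** K)) \<partial>\<mu>) \<le> (\<integral>U. cmod (trace (G U ** (K ** decouple Y X U ** K))) \<partial>\<mu>)"
    by (rule integral_norm_bound)
  also have "\<dots> \<le> (\<integral>U. norm (decouple Y X U) \<partial>\<mu>)"
  proof (rule integral_mono_AE')
    show "integrable \<mu> (\<lambda>U. norm (decouple Y X U))"
      by (intro integrable_continuous continuous_intros continuous_on_decouple)
    have "cmod (trace (G U ** (K ** decouple Y X U ** K))) \<le> norm (decouple Y X U)" for U
    proof -
      have "trace (G U ** (K ** decouple Y X U ** K)) = trace ((G U ** (K ** decouple Y X U)) ** K)"
        by (simp add: matrix_mul_assoc)
      also have "\<dots> = trace (K ** (G U ** (K ** decouple Y X U)))" by (rule trace_comm)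
      finally have "cmod (trace (G U ** (K ** decouple Y X U ** K))) = cmod (trace ((K ** G U ** K) ** decouple Y X U))"
        by (simp add: matrix_mul_assoc)
      also have "\<dots> \<le> norm (K ** G U ** K) * norm (decouple Y X U)" by (rule norm_trace_mult_le)
      also have "\<dots> \<le> 1 * norm (decouple Y X U)" by (intro mult_right_mono KG G) simp
      finally show ?thesis by simp
    qed
    then show "AE U in \<mu>. cmod (trace (G U ** (K ** decouple Y X U ** K))) \<le> norm (decouple Y X U)" by simp
  qed simp
  also have "\<dots> \<le> 2 / sqrt 3 * (norm X * norm Y)" by (rule integral_norm_decouple)
  finally show ?thesis unfolding decouple_weighted K_def .
qed

text \<open>The integrand is a polynomial in the entries of \<open>Y z\<close> and
  \<open>X z\<close> whose coefficients depend on \<open>U\<close> only. Integrating these bounded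
  measurable coefficients leaves a finite sum of holomorphic functions.\<close>

lemma holomorphic_integral_decouple:
  fixes Y :: "complex \<Rightarrow> complex^('n\<times>'c::finite)^('n\<times>'c)" and X :: "complex \<Rightarrow> complex^('n\<times>'e::finite)^('n\<times>'e)"
  assumes G: "G \<in> borel_measurable \<mu>" "\<And>U. contraction (G U)"
    and X: "\<And>p q. (\<lambda>z. X z $ p $ q) holomorphic_on S" and Y: "\<And>p q. (\<lambda>z. Y z $ p $ q) holomorphic_on S"
  shows "(\<lambda>z. \<integral>U. trace (G U ** decouple (Y z) (X z) U) \<partial>\<mu>) holomorphic_on S"
proof -
  have mG: "(\<lambda>U. G U $ p $ q) \<in> borel_measurable \<mu>" for p q
    by (rule measurable_compose[OF G(1)]) (intro borel_measurable_continuous_onI continuous_intros)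
  have nG: "cmod (G U $ p $ q) \<le> 1" for U p q by (rule contraction_entry[OF G(2)])
  have iG: "integrable \<mu> (\<lambda>U. G U $ p $ q)" for p q
    by (rule integrable_const_bound[of _ 1]) (auto simp: nG mG)
  have i: "integrable \<mu> (\<lambda>U. G U $ p $ q * (U $ a $ i * cnj (U $ b $ j)))" for p q a i b j
  proof (rule integrable_const_bound[of _ 1])
    show "AE U in \<mu>. norm (G U $ p $ q * (U $ a $ i * cnj (U $ b $ j))) \<le> 1"
      using AE_unitary
    proof eventually_elim
      case (elim U)
      then have "cmod (U $ a $ i) \<le> 1" "cmod (U $ b $ j) \<le> 1"
        by (simp_all add: contraction_entry unitary_contraction)
      then have "cmod (G U $ p $ q) * (cmod (U $ a $ i) * cmod (U $ b $ j)) \<le> 1 * (1 * 1)"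
        using nG by (intro mult_mono) auto
      then show ?case by (simp add: norm_mult)
    qed
    show "(\<lambda>U. G U $ p $ q * (U $ a $ i * cnj (U $ b $ j))) \<in> borel_measurable \<mu>"
      by (intro borel_measurable_times mG measurable_continuous continuous_intros)
  qed
  define h where "h = (\<lambda>p q a i b j. \<integral>U. G U $ p $ q * (U $ a $ i * cnj (U $ b $ j)) \<partial>\<mu>)"
  define k where "k = (\<lambda>p q. \<integral>U. G U $ p $ q \<partial>\<mu>)"
  have pt: "trace (G U ** decouple Y' X' U) = (\<Sum>p\<in>UNIV. \<Sum>q\<in>UNIV.
      (\<Sum>a\<in>UNIV. \<Sum>b\<in>UNIV. \<Sum>j\<in>UNIV. \<Sum>i\<in>UNIV. (of_nat CARD('n) * Y' $ (a, fst q) $ (b, fst p) * X' $ (i, snd q) $ (j, snd p))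
         * (G U $ p $ q * (U $ a $ i * cnj (U $ b $ j))))
      - (ptr1 Y' $ fst q $ fst p * ptr1 X' $ snd q $ snd p) * G U $ p $ q)"
    for U and Y' :: "complex^('n\<times>'c)^('n\<times>'c)" and X' :: "complex^('n\<times>'e)^('n\<times>'e)"
    unfolding trace_mult
  proof (intro sum.cong refl)
    fix p q :: "'c \<times> 'e"
    have "decouple Y' X' U $ q $ p = (\<Sum>a\<in>UNIV. \<Sum>b\<in>UNIV. \<Sum>j\<in>UNIV. \<Sum>i\<in>UNIV. of_nat CARD('n) * Y' $ (a, fst q) $ (b, fst p) * X' $ (i, snd q) $ (j, snd p)
         * (U $ a $ i * cnj (U $ b $ j))) - ptr1 Y' $ fst q $ fst p * ptr1 X' $ snd q $ snd p"
    proof -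
      have "decouple Y' X' U $ q $ p = of_nat CARD('n) * (\<Sum>a\<in>UNIV. \<Sum>b\<in>UNIV. Y' $ (a, fst q) $ (b, fst p) *
          (\<Sum>j\<in>UNIV. \<Sum>i\<in>UNIV. U $ a $ i * X' $ (i, snd q) $ (j, snd p) * cnj (U $ b $ j)))
          - ptr1 Y' $ fst q $ fst p * ptr1 X' $ snd q $ snd p"
        by (simp add: decouple_def choi_map_def twirl_nth conj_by_nth block_def kron_nth)
      then show ?thesis by (simp only: sum_distrib_left mult_ac)
    qed
    then show "G U $ p $ q * decouple Y' X' U $ q $ p = (\<Sum>a\<in>UNIV. \<Sum>b\<in>UNIV. \<Sum>j\<in>UNIV. \<Sum>i\<in>UNIV. (of_nat CARD('n) * Y' $ (a, fst q) $ (b, fst p) * X' $ (i, snd q) $ (j, snd p))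
         * (G U $ p $ q * (U $ a $ i * cnj (U $ b $ j))))
      - (ptr1 Y' $ fst q $ fst p * ptr1 X' $ snd q $ snd p) * G U $ p $ q"
      by (simp only: right_diff_distrib sum_distrib_left mult_ac)
  qed
  have hi: "has_bochner_integral \<mu> (\<lambda>U. G U $ p $ q * (U $ a $ i * cnj (U $ b $ j))) (h p q a i b j)" for p q a i b j
    unfolding h_def by (rule has_bochner_integral_integrable[OF i])
  have ki: "has_bochner_integral \<mu> (\<lambda>U. G U $ p $ q) (k p q)" for p q
    unfolding k_def by (rule has_bochner_integral_integrable[OF iG])
  have F: "(\<integral>U. trace (G U ** decouple (Y z) (X z) U) \<partial>\<mu>) = (\<Sum>p\<in>UNIV. \<Sum>q\<in>UNIV.
      (\<Sum>a\<in>UNIV. \<Sum>b\<in>UNIV. \<Sum>j\<in>UNIV. \<Sum>i\<in>UNIV. (of_nat CARD('n) * Y z $ (a, fst q) $ (b, fst p) * X z $ (i, snd q) $ (j, snd p))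
         * h p q a i b j)
      - (ptr1 (Y z) $ fst q $ fst p * ptr1 (X z) $ snd q $ snd p) * k p q)" for z
    unfolding pt
    by (rule has_bochner_integral_integral_eq)
      (intro has_bochner_integral_sum has_bochner_integral_diff has_bochner_integral_mult_right hi ki)
  show ?thesis unfolding F ptr1_def vec_lambda_beta by (intro holomorphic_intros X Y)
qed

text \<open>Each new candidate replaces the old choice exactly where it is strictly better. That set
  must be measurable, which is why measurability of the attained value is carried through the
  induction as well.\<close>

lemma measurable_selection:
  fixes D :: "complex^'n^'n \<Rightarrow> complex^'m::finite^'m"
  assumes "finite F" "F \<noteq> {}" and D: "continuous_on UNIV D"
  shows "\<exists>G. G \<in> borel_measurable \<mu> \<and> (\<lambda>U. Re (trace (G U ** D U))) \<in> borel_measurable \<mu> \<and>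
    (\<forall>U. G U \<in> F \<and> (\<forall>g\<in>F. Re (trace (g ** D U)) \<le> Re (trace (G U ** D U))))"
  using assms(1,2)
proof (induction F rule: finite_ne_induct)
  case (singleton g)
  have "(\<lambda>U. Re (trace (g ** D U))) \<in> borel_measurable \<mu>"
    unfolding trace_mult by (intro measurable_continuous continuous_intros D)
  then show ?case by (intro exI[of _ "\<lambda>_. g"]) auto
next
  case (insert g F)
  then obtain G where G: "G \<in> borel_measurable \<mu>" "(\<lambda>U. Re (trace (G U ** D U))) \<in> borel_measurable \<mu>"
    "\<And>U. G U \<in> F" "\<And>U g. g \<in> F \<Longrightarrow> Re (trace (g ** D U)) \<le> Re (trace (G U ** D U))" by blast
  have g: "(\<lambda>U. Re (trace (g ** D U))) \<in> borel_measurable \<mu>"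
    unfolding trace_mult by (intro measurable_continuous continuous_intros D)
  define G' where "G' = (\<lambda>U. if Re (trace (G U ** D U)) < Re (trace (g ** D U)) then g else G U)"
  have P: "{U \<in> space \<mu>. Re (trace (G U ** D U)) < Re (trace (g ** D U))} \<in> sets \<mu>"
    using G(2) g by measurable
  have "G' \<in> borel_measurable \<mu>" unfolding G'_def
    by (rule measurable_If[OF _ G(1) P]) simp
  moreover have "(\<lambda>U. Re (trace (G' U ** D U))) \<in> borel_measurable \<mu>"
  proof -
    have "(\<lambda>U. Re (trace (G' U ** D U))) = (\<lambda>U. if Re (trace (G U ** D U)) < Re (trace (g ** D U))
        then Re (trace (g ** D U)) else Re (trace (G U ** D U)))"
      by (auto simp: G'_def)
    then show ?thesis using measurable_If[OF g G(2) P] by simp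
  qed
  moreover have "G' U \<in> insert g F" for U using G(3) by (simp add: G'_def)
  moreover have "Re (trace (h ** D U)) \<le> Re (trace (G' U ** D U))" if "h \<in> insert g F" for h U
  proof (cases "h = g")
    case True
    then show ?thesis by (simp add: G'_def)
  next
    case False
    then have "Re (trace (h ** D U)) \<le> Re (trace (G U ** D U))" using that by (intro G(4)) simp
    then show ?thesis by (simp add: G'_def)
  qed
  ultimately show ?case by (intro exI[of _ G']) blast
qed

text \<open>Duality \<open>trnorm X = Re (trace (G ** X))\<close> needs a measurable choice of \<open>G\<close>; up to \<open>\<epsilon>\<close> it can be
  made within a finite net of contractions.\<close>

lemma integral_trnorm_le:
  fixes D :: "complex^'n^'n \<Rightarrow> complex^'m::finite^'m"
  assumes D: "continuous_on UNIV D" and K: "K \<ge> 0"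
    and bound: "\<And>G. G \<in> borel_measurable \<mu> \<Longrightarrow> (\<And>U. contraction (G U)) \<Longrightarrow> cmod (\<integral>U. trace (G U ** D U) \<partial>\<mu>) \<le> K"
  shows "(\<integral>U. trnorm (D U) \<partial>\<mu>) \<le> K"
proof (cases "integrable \<mu> (\<lambda>U. trnorm (D U))")
  case False
  \<comment> \<open>The integral of a non-integrable function is 0 by convention, and
    \<open>K \<ge> 0\<close>.\<close>
  then show ?thesis using K by (simp add: not_integrable_integral_eq)
next
  case int: True
  have iD: "integrable \<mu> (\<lambda>U. norm (D U))"
    by (intro integrable_continuous continuous_intros D)
  define I where "I = (\<integral>U. norm (D U) \<partial>\<mu>)"
  have I0: "I \<ge> 0" unfolding I_def by simp
  have eps: "(\<integral>U. trnorm (D U) \<partial>\<mu>) \<le> K + e * I" if e: "e > 0" for e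
  proof -
    \<comment> \<open>\<open>F\<close> is an \<open>e\<close>-net of the contractions: replacing an
      optimal contraction by a net point costs at most \<open>e * norm (D U)\<close>.\<close>
    obtain F where F: "finite F" "F \<subseteq> {A :: complex^'m^'m. contraction A}" "{A :: complex^'m^'m. contraction A} \<subseteq> (\<Union>g\<in>F. ball g e)"
      using seq_compact_imp_totally_bounded[OF compact_imp_seq_compact[OF compact_contractions[where 'n='m and 'm='m]]] e by meson
    have "F \<noteq> {}" using F(3) contraction_mat_1 by blast
    from measurable_selection[OF F(1) this D] obtain G where G: "G \<in> borel_measurable \<mu>" "(\<lambda>U. Re (trace (G U ** D U))) \<in> borel_measurable \<mu>"
      "\<And>U. G U \<in> F" "\<And>U g. g \<in> F \<Longrightarrow> Re (trace (g ** D U)) \<le> Re (trace (G U ** D U))" by blast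
    have cG: "contraction (G U)" for U using G(3) F(2) by blast
    have pt: "trnorm (D U) \<le> Re (trace (G U ** D U)) + e * norm (D U)" for U
    proof -
      obtain H where H: "contraction H" "trnorm (D U) = Re (trace (H ** D U))" by (rule trnorm_attained)
      then obtain g where g: "g \<in> F" "dist g H < e" using F(3) by force
      have "trace (H ** D U) = trace (g ** D U) + trace ((H - g) ** D U)"
        by (simp add: matrix_diff_right trace_sub)
      then have "trnorm (D U) = Re (trace (g ** D U)) + Re (trace ((H - g) ** D U))" using H by simp
      also have "Re (trace ((H - g) ** D U)) \<le> norm (H - g) * norm (D U)"
        using complex_Re_le_cmod norm_trace_mult_le order_trans by blast
      also have "\<dots> \<le> e * norm (D U)" using g by (intro mult_right_mono) (auto simp: dist_norm norm_minus_commute)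
      finally show ?thesis using G(4)[OF g(1), of U] by linarith
    qed
    have iG: "integrable \<mu> (\<lambda>U. trace (G U ** D U))"
    proof (rule Bochner_Integration.integrable_bound)
      show "integrable \<mu> (\<lambda>U. norm (mat 1 :: complex^'m^'m) * norm (D U))" using iD by simp
      have "(\<lambda>U. G U $ p $ q) \<in> borel_measurable \<mu>" for p q
        by (rule measurable_compose[OF G(1)]) (intro borel_measurable_continuous_onI continuous_intros)
      then show "(\<lambda>U. trace (G U ** D U)) \<in> borel_measurable \<mu>"
        unfolding trace_mult by (intro borel_measurable_sum borel_measurable_times
            measurable_continuous[OF continuous_on_matrix_entry[OF D]])
      have "cmod (trace (G U ** D U)) \<le> norm (mat 1 :: complex^'m^'m) * norm (D U)" for U
      proof -
        have "cmod (trace (G U ** D U)) \<le> norm (G U) * norm (D U)" by (rule norm_trace_mult_le)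
        also have "norm (G U) \<le> norm (mat 1 :: complex^'m^'m)" using norm_contraction_mult[OF cG, of U "mat 1"] by simp
        finally show ?thesis by (simp add: mult_right_mono)
      qed
      then show "AE U in \<mu>. cmod (trace (G U ** D U)) \<le> norm (norm (mat 1 :: complex^'m^'m) * norm (D U))" by simp
    qed
    have "(\<integral>U. trnorm (D U) \<partial>\<mu>) \<le> (\<integral>U. Re (trace (G U ** D U)) + e * norm (D U) \<partial>\<mu>)"
      using pt by (intro integral_mono int) (auto simp: iD iG)
    also have "\<dots> = Re (\<integral>U. trace (G U ** D U) \<partial>\<mu>) + e * I"
      by (simp add: iD iG I_def integral_Re)
    also have "Re (\<integral>U. trace (G U ** D U) \<partial>\<mu>) \<le> K"
      using bound[OF G(1) cG] complex_Re_le_cmod order_trans by blast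
    finally show ?thesis by simp
  qed
  show ?thesis
  proof (rule field_le_epsilon)
    fix e :: real assume e: "e > 0"
    \<comment> \<open>The denominator \<open>I + 1\<close> is positive even when \<open>I\<close> is
      0.\<close>
    have "e / (I + 1) * I \<le> e" using e I0 by (simp add: field_simps)
    then show "(\<integral>U. trnorm (D U) \<partial>\<mu>) \<le> K + e" using eps[of "e / (I + 1)"] e I0 by (simp add: add_nonneg_pos)
  qed
qed

end

section \<open>Interpolation\<close>

lemma cpow_0: "cpow x 0 = (if x > 0 then 1 else 0)"
  by (simp add: cpow_def)

lemma norm_cpow_imaginary: "Re z = 0 \<Longrightarrow> cmod (cpow x z) \<le> 1"
  by (simp add: norm_cpow)

lemma mpow_spectral:
  assumes "unitary_mat U" "A = sreal U l"
  shows "mpow t A = spow U l (of_real t)"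
  unfolding mpow_def mfun_spectral[OF assms] cpow_of_real ..

lemma kron_mat_1_spectral:
  "kron (mat 1 :: complex^'a::finite^'a) (spectral V g) = spectral (kron (mat 1) V) (\<lambda>p. g (snd p))"
proof -
  have "spectral (mat 1 :: complex^'a^'a) (\<lambda>_. 1) = mat 1" by (simp add: spectral_def diag_mat_one)
  then show ?thesis using kron_spectral[of "mat 1 :: complex^'a^'a" "\<lambda>_. 1" V g] by simp
qed

lemma unitary_kron_mat_1: "unitary_mat V \<Longrightarrow> unitary_mat (kron (mat 1) V)"
  by (intro unitary_kron) (simp_all add: unitary_mat_def)

lemma matrix_vector_mult_0_right_matrix:
  fixes A :: "complex^'n::finite^'m::finite"
  assumes "\<And>x. A *v x = 0" shows "A = 0"
  using assms by (metis matrix_eq matrix_vector_mult_0)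

text \<open>\<open>spow U l 0\<close> is the support projection of \<open>sreal U l\<close>; its
  complement maps into the kernel, which \<rho> annihilates.\<close>

lemma support_projection:
  fixes \<rho> :: "complex^'n::finite^'n"
  assumes U: "unitary_mat U" and l: "\<And>i. l i \<ge> 0" and h: "cadj \<rho> = \<rho>"
    and supp: "\<And>v. sreal U l *v v = 0 \<Longrightarrow> \<rho> *v v = 0"
  shows "\<rho> ** spow U l 0 = \<rho>" "spow U l 0 ** \<rho> = \<rho>"
proof -
  let ?P = "spow U l 0" and ?S = "sreal U l"
  have "complex_of_real (l i) * cpow (l i) 0 = of_real (l i)" for i
    using l[of i] by (simp add: cpow_0)
  then have "(\<lambda>i. complex_of_real (l i) * cpow (l i) 0) = (\<lambda>i. of_real (l i))" by blast
  then have "?S ** ?P = ?S" by (simp only: spectral_mult[OF U])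
  then have "?S ** (mat 1 - ?P) = 0" by (simp add: matrix_diff_left)
  then have "\<rho> *v ((mat 1 - ?P) *v x) = 0" for x
    by (intro supp) (simp add: matrix_vector_mul_assoc)
  then have "\<rho> ** (mat 1 - ?P) = 0"
    by (intro matrix_vector_mult_0_right_matrix) (simp add: matrix_vector_mul_assoc)
  then show 1: "\<rho> ** ?P = \<rho>" by (simp add: matrix_diff_left)
  have "cadj ?P = ?P" by (simp add: cadj_spectral cnj_cpow)
  then show "?P ** \<rho> = \<rho>" using arg_cong[OF 1, of cadj] by (simp add: cadj_mult h)
qed

text \<open>Opposite powers multiply to the support projection only; the inclusion of kernels makes
  that projection act as the identity on \<rho>.\<close>

lemma sandwich_inverse:
  fixes \<rho> :: "complex^'n::finite^'n"
  assumes U: "unitary_mat U" and l: "\<And>i. l i \<ge> 0" and h: "cadj \<rho> = \<rho>"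
    and supp: "\<And>v. sreal U l *v v = 0 \<Longrightarrow> \<rho> *v v = 0"
  shows "spow U l (- w) ** (spow U l w ** \<rho> ** spow U l w) ** spow U l (- w) = \<rho>"
proof -
  have "spow U l (- w) ** (spow U l w ** \<rho> ** spow U l w) ** spow U l (- w)
    = (spow U l (- w) ** spow U l w) ** \<rho> ** (spow U l w ** spow U l (- w))"
    by (simp add: matrix_mul_assoc)
  also have "\<dots> = spow U l 0 ** \<rho> ** spow U l 0"
    by (simp add: spectral_mult[OF U] cpow_add[symmetric])
  finally show ?thesis using support_projection[OF assms] by (simp add: matrix_mul_assoc[symmetric])
qed

definition sandwiched_Q :: "real \<Rightarrow> complex^'n::finite^'n \<Rightarrow> complex^'n^'n \<Rightarrow> real" where
  "sandwiched_Q \<alpha> \<rho> \<sigma> = Re (trace (mpow \<alpha> (mpow ((1 - \<alpha>) / (2 * \<alpha>)) \<sigma> ** \<rho> ** mpow ((1 - \<alpha>) / (2 * \<alpha>)) \<sigma>)))"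

text \<open>Collects the spectral data of the sandwiched operator. Strict positivity, required for
  the logarithm, holds because a vanishing trace would force every \<open>m k\<close> to be 0 and
  then, by undoing the sandwich, \<rho> itself.\<close>

lemma sandwich_diagonalizable:
  fixes \<rho> :: "complex^'n::finite^'n" and \<alpha> :: real
  assumes \<rho>: "density \<rho>" and U: "unitary_mat U" and l: "\<And>i. l i \<ge> 0"
    and supp: "\<And>v. sreal U l *v v = 0 \<Longrightarrow> \<rho> *v v = 0"
  defines "s \<equiv> complex_of_real ((1 - \<alpha>) / (2 * \<alpha>))"
  obtains W m where "unitary_mat W" "\<And>k. m k \<ge> 0"
    "spow U l s ** \<rho> ** spow U l s = sreal W m"
    "sandwiched_Q \<alpha> \<rho> (sreal U l) = (\<Sum>k\<in>UNIV. Re (cpow (m k) (of_real \<alpha>)))"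
    "sandwiched_Q \<alpha> \<rho> (sreal U l) > 0"
    "spow U l (- s) ** sreal W m ** spow U l (- s) = \<rho>"
proof -
  define M where "M = spow U l s ** \<rho> ** spow U l s"
  have h: "cadj \<rho> = \<rho>" using \<rho> by (auto simp: density_def intro: psd_hermitian)
  have "psd M" unfolding M_def
    using psd_congruence[of \<rho> "spow U l s"] \<rho> by (simp add: s_def cadj_spectral cnj_cpow density_def)
  then obtain W m where W: "unitary_mat W" "M = sreal W m" "\<And>k. m k \<ge> 0"
    using psd_diagonalizable by blast
  have Q: "sandwiched_Q \<alpha> \<rho> (sreal U l) = (\<Sum>k\<in>UNIV. Re (cpow (m k) (of_real \<alpha>)))"
    unfolding sandwiched_Q_def mpow_spectral[OF U refl] s_def[symmetric] M_def[symmetric]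
    by (simp add: mpow_spectral[OF W(1,2)] trace_spectral[OF W(1)])
  have inv: "spow U l (- s) ** M ** spow U l (- s) = \<rho>"
    unfolding M_def by (rule sandwich_inverse[OF U l h supp])
  have nn: "Re (cpow (m k) (of_real \<alpha>)) \<ge> 0" for k by (simp add: cpow_of_real)
  have pos: "(\<Sum>k\<in>UNIV. Re (cpow (m k) (of_real \<alpha>))) > 0"
  proof (rule ccontr)
    assume "\<not> ?thesis"
    then have "(\<Sum>k\<in>UNIV. Re (cpow (m k) (of_real \<alpha>))) = 0" by (meson nn not_less order_antisym sum_nonneg)
    then have z: "Re (cpow (m k) (of_real \<alpha>)) = 0" for k using nn by (simp add: sum_nonneg_eq_0_iff)
    have "m k \<le> 0" for k
    proof (rule ccontr)
      assume "\<not> m k \<le> 0"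
      then show False using z[of k] by (simp add: cpow_of_real)
    qed
    then have "m k = 0" for k using W(3)[of k] by (simp add: antisym)
    then have "M = 0" unfolding W(2) by (simp add: vec_eq_iff spectral_nth)
    then have "\<rho> = 0" using inv by simp
    then show False using \<rho> by (simp add: density_def trace_def)
  qed
  show ?thesis
    by (rule that[OF W(1) W(3)]) (use inv W(2) Q pos in \<open>simp_all add: M_def\<close>)
qed

lemma norm_spectral_le:
  assumes "unitary_mat U" "\<And>i. cmod (g i) \<le> b i" shows "norm (spectral U g) \<le> sqrt (\<Sum>i\<in>UNIV. (b i)\<^sup>2)"
proof (rule real_le_rsqrt)
  show "(norm (spectral U g))\<^sup>2 \<le> (\<Sum>i\<in>UNIV. (b i)\<^sup>2)"
    unfolding norm_spectral_sq[OF assms(1)] using assms(2) by (intro sum_mono power_mono) auto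
qed

lemma norm_cpow_le:
  assumes "0 \<le> Re z" "Re z \<le> c" shows "cmod (cpow x z) \<le> 1 + x powr c"
proof (cases "x > 1")
  case True
  then have "x powr Re z \<le> x powr c" using assms by (intro powr_mono) auto
  moreover have "cmod (cpow x z) = x powr Re z" using True by (simp add: norm_cpow)
  ultimately show ?thesis by linarith
next
  case False
  show ?thesis
  proof (cases "x > 0")
    case True
    then have "x powr Re z \<le> 1" using False assms by (intro powr_le1) auto
    then show ?thesis by (simp add: norm_cpow add_increasing2)
  qed (simp add: norm_cpow add_nonneg_nonneg)
qed

lemma sum_norm_rows:
  fixes C :: "complex^'n::finite^'m::finite"
  shows "(\<Sum>i\<in>UNIV. (norm (C $ i))\<^sup>2) = (norm C)\<^sup>2"
  by (simp only: frobenius_norm norm_vec_sq)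

lemma norm_matrix_mult_le: "norm (A ** B) \<le> norm A * norm (B :: complex^'k::finite^'n::finite)"
  for A :: "complex^'n^'m::finite"
proof -
  have "(norm (A ** B))\<^sup>2 \<le> (\<Sum>i\<in>UNIV. \<Sum>j\<in>UNIV. (norm (A $ i) * norm (cadj B $ j))\<^sup>2)"
    unfolding frobenius_norm
  proof (intro sum_mono power_mono)
    fix i j
    have "(A ** B) $ i $ j = (\<Sum>k\<in>UNIV. (A $ i) $ k * cnj ((cadj B $ j) $ k))"
      by (simp add: matrix_mult_nth)
    then show "cmod ((A ** B) $ i $ j) \<le> norm (A $ i) * norm (cadj B $ j)"
      using cmod_sum_cnj_le[of "A $ i" "cadj B $ j"] by simp
  qed simp
  also have "\<dots> = (\<Sum>i\<in>UNIV. (norm (A $ i))\<^sup>2) * (\<Sum>j\<in>UNIV. (norm (cadj B $ j))\<^sup>2)"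
    by (simp add: sum_product power_mult_distrib)
  also have "\<dots> = (norm A)\<^sup>2 * (norm (cadj B))\<^sup>2"
    by (simp only: sum_norm_rows)
  finally have "(norm (A ** B))\<^sup>2 \<le> (norm A * norm B)\<^sup>2" by (simp add: power_mult_distrib)
  then show ?thesis by (rule power2_le_imp_le) simp
qed

text \<open>The family \<open>X z = S^(z/4) ** M^(\<alpha>(1 - z/2)) ** S^(z/4)\<close>, where \<open>S = kron (mat 1) \<sigma>\<close> and \<open>M\<close> is the
  sandwiched operator, passes through \<open>\<rho>\<close> at \<open>z = 2 (\<alpha> - 1) / \<alpha>\<close>. On the left
  edge its trace norm, on the right edge its weighted Hilbert-Schmidt norm, is controlled by \<open>Tr M\<^sup>\<alpha>\<close>.\<close>

definition interpolation_family :: "real \<Rightarrow> complex^('a::finite\<times>'e::finite)^('a\<times>'e) \<Rightarrow> real \<Rightarrow>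
    (complex \<Rightarrow> complex^('a\<times>'e)^('a\<times>'e)) \<Rightarrow> bool" where
  "interpolation_family \<alpha> \<rho> Q X \<longleftrightarrow>
    (\<forall>p q. (\<lambda>z. X z $ p $ q) holomorphic_on UNIV) \<and> X (of_real (2 * (\<alpha> - 1) / \<alpha>)) = \<rho> \<and>
    (\<forall>z. Re z = 0 \<longrightarrow> (\<exists>A (n :: 'a \<times> 'e \<Rightarrow> real) B. contraction A \<and> contraction B \<and> (\<forall>k. n k \<ge> 0) \<and>
        (\<Sum>k\<in>UNIV. n k) = Q \<and> X z = A ** diag_mat (\<lambda>k. of_real (n k)) ** B)) \<and>
    (\<forall>z. Re z = 1 \<longrightarrow> (\<exists>V g Z. unitary_mat V \<and> (\<Sum>i\<in>UNIV. (cmod (g i))^4) \<le> 1 \<and> norm Z = sqrt Q \<and>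
        X z = kron (mat 1) (spectral V g) ** Z ** kron (mat 1) (spectral V g))) \<and>
    (\<exists>K. \<forall>z. 0 \<le> Re z \<longrightarrow> Re z \<le> 1 \<longrightarrow> norm (X z) \<le> K)"

lemma interpolation_family_exists:
  fixes \<rho> :: "complex^('a::finite\<times>'e::finite)^('a\<times>'e)"
  assumes \<rho>: "density \<rho>" and \<sigma>: "density \<sigma>" and \<alpha>: "\<alpha> > 1"
    and supp: "\<And>v. kron (mat 1) \<sigma> *v v = 0 \<Longrightarrow> \<rho> *v v = 0"
  defines "Q \<equiv> sandwiched_Q \<alpha> \<rho> (kron (mat 1) \<sigma>)"
  shows "Q > 0 \<and> (\<exists>X. interpolation_family \<alpha> \<rho> Q X)"
proof -
  define s where "s = (1 - \<alpha>) / (2 * \<alpha>)"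
  obtain V l where V: "unitary_mat V" "\<sigma> = sreal V l" "\<And>i. l i \<ge> 0"
    and suml: "(\<Sum>i\<in>UNIV. l i) = 1"
    using density_diagonalizable[OF \<sigma>] by metis
  let ?V = "kron (mat 1 :: complex^'a^'a) V"
  have uV: "unitary_mat ?V" by (rule unitary_kron_mat_1[OF V(1)])
  have S: "kron (mat 1 :: complex^'a^'a) \<sigma> = spectral ?V (\<lambda>p. of_real (l (snd p)))"
    unfolding V(2) by (rule kron_mat_1_spectral)
  have lp: "l (snd p) \<ge> 0" for p :: "'a \<times> 'e" by (rule V(3))
  from supp have supp': "\<And>v. spectral ?V (\<lambda>p. of_real (l (snd p))) *v v = 0 \<Longrightarrow> \<rho> *v v = 0" unfolding S .
  show ?thesis
  proof (rule sandwich_diagonalizable[OF \<rho> uV, where l = "\<lambda>p. l (snd p)" and \<alpha> = \<alpha>, OF lp supp', folded s_def])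
    fix W m
    assume W: "unitary_mat W" "\<And>k. m k \<ge> 0"
      "spectral ?V (\<lambda>p. cpow (l (snd p)) (of_real s)) ** \<rho> ** spectral ?V (\<lambda>p. cpow (l (snd p)) (of_real s)) = sreal W m"
      "sandwiched_Q \<alpha> \<rho> (spectral ?V (\<lambda>p. of_real (l (snd p)))) = (\<Sum>k\<in>UNIV. Re (cpow (m k) (of_real \<alpha>)))"
      "sandwiched_Q \<alpha> \<rho> (spectral ?V (\<lambda>p. of_real (l (snd p)))) > 0"
      "spectral ?V (\<lambda>p. cpow (l (snd p)) (- of_real s)) ** sreal W m ** spectral ?V (\<lambda>p. cpow (l (snd p)) (- of_real s)) = \<rho>"
    have Q: "Q = (\<Sum>k\<in>UNIV. Re (cpow (m k) (of_real \<alpha>)))" using W(4) unfolding Q_def S .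
    define n where "n = (\<lambda>k. Re (cpow (m k) (of_real \<alpha>)))"
    have n: "of_real (n k) = cpow (m k) (of_real \<alpha>)" for k by (simp add: n_def cpow_of_real)
    define X where "X = (\<lambda>z. kron (mat 1) (spow V l (z / 4)) ** spow W m (of_real \<alpha> * (1 - z / 2))
        ** kron (mat 1) (spow V l (z / 4)))"
    have Xsp: "X z = spectral ?V (\<lambda>p. cpow (l (snd p)) (z / 4)) ** spow W m (of_real \<alpha> * (1 - z / 2))
        ** spectral ?V (\<lambda>p. cpow (l (snd p)) (z / 4))" for z
      by (simp add: X_def kron_mat_1_spectral)
    have nn: "\<forall>k. n k \<ge> 0" by (simp add: n_def cpow_of_real)
    have sn: "(\<Sum>k\<in>UNIV. n k) = Q" by (simp add: Q n_def)
    have "interpolation_family \<alpha> \<rho> Q X"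
      unfolding interpolation_family_def
    proof (intro conjI allI impI)
      show "(\<lambda>z. X z $ p $ q) holomorphic_on UNIV" for p q
        unfolding Xsp by (intro holomorphic_matrix_mult holomorphic_spectral holomorphic_intros) simp_all
      \<comment> \<open>At this point the outer powers are inverse to those of the sandwich and, by
        \<open>b\<close>, the middle power has exponent 1, so \<rho> comes back.\<close>
      have a: "of_real (2 * (\<alpha> - 1) / \<alpha>) / 4 = - complex_of_real s"
      proof -
        have "2 * (\<alpha> - 1) / \<alpha> / 4 = - s" using \<alpha> by (simp add: s_def field_simps)
        then have "complex_of_real (2 * (\<alpha> - 1) / \<alpha> / 4) = of_real (- s)" by (rule arg_cong)
        then show ?thesis by simp
      qed
      have b: "of_real \<alpha> * (1 - of_real (2 * (\<alpha> - 1) / \<alpha>) / 2) = (1::complex)"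
      proof -
        have "\<alpha> * (1 - 2 * (\<alpha> - 1) / \<alpha> / 2) = 1" using \<alpha> by (simp add: field_simps)
        then have "complex_of_real (\<alpha> * (1 - 2 * (\<alpha> - 1) / \<alpha> / 2)) = of_real 1" by (rule arg_cong)
        then show ?thesis by simp
      qed
      show "X (of_real (2 * (\<alpha> - 1) / \<alpha>)) = \<rho>"
        unfolding Xsp a b using W(6) by (simp add: cpow_one W(2))
    next
      fix z :: complex assume z: "Re z = 0"
      \<comment> \<open>Imaginary powers are contractions. On this edge the middle power splits into
        an imaginary power and the power \<alpha> of the sandwiched operator, whose eigenvalues
        \<open>n\<close> sum to \<open>Q\<close>.\<close>
      define A where "A = spectral ?V (\<lambda>p. cpow (l (snd p)) (z / 4)) ** (W ** diag_mat (\<lambda>k. cpow (m k) (- (of_real \<alpha> * z / 2))))"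
      define B where "B = cadj W ** spectral ?V (\<lambda>p. cpow (l (snd p)) (z / 4))"
      have "contraction A" unfolding A_def
        by (intro contraction_mult contraction_spectral uV unitary_contraction W contraction_diag_mat norm_cpow_imaginary) (use z in simp_all)
      moreover have "contraction B" unfolding B_def
        by (intro contraction_mult contraction_spectral uV unitary_contraction unitary_cadj W norm_cpow_imaginary) (use z in simp_all)
      moreover have "X z = A ** diag_mat (\<lambda>k. of_real (n k)) ** B"
      proof -
        have "diag_mat (\<lambda>k. cpow (m k) (- (of_real \<alpha> * z / 2))) ** diag_mat (\<lambda>k. of_real (n k)) = diag_mat (\<lambda>k. cpow (m k) (of_real \<alpha> * (1 - z / 2)))"
          unfolding n diag_mat_mult cpow_add[symmetric] by (simp add: algebra_simps)
        then have "spow W m (of_real \<alpha> * (1 - z / 2)) = W ** diag_mat (\<lambda>k. cpow (m k) (- (of_real \<alpha> * z / 2))) ** diag_mat (\<lambda>k. of_real (n k)) ** cadj W"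
          unfolding spectral_def by (simp add: matrix_mul_assoc[symmetric])
        then show ?thesis unfolding Xsp A_def B_def by (simp add: matrix_mul_assoc)
      qed
      ultimately show "\<exists>A (n :: 'a \<times> 'e \<Rightarrow> real) B. contraction A \<and> contraction B \<and> (\<forall>k. n k \<ge> 0) \<and>
          (\<Sum>k\<in>UNIV. n k) = Q \<and> X z = A ** diag_mat (\<lambda>k. of_real (n k)) ** B" using nn sn by blast
    next
      fix z :: complex assume z: "Re z = 1"
      \<comment> \<open>This is the reason for the exponent \<open>z / 4\<close>: on Re z = 1 the
        fourth powers of the weights are the eigenvalues of \<sigma>, which sum to 1.\<close>
      have g: "(cmod (cpow (l i) (z / 4)))^4 = l i" for i
      proof (cases "l i > 0")
        case True
        then have "(l i powr (1 / 4))^4 = l i" by (simp add: powr_realpow[symmetric] powr_powr)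
        then show ?thesis using True z by (simp add: norm_cpow)
      qed (use V(3)[of i] in \<open>simp add: norm_cpow\<close>)
      \<comment> \<open>On Re z = 1 the middle exponent has real part \<open>\<alpha> / 2\<close>,
        so squaring its Hilbert-Schmidt norm gives \<open>Q\<close>.\<close>
      have "(norm (spow W m (of_real \<alpha> * (1 - z / 2))))\<^sup>2 = Q"
        unfolding norm_spectral_sq[OF W(1)] Q
      proof (rule sum.cong[OF refl])
        fix k
        show "(cmod (cpow (m k) (of_real \<alpha> * (1 - z / 2))))\<^sup>2 = Re (cpow (m k) (of_real \<alpha>))"
        proof (cases "m k > 0")
          case True
          have e: "Re (of_real \<alpha> * (1 - z / 2)) = \<alpha> / 2" using z by simp
          have "cmod (cpow (m k) w) = m k powr Re w" for w using True by (simp add: norm_cpow)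
          then have "(cmod (cpow (m k) (of_real \<alpha> * (1 - z / 2))))\<^sup>2 = (m k powr (\<alpha> / 2))\<^sup>2"
            by (simp only: e)
          also have "\<dots> = m k powr \<alpha>" using True by (simp add: powr_realpow[symmetric] powr_powr)
          finally show ?thesis using True by (simp add: cpow_of_real)
        qed (simp add: cpow_def)
      qed
      then have nZ: "norm (spow W m (of_real \<alpha> * (1 - z / 2))) = sqrt Q"
        by (intro real_sqrt_unique[symmetric]) auto
      have sg: "(\<Sum>i\<in>UNIV. (cmod (cpow (l i) (z / 4)))^4) \<le> 1" unfolding g suml by simp
      show "\<exists>V g Z. unitary_mat V \<and> (\<Sum>i\<in>UNIV. (cmod (g i))^4) \<le> 1 \<and> norm Z = sqrt Q \<and>
          X z = kron (mat 1) (spectral V g) ** Z ** kron (mat 1) (spectral V g)"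
        unfolding X_def by (rule exI[of _ V], rule exI[of _ "\<lambda>i. cpow (l i) (z / 4)"],
            rule exI[of _ "spow W m (of_real \<alpha> * (1 - z / 2))"], intro conjI V(1) sg nZ refl)
    next
      define K where "K = sqrt (\<Sum>p\<in>(UNIV::('a\<times>'e) set). (1 + l (snd p) powr 1)\<^sup>2) * sqrt (\<Sum>k\<in>UNIV. (1 + m k powr \<alpha>)\<^sup>2) * sqrt (\<Sum>p\<in>(UNIV::('a\<times>'e) set). (1 + l (snd p) powr 1)\<^sup>2)"
      have "norm (X z) \<le> K" if z: "0 \<le> Re z" "Re z \<le> 1" for z
      proof -
        have "norm (spectral ?V (\<lambda>p. cpow (l (snd p)) (z / 4))) \<le> sqrt (\<Sum>p\<in>(UNIV::('a\<times>'e) set). (1 + l (snd p) powr 1)\<^sup>2)"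
          using z by (intro norm_spectral_le uV norm_cpow_le) auto
        moreover have "norm (spow W m (of_real \<alpha> * (1 - z / 2))) \<le> sqrt (\<Sum>k\<in>UNIV. (1 + m k powr \<alpha>)\<^sup>2)"
        proof (intro norm_spectral_le W norm_cpow_le)
          show "0 \<le> Re (of_real \<alpha> * (1 - z / 2))" using z \<alpha> by simp
          show "Re (of_real \<alpha> * (1 - z / 2)) \<le> \<alpha>" using z \<alpha> by (simp add: field_simps)
        qed
        ultimately have "norm (spectral ?V (\<lambda>p. cpow (l (snd p)) (z / 4))) * norm (spow W m (of_real \<alpha> * (1 - z / 2))) * norm (spectral ?V (\<lambda>p. cpow (l (snd p)) (z / 4)))
          \<le> sqrt (\<Sum>p\<in>(UNIV::('a\<times>'e) set). (1 + l (snd p) powr 1)\<^sup>2) * sqrt (\<Sum>k\<in>UNIV. (1 + m k powr \<alpha>)\<^sup>2) * sqrt (\<Sum>p\<in>(UNIV::('a\<times>'e) set). (1 + l (snd p) powr 1)\<^sup>2)"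
          by (intro mult_mono) (auto simp: sum_nonneg)
        moreover have "norm (X z) \<le> norm (spectral ?V (\<lambda>p. cpow (l (snd p)) (z / 4))) * norm (spow W m (of_real \<alpha> * (1 - z / 2))) * norm (spectral ?V (\<lambda>p. cpow (l (snd p)) (z / 4)))"
          unfolding Xsp by (rule order_trans[OF norm_matrix_mult_le]) (intro mult_right_mono norm_matrix_mult_le norm_ge_zero)
        ultimately show ?thesis by (simp add: K_def)
      qed
      then show "\<exists>K. \<forall>z. 0 \<le> Re z \<longrightarrow> Re z \<le> 1 \<longrightarrow> norm (X z) \<le> K" by blast
    qed
    moreover have "Q > 0" using W(5) unfolding Q_def S .
    ultimately show ?thesis by blast
  qed
qed

context haar
begin

text \<open>A crude bound that serves the boundedness on the strip required by the three lines
  theorem; its constant does not reach the result.\<close>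

lemma integral_trace_decouple_bound:
  fixes Y :: "complex^('n\<times>'c::finite)^('n\<times>'c)" and X :: "complex^('n\<times>'e::finite)^('n\<times>'e)"
  assumes "\<And>U. contraction (G U)"
  shows "cmod (\<integral>U. trace (G U ** decouple Y X U) \<partial>\<mu>) \<le> norm (mat 1 :: complex^('c\<times>'e)^('c\<times>'e)) * (2 / sqrt 3 * (norm X * norm Y))"
proof -
  have "cmod (\<integral>U. trace (G U ** decouple Y X U) \<partial>\<mu>) \<le> (\<integral>U. cmod (trace (G U ** decouple Y X U)) \<partial>\<mu>)"
    by (rule integral_norm_bound)
  also have "\<dots> \<le> (\<integral>U. norm (mat 1 :: complex^('c\<times>'e)^('c\<times>'e)) * norm (decouple Y X U) \<partial>\<mu>)"
  proof (rule integral_mono_AE')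
    show "integrable \<mu> (\<lambda>U. norm (mat 1 :: complex^('c\<times>'e)^('c\<times>'e)) * norm (decouple Y X U))"
      by (intro integrable_continuous continuous_intros continuous_on_decouple)
    have "cmod (trace (G U ** decouple Y X U)) \<le> norm (mat 1 :: complex^('c\<times>'e)^('c\<times>'e)) * norm (decouple Y X U)" for U
    proof -
      have "cmod (trace (G U ** decouple Y X U)) \<le> norm (G U) * norm (decouple Y X U)" by (rule norm_trace_mult_le)
      also have "norm (G U) \<le> norm (mat 1 :: complex^('c\<times>'e)^('c\<times>'e))" using norm_contraction_mult[OF assms, of U "mat 1"] by simp
      finally show ?thesis by (simp add: mult_right_mono)
    qed
    then show "AE U in \<mu>. cmod (trace (G U ** decouple Y X U)) \<le> norm (mat 1 :: complex^('c\<times>'e)^('c\<times>'e)) * norm (decouple Y X U)" by simp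
  qed simp
  also have "\<dots> = norm (mat 1 :: complex^('c\<times>'e)^('c\<times>'e)) * (\<integral>U. norm (decouple Y X U) \<partial>\<mu>)" by simp
  also have "\<dots> \<le> norm (mat 1 :: complex^('c\<times>'e)^('c\<times>'e)) * (2 / sqrt 3 * (norm X * norm Y))"
    by (intro mult_left_mono integral_norm_decouple) simp
  finally show ?thesis .
qed

text \<open>Here \<sigma> and \<tau> are any states with the right supports; the passage to the
  infima over them comes at the end.\<close>

theorem decoupling_bound:
  fixes \<omega> :: "complex^('n\<times>'c::finite)^('n\<times>'c)" and \<rho> :: "complex^('n\<times>'e::finite)^('n\<times>'e)"
  assumes \<rho>: "density \<rho>" and \<omega>: "density \<omega>" and \<sigma>: "density \<sigma>" and \<tau>: "density \<tau>" and \<alpha>: "1 < \<alpha>" "\<alpha> \<le> 2"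
    and supp1: "\<And>v. kron (mat 1) \<sigma> *v v = 0 \<Longrightarrow> \<rho> *v v = 0"
    and supp2: "\<And>v. kron (mat 1) \<tau> *v v = 0 \<Longrightarrow> \<omega> *v v = 0"
  defines "Q \<equiv> sandwiched_Q \<alpha> \<rho> (kron (mat 1) \<sigma>)" and "R \<equiv> sandwiched_Q \<alpha> \<omega> (kron (mat 1) \<tau>)"
  shows "(\<integral>U. trnorm (decouple \<omega> \<rho> U) \<partial>\<mu>) \<le> 2 * exp (1 / \<alpha> * (ln Q + ln R) - (\<alpha> - 1) / \<alpha> * ln 3)"
proof -
  have Q: "Q > 0" and "\<exists>X. interpolation_family \<alpha> \<rho> Q X"
    using interpolation_family_exists[OF \<rho> \<sigma> \<alpha>(1) supp1] unfolding Q_def by auto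
  then obtain X where X: "interpolation_family \<alpha> \<rho> Q X" by blast
  have R: "R > 0" and "\<exists>Y. interpolation_family \<alpha> \<omega> R Y"
    using interpolation_family_exists[OF \<omega> \<tau> \<alpha>(1) supp2] unfolding R_def by auto
  then obtain Y where Y: "interpolation_family \<alpha> \<omega> R Y" by blast
  obtain K K' where K: "\<And>z. 0 \<le> Re z \<Longrightarrow> Re z \<le> 1 \<Longrightarrow> norm (X z) \<le> K"
    and K': "\<And>z. 0 \<le> Re z \<Longrightarrow> Re z \<le> 1 \<Longrightarrow> norm (Y z) \<le> K'"
    using X Y unfolding interpolation_family_def by blast
  define x where "x = 2 * (\<alpha> - 1) / \<alpha>"
  \<comment> \<open>This is where \<alpha> \<le> 2 enters: it says exactly that the point
    \<open>2 * (\<alpha> - 1) / \<alpha>\<close> does not lie beyond the right edge.\<close>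
  have x: "0 \<le> x" "x \<le> 1" using \<alpha> by (auto simp: x_def field_simps)
  \<comment> \<open>Each of \<open>ln Q\<close> and \<open>ln R\<close> receives the coefficient
    \<open>(1 - x) + x / 2 = 1 / \<alpha>\<close>, \<open>ln 2\<close> receives 1 and
    \<open>ln 3\<close> receives \<open>- x / 2\<close>; this is the origin of log 3 in the
    theorem.\<close>
  have rhs: "(2 * (R * Q)) powr (1 - x) * (2 / sqrt 3 * (sqrt Q * sqrt R)) powr x = 2 * exp (1 / \<alpha> * (ln Q + ln R) - (\<alpha> - 1) / \<alpha> * ln 3)"
  proof -
    have l3: "ln (sqrt 3) = ln 3 / (2::real)" by (simp add: ln_sqrt)
    have "ln (2 * (R * Q)) = ln 2 + ln R + ln Q" using Q R by (simp add: ln_mult)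
    moreover have "ln (2 / sqrt 3 * (sqrt Q * sqrt R)) = ln 2 - ln 3 / 2 + ln Q / 2 + ln R / 2"
      using Q R by (simp add: ln_mult ln_div ln_sqrt)
    ultimately have "(2 * (R * Q)) powr (1 - x) * (2 / sqrt 3 * (sqrt Q * sqrt R)) powr x =
        exp ((1 - x) * (ln 2 + ln R + ln Q) + x * (ln 2 - ln 3 / 2 + ln Q / 2 + ln R / 2))"
      using Q R by (simp add: powr_def exp_add)
    also have "(1 - x) * (ln 2 + ln R + ln Q) + x * (ln 2 - ln 3 / 2 + ln Q / 2 + ln R / 2)
        = ln 2 + (1 - x / 2) * (ln Q + ln R) - x / 2 * ln 3"
      by (simp add: algebra_simps)
    also have "x / 2 = (\<alpha> - 1) / \<alpha>" using \<alpha> by (simp add: x_def field_simps)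
    also have "1 - (\<alpha> - 1) / \<alpha> = 1 / \<alpha>" using \<alpha> by (simp add: field_simps)
    finally show ?thesis by (simp add: exp_add exp_diff)
  qed
  show ?thesis
  proof (rule integral_trnorm_le[OF continuous_on_decouple])
    fix G assume G: "G \<in> borel_measurable \<mu>" "\<And>U. contraction (G U :: complex^('c\<times>'e)^('c\<times>'e))"
    define F where "F = (\<lambda>z. \<integral>U. trace (G U ** decouple (Y z) (X z) U) \<partial>\<mu>)"
    have "cmod (F (of_real x)) \<le> (2 * (R * Q)) powr (1 - x) * (2 / sqrt 3 * (sqrt Q * sqrt R)) powr x"
    proof (rule three_lines[where K = "norm (mat 1 :: complex^('c\<times>'e)^('c\<times>'e)) * (2 / sqrt 3 * (K * K'))"])
      show "F holomorphic_on UNIV" unfolding F_def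
      proof (rule holomorphic_integral_decouple[OF G])
        show "(\<lambda>z. X z $ p $ q) holomorphic_on UNIV" "(\<lambda>z. Y z $ p' $ q') holomorphic_on UNIV" for p q p' q'
          using X Y unfolding interpolation_family_def by blast+
      qed
      show "cmod (F z) \<le> norm (mat 1 :: complex^('c\<times>'e)^('c\<times>'e)) * (2 / sqrt 3 * (K * K'))" if z: "0 \<le> Re z" "Re z \<le> 1" for z
      proof -
        have "0 \<le> K" using K[OF z] norm_ge_zero order_trans by blast
        then have "norm (X z) * norm (Y z) \<le> K * K'" using K[OF z] K'[OF z] by (intro mult_mono) auto
        then have "norm (mat 1 :: complex^('c\<times>'e)^('c\<times>'e)) * (2 / sqrt 3 * (norm (X z) * norm (Y z))) \<le> norm (mat 1 :: complex^('c\<times>'e)^('c\<times>'e)) * (2 / sqrt 3 * (K * K'))"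
          by (intro mult_left_mono) auto
        then show ?thesis unfolding F_def using integral_trace_decouple_bound[of G "Y z" "X z", OF G(2)] by linarith
      qed
      show "cmod (F z) \<le> 2 * (R * Q)" if z: "Re z = 0" for z
      proof -
        obtain A n B where A: "contraction A" "contraction B" "\<And>k. n k \<ge> 0" "(\<Sum>k\<in>UNIV. n k) = Q"
          "X z = A ** diag_mat (\<lambda>k :: 'n \<times> 'e. of_real (n k)) ** B"
          using X z unfolding interpolation_family_def by blast
        obtain A' n' B' where A': "contraction A'" "contraction B'" "\<And>k. n' k \<ge> 0" "(\<Sum>k\<in>UNIV. n' k) = R"
          "Y z = A' ** diag_mat (\<lambda>k :: 'n \<times> 'c. of_real (n' k)) ** B'"
          using Y z unfolding interpolation_family_def by blast
        show ?thesis unfolding F_def A(5) A'(5) A(4)[symmetric] A'(4)[symmetric]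
          by (rule edge_zero[OF A(3) A'(3) A(1,2) A'(1,2) G(2)])
      qed
      show "cmod (F z) \<le> 2 / sqrt 3 * (sqrt Q * sqrt R)" if z: "Re z = 1" for z
      proof -
        obtain V g Z where V: "unitary_mat V" "(\<Sum>i\<in>UNIV. (cmod (g i))^4) \<le> 1" "norm Z = sqrt Q"
          "X z = kron (mat 1) (spectral V g) ** Z ** kron (mat 1) (spectral V g)" using X z unfolding interpolation_family_def by blast
        obtain V' g' Z' where V': "unitary_mat V'" "(\<Sum>i\<in>UNIV. (cmod (g' i))^4) \<le> 1" "norm Z' = sqrt R"
          "Y z = kron (mat 1) (spectral V' g') ** Z' ** kron (mat 1) (spectral V' g')" using Y z unfolding interpolation_family_def by blast
        show ?thesis unfolding F_def V(4) V'(4) V(3)[symmetric] V'(3)[symmetric]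
          by (rule edge_one[OF V'(1) V(1) V'(2) V(2) G(2)])
      qed
    qed (use Q R x in simp_all)
    moreover have "X (of_real x) = \<rho>" "Y (of_real x) = \<omega>"
      using X Y unfolding interpolation_family_def x_def by blast+
    ultimately show "cmod (\<integral>U. trace (G U ** decouple \<omega> \<rho> U) \<partial>\<mu>) \<le> 2 * exp (1 / \<alpha> * (ln Q + ln R) - (\<alpha> - 1) / \<alpha> * ln 3)"
      unfolding rhs F_def by simp
  qed simp
qed

text \<open>At \<alpha> = 1 the left edge bound applies directly to the states, whose eigenvalues
  sum to 1.\<close>

lemma decoupling_bound_one:
  fixes \<omega> :: "complex^('n\<times>'c::finite)^('n\<times>'c)" and \<rho> :: "complex^('n\<times>'e::finite)^('n\<times>'e)"
  assumes \<rho>: "density \<rho>" and \<omega>: "density \<omega>"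
  shows "(\<integral>U. trnorm (decouple \<omega> \<rho> U) \<partial>\<mu>) \<le> 2"
proof (rule integral_trnorm_le[OF continuous_on_decouple])
  fix G :: "complex^'n^'n \<Rightarrow> complex^('c\<times>'e)^('c\<times>'e)" assume G: "\<And>U. contraction (G U)"
  obtain V l where V: "unitary_mat V" "\<rho> = sreal V l" "\<And>i. l i \<ge> 0" "(\<Sum>i\<in>UNIV. l i) = 1"
    using density_diagonalizable[OF \<rho>] by metis
  obtain W m where W: "unitary_mat W" "\<omega> = sreal W m" "\<And>i. m i \<ge> 0" "(\<Sum>i\<in>UNIV. m i) = 1"
    using density_diagonalizable[OF \<omega>] by metis
  have "cmod (\<integral>U. trace (G U ** decouple \<omega> \<rho> U) \<partial>\<mu>) \<le> 2 * ((\<Sum>i\<in>UNIV. m i) * (\<Sum>i\<in>UNIV. l i))"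
    unfolding V(2) W(2) spectral_def
    by (intro edge_zero V(3) W(3) unitary_contraction unitary_cadj V(1) W(1) G)
  then show "cmod (\<integral>U. trace (G U ** decouple \<omega> \<rho> U) \<partial>\<mu>) \<le> 2" by (simp add: V(4) W(4))
qed simp

end

section \<open>Choi states\<close>

definition unit_mat :: "'a::finite \<Rightarrow> 'a \<Rightarrow> complex^'a^'a" where
  "unit_mat a b = (\<chi> i j. if i = a \<and> j = b then 1 else 0)"

lemma clinear_map_zero: "clinear_map T \<Longrightarrow> T 0 = 0"
proof -
  assume T: "clinear_map T"
  have "T (\<chi> i j. 0 * (0 :: complex^'a^'a) $ i $ j) = (\<chi> i j. 0 * T 0 $ i $ j)"
    using T unfolding clinear_map_def by blast
  moreover have "(\<chi> i j. 0 * (0 :: complex^'a^'a) $ i $ j) = 0" by (simp add: vec_eq_iff)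
  moreover have "(\<chi> i j. 0 * T 0 $ i $ j) = 0" by (simp add: vec_eq_iff)
  ultimately show ?thesis by simp
qed

lemma clinear_map_sum:
  assumes "clinear_map T" "finite S" shows "T (\<Sum>x\<in>S. f x) = (\<Sum>x\<in>S. T (f x))"
  using assms(2)
proof (induction S rule: finite_induct)
  case (insert x S)
  have "T (f x + sum f S) = T (f x) + T (sum f S)" using assms(1) unfolding clinear_map_def by blast
  then show ?case using insert by simp
qed (simp add: clinear_map_zero assms(1))

lemma clinear_map_expand:
  assumes "clinear_map T"
  shows "T X $ c $ d = (\<Sum>a\<in>UNIV. \<Sum>b\<in>UNIV. X $ a $ b * T (unit_mat a b) $ c $ d)"
proof -
  have "X = (\<Sum>a\<in>UNIV. \<Sum>b\<in>UNIV. (\<chi> i j. X $ a $ b * unit_mat a b $ i $ j))"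
  proof -
    have nth: "X $ i $ j = (\<Sum>a\<in>UNIV. \<Sum>b\<in>UNIV. X $ a $ b * unit_mat a b $ i $ j)" for i j
    proof -
      have "(\<Sum>a\<in>UNIV. \<Sum>b\<in>UNIV. X $ a $ b * unit_mat a b $ i $ j) =
          (\<Sum>a\<in>UNIV. if i = a then (\<Sum>b\<in>UNIV. if j = b then X $ a $ b else 0) else 0)"
        by (rule sum.cong[OF refl]) (simp add: unit_mat_def if_distrib[of "\<lambda>x. _ * x"] cong: if_cong)
      then show ?thesis by simp
    qed
    show ?thesis unfolding vec_eq_iff sum_component vec_lambda_beta using nth by blast
  qed
  then have "T X = T (\<Sum>a\<in>UNIV. \<Sum>b\<in>UNIV. (\<chi> i j. X $ a $ b * unit_mat a b $ i $ j))" by (rule arg_cong)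
  also have "\<dots> = (\<Sum>a\<in>UNIV. \<Sum>b\<in>UNIV. T (\<chi> i j. X $ a $ b * unit_mat a b $ i $ j))"
    by (simp add: clinear_map_sum[OF assms])
  also have "\<dots> = (\<Sum>a\<in>UNIV. \<Sum>b\<in>UNIV. (\<chi> i j. X $ a $ b * T (unit_mat a b) $ i $ j))"
    using assms unfolding clinear_map_def by simp
  finally show ?thesis by simp
qed

lemma choi_state_nth:
  fixes T :: "complex^'a::finite^'a \<Rightarrow> complex^'c::finite^'c"
  assumes "clinear_map T"
  shows "choi_state T $ p $ q = 1 / of_nat CARD('a) * T (unit_mat (fst p) (fst q)) $ snd p $ snd q"
proof -
  have "(\<chi> i j. max_ent $ (fst p, i) $ (fst q, j)) = (\<chi> i j. (1 / of_nat CARD('a)) * unit_mat (fst p) (fst q) $ i $ j)"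
    by (auto simp: vec_eq_iff max_ent_def unit_mat_def)
  moreover have "T (\<chi> i j. (1 / of_nat CARD('a)) * unit_mat (fst p) (fst q) $ i $ j) =
      (\<chi> i j. (1 / of_nat CARD('a)) * T (unit_mat (fst p) (fst q)) $ i $ j)"
    using assms unfolding clinear_map_def by blast
  ultimately show ?thesis by (simp only: choi_state_def id_tensor_def vec_lambda_beta)
qed

text \<open>Expanding \<open>T\<close> over matrix units leaves the entries of the Choi state; the
  dimension factor in \<open>choi_map\<close> undoes the normalization of
  \<open>max_ent\<close>.\<close>

lemma tensor_id_eq_choi_map:
  fixes T :: "complex^'a::finite^'a \<Rightarrow> complex^'c::finite^'c"
  assumes "clinear_map T" shows "tensor_id T M = choi_map (choi_state T) M"
proof -
  have "tensor_id T M $ p $ q = choi_map (choi_state T) M $ p $ q" for p q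
    by (simp add: tensor_id_def clinear_map_expand[OF assms, of "\<chi> i j. _ i j"] choi_map_def choi_state_nth[OF assms]
        sum_distrib_left mult_ac)
  then show ?thesis by (simp add: vec_eq_iff)
qed

text \<open>Complete positivity is stated for ancilla bases \<open>{..<n}\<close>, while the ancilla
  of the Choi state is indexed by the type \<open>'a\<close>; the bijection \<open>h\<close> carries
  one to the other.\<close>

lemma density_choi_state:
  fixes T :: "complex^'a::finite^'a \<Rightarrow> complex^'c::finite^'c"
  assumes T: "quantum_channel T" shows "density (choi_state T)"
proof -
  have lin: "clinear_map T" and cp: "completely_positive T" and tp: "trace_preserving T"
    using T by (simp_all add: quantum_channel_def)
  let ?n = "CARD('a)"
  obtain h :: "nat \<Rightarrow> 'a" where h: "bij_betw h {..<?n} UNIV"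
    using ex_bij_betw_nat_finite[of "UNIV :: 'a set"] by (auto simp: atLeast0LessThan)
  define M :: "nat \<times> 'a \<Rightarrow> nat \<times> 'a \<Rightarrow> complex" where
    "M = (\<lambda>p q. max_ent $ (h (fst p), snd p) $ (h (fst q), snd q))"
  have "psd_on ({..<?n} \<times> UNIV) M"
    unfolding psd_on_def Let_def
  proof (intro allI)
    fix v :: "nat \<times> 'a \<Rightarrow> complex"
    \<comment> \<open>Only index pairs on the diagonal of \<open>max_ent\<close> survive, and the
      form becomes the squared modulus of a single sum.\<close>
    define u where "u = (\<lambda>p. if h (fst p) = snd p then v p else 0)"
    have "(\<Sum>p\<in>{..<?n} \<times> UNIV. \<Sum>q\<in>{..<?n} \<times> UNIV. cnj (v p) * M p q * v q) =
      (\<Sum>p\<in>{..<?n} \<times> UNIV. \<Sum>q\<in>{..<?n} \<times> UNIV. of_real (1 / real ?n) * (cnj (u p) * u q))"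
      by (intro sum.cong refl) (auto simp: M_def max_ent_def u_def)
    also have "\<dots> = of_real (1 / real ?n) * (cnj (\<Sum>p\<in>{..<?n} \<times> UNIV. u p) * (\<Sum>q\<in>{..<?n} \<times> UNIV. u q))"
      unfolding cnj_sum unfolding sum_product unfolding sum_distrib_left ..
    also have "\<dots> = of_real (1 / real ?n * (cmod (\<Sum>p\<in>{..<?n} \<times> UNIV. u p))\<^sup>2)"
      by (simp only: of_real_mult complex_norm_square mult.commute[of "cnj _"])
    finally have e: "(\<Sum>p\<in>{..<?n} \<times> UNIV. \<Sum>q\<in>{..<?n} \<times> UNIV. cnj (v p) * M p q * v q) = \<dots>" .
    show "Im (\<Sum>p\<in>{..<?n} \<times> UNIV. \<Sum>q\<in>{..<?n} \<times> UNIV. cnj (v p) * M p q * v q) = 0 \<and>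
        0 \<le> Re (\<Sum>p\<in>{..<?n} \<times> UNIV. \<Sum>q\<in>{..<?n} \<times> UNIV. cnj (v p) * M p q * v q)"
      unfolding e Im_complex_of_real Re_complex_of_real by simp
  qed
  then have *: "psd_on ({..<?n} \<times> (UNIV :: 'c set)) (\<lambda>p q. (T (\<chi> i j. M (fst p, i) (fst q, j))) $ (snd p) $ (snd q))"
    using cp unfolding completely_positive_def by blast
  have ent: "(T (\<chi> i j. M (k, i) (l, j))) $ c $ d = choi_state T $ (h k, c) $ (h l, d)" for k l c d
    by (simp add: M_def choi_state_def id_tensor_def)
  have bij: "bij_betw (\<lambda>p. (h (fst p), snd p)) ({..<?n} \<times> (UNIV :: 'c set)) UNIV"
    using h by (fastforce simp: bij_betw_def inj_on_def image_def)
  have "psd (choi_state T)"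
    unfolding psd_form
  proof
    fix w :: "'a \<times> 'c \<Rightarrow> complex"
    have "(\<Sum>p\<in>UNIV. \<Sum>q\<in>UNIV. cnj (w p) * choi_state T $ p $ q * w q) =
      (\<Sum>p\<in>{..<?n} \<times> UNIV. \<Sum>q\<in>{..<?n} \<times> UNIV. cnj (w (h (fst p), snd p)) *
         (T (\<chi> i j. M (fst p, i) (fst q, j))) $ (snd p) $ (snd q) * w (h (fst q), snd q))"
      unfolding ent sum.reindex_bij_betw[OF bij, symmetric] by simp
    then show "Im (\<Sum>p\<in>UNIV. \<Sum>q\<in>UNIV. cnj (w p) * choi_state T $ p $ q * w q) = 0 \<and>
        0 \<le> Re (\<Sum>p\<in>UNIV. \<Sum>q\<in>UNIV. cnj (w p) * choi_state T $ p $ q * w q)"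
      using *[unfolded psd_on_def Let_def, rule_format, of "\<lambda>p. w (h (fst p), snd p)"] by simp
  qed
  moreover have "trace (choi_state T) = 1"
  proof -
    have t: "trace (T (unit_mat a a)) = 1" for a
      using tp by (simp add: trace_preserving_def) (simp add: trace_def unit_mat_def)
    have "trace (choi_state T) = (\<Sum>a\<in>UNIV. 1 / of_nat ?n * trace (T (unit_mat a a)))"
      unfolding trace_def sum_UNIV_prod choi_state_nth[OF lin] by (simp add: sum_distrib_left sum_divide_distrib)
    then show ?thesis by (simp add: t)
  qed
  ultimately show ?thesis by (simp add: density_def)
qed

lemma trace_ptr1: "trace (ptr1 X) = trace X"
  unfolding trace_def sum_UNIV_prod ptr1_def by (subst sum.swap) simp

text \<open>The form of the partial trace is a sum of values of the form of \<rho>, taken at vectors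
  supported on one slice of the first index.\<close>

lemma density_ptr1:
  fixes \<rho> :: "complex^('a::finite\<times>'e::finite)^('a\<times>'e)"
  assumes "density \<rho>" shows "density (ptr1 \<rho>)"
proof -
  have "psd (ptr1 \<rho>)"
    unfolding psd_form
  proof
    fix v :: "'e \<Rightarrow> complex"
    define q where "q = (\<lambda>i. \<Sum>p\<in>UNIV. \<Sum>q\<in>UNIV. cnj (if fst p = i then v (snd p) else 0) * \<rho> $ p $ q * (if fst q = i then v (snd q) else 0))"
    have pos: "Im (q i) = 0 \<and> 0 \<le> Re (q i)" for i
      using assms[unfolded density_def psd_form, THEN conjunct1, rule_format,
          of "\<lambda>p. if fst p = i then v (snd p) else 0"] unfolding q_def .
    have qi: "q i = (\<Sum>k\<in>UNIV. \<Sum>l\<in>UNIV. cnj (v k) * \<rho> $ (i, k) $ (i, l) * v l)" for i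
    proof -
      have "q i = (\<Sum>a\<in>UNIV. \<Sum>k\<in>UNIV. \<Sum>b\<in>UNIV. if b = i then (\<Sum>l\<in>UNIV. if a = i then cnj (v k) * \<rho> $ (a, k) $ (b, l) * v l else 0) else 0)"
        unfolding q_def sum_UNIV_prod
        by (rule sum.cong[OF refl], rule sum.cong[OF refl], rule sum.cong[OF refl]) auto
      also have "\<dots> = (\<Sum>a\<in>UNIV. if a = i then (\<Sum>k\<in>UNIV. \<Sum>l\<in>UNIV. cnj (v k) * \<rho> $ (a, k) $ (i, l) * v l) else 0)"
        by (rule sum.cong[OF refl]) simp
      finally show ?thesis by simp
    qed
    have "(\<Sum>k\<in>UNIV. \<Sum>l\<in>UNIV. cnj (v k) * ptr1 \<rho> $ k $ l * v l) = (\<Sum>k\<in>UNIV. \<Sum>l\<in>UNIV. \<Sum>i\<in>UNIV. cnj (v k) * \<rho> $ (i, k) $ (i, l) * v l)"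
      by (simp add: ptr1_def sum_distrib_left sum_distrib_right)
    also have "\<dots> = (\<Sum>k\<in>UNIV. \<Sum>i\<in>UNIV. \<Sum>l\<in>UNIV. cnj (v k) * \<rho> $ (i, k) $ (i, l) * v l)"
      by (rule sum.cong[OF refl], rule sum.swap)
    also have "\<dots> = (\<Sum>i\<in>UNIV. q i)" unfolding qi by (rule sum.swap)
    finally have e: "(\<Sum>k\<in>UNIV. \<Sum>l\<in>UNIV. cnj (v k) * ptr1 \<rho> $ k $ l * v l) = (\<Sum>i\<in>UNIV. q i)" .
    show "Im (\<Sum>k\<in>UNIV. \<Sum>l\<in>UNIV. cnj (v k) * ptr1 \<rho> $ k $ l * v l) = 0 \<and> 0 \<le> Re (\<Sum>k\<in>UNIV. \<Sum>l\<in>UNIV. cnj (v k) * ptr1 \<rho> $ k $ l * v l)"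
      unfolding e using pos by (simp add: sum_nonneg)
  qed
  then show ?thesis using assms by (simp add: density_def trace_ptr1)
qed

section \<open>Traces in two eigenbases, a Hoelder inequality and matrix derivatives\<close>

definition ln_supp :: "real \<Rightarrow> real" where "ln_supp x = (if x > 0 then ln x else 0)"

lemma mlog_spectral:
  assumes "unitary_mat U" "A = sreal U l"
  shows "mlog A = spectral U (\<lambda>i. of_real (ln_supp (l i)))"
  unfolding mlog_def mfun_spectral[OF assms] ln_supp_def ..

text \<open>The weights are the squared overlaps of the two eigenbases, a doubly stochastic matrix;
  they turn traces of products into classical double sums.\<close>

lemma trace_spectral_spectral:
  assumes U: "unitary_mat U" and V: "unitary_mat V"
  shows "trace (spectral U g ** spectral V h) = (\<Sum>i\<in>UNIV. \<Sum>j\<in>UNIV. g i * h j * of_real ((cmod ((cadj U ** V) $ i $ j))\<^sup>2))"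
proof -
  define W where "W = cadj U ** V"
  have "trace (spectral U g ** spectral V h) = trace (U ** (diag_mat g ** W ** diag_mat h ** cadj V))"
    by (simp add: spectral_def W_def matrix_mul_assoc)
  also have "\<dots> = trace ((diag_mat g ** W ** diag_mat h) ** cadj W)"
    by (subst trace_comm) (simp add: W_def cadj_mult matrix_mul_assoc)
  also have "\<dots> = (\<Sum>i\<in>UNIV. \<Sum>j\<in>UNIV. g i * W $ i $ j * h j * cnj (W $ i $ j))"
    by (simp add: trace_mult mult_diag_mat_nth diag_mat_mult_nth)
  also have "\<dots> = (\<Sum>i\<in>UNIV. \<Sum>j\<in>UNIV. g i * h j * of_real ((cmod (W $ i $ j))\<^sup>2))"
    unfolding complex_norm_square by (simp only: mult_ac)
  finally show ?thesis unfolding W_def .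
qed

text \<open>In the eigenbasis of the positive operator only the diagonal of the rotated contraction
  counts, and its entries have modulus at most 1. Serves the left edges in the comparisons of
  divergences.\<close>

lemma norm_trace_contraction_spectral:
  assumes G: "contraction G" and U: "unitary_mat U" and p: "\<And>i. p i \<ge> 0"
  shows "cmod (trace (G ** sreal U p)) \<le> (\<Sum>i\<in>UNIV. p i)"
proof -
  define H where "H = cadj U ** G ** U"
  have H: "contraction H" unfolding H_def by (intro contraction_mult unitary_contraction unitary_cadj U G)
  have "trace (G ** sreal U p) = trace ((G ** U ** diag_mat (\<lambda>i. of_real (p i))) ** cadj U)"
    by (simp add: spectral_def matrix_mul_assoc)
  also have "\<dots> = trace (H ** diag_mat (\<lambda>i. of_real (p i)))"
    by (subst trace_comm) (simp add: H_def matrix_mul_assoc)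
  also have "\<dots> = (\<Sum>i\<in>UNIV. H $ i $ i * of_real (p i))" by (simp add: trace_def mult_diag_mat_nth)
  also have "cmod \<dots> \<le> (\<Sum>i\<in>UNIV. 1 * p i)"
  proof (rule sum_norm_le)
    fix i
    have "cmod (H $ i $ i * of_real (p i)) = cmod (H $ i $ i) * p i" using p by (simp add: norm_mult)
    also have "\<dots> \<le> 1 * p i" by (intro mult_right_mono contraction_entry H p)
    finally show "cmod (H $ i $ i * of_real (p i)) \<le> 1 * p i" .
  qed
  finally show ?thesis by simp
qed

text \<open>Hoelder's inequality with Schatten exponents \<open>\<alpha> / (\<alpha> - 1)\<close> and \<open>\<alpha>\<close>, the two operators being given
  in their own eigenbases.\<close>

lemma trace_hoelder:
  fixes A :: "complex^'k::finite^'i::finite" and B :: "complex^'i^'k"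
  assumes A: "contraction A" and B: "contraction B" and \<alpha>: "\<alpha> > 1"
    and p: "\<And>i. p i \<ge> 0" "(\<Sum>i\<in>UNIV. p i) = 1" and m: "\<And>k. m k \<ge> 0"
    and Q: "Q = (\<Sum>k\<in>UNIV. m k powr \<alpha>)" "Q > 0"
    and g: "\<And>i. cmod (g i) \<le> p i powr ((\<alpha> - 1) / \<alpha>)"
  shows "cmod (trace (diag_mat g ** A ** diag_mat (\<lambda>k. of_real (m k)) ** B)) \<le> Q powr (1 / \<alpha>)"
proof -
  define \<theta> where "\<theta> = (\<alpha> - 1) / \<alpha>"
  have \<theta>: "0 \<le> \<theta>" "\<theta> + 1 / \<alpha> = 1" using \<alpha> by (auto simp: \<theta>_def field_simps)
  define y where "y = (\<lambda>k. m k powr \<alpha> / Q)"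
  have y: "y k \<ge> 0" for k using Q by (simp add: y_def)
  have sy: "(\<Sum>k\<in>UNIV. y k) = 1" using Q by (simp add: y_def sum_divide_distrib[symmetric])
  have young: "a powr \<theta> * b powr (1 / \<alpha>) \<le> \<theta> * a + 1 / \<alpha> * b" if "a \<ge> 0" "b \<ge> 0" for a b
  proof (cases "a = 0 \<or> b = 0")
    case True
    then show ?thesis using that \<theta> \<alpha> by auto
  next
    case False
    then show ?thesis using that \<theta> \<alpha> by (intro Youngs_inequality_0) auto
  qed
  have my: "m k = Q powr (1 / \<alpha>) * y k powr (1 / \<alpha>)" for k
  proof -
    have "Q powr (1 / \<alpha>) * y k powr (1 / \<alpha>) = (Q * y k) powr (1 / \<alpha>)" using Q y by (simp add: powr_mult)
    also have "Q * y k = m k powr \<alpha>" using Q by (simp add: y_def)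
    also have "(m k powr \<alpha>) powr (1 / \<alpha>) = m k" using m[of k] \<alpha> by (simp add: powr_powr)
    finally show ?thesis by simp
  qed
  have "trace (diag_mat g ** A ** diag_mat (\<lambda>k. of_real (m k)) ** B) = (\<Sum>i\<in>UNIV. \<Sum>k\<in>UNIV. g i * A $ i $ k * of_real (m k) * B $ k $ i)"
    by (simp add: trace_mult mult_diag_mat_nth diag_mat_mult_nth)
  also have "cmod \<dots> \<le> (\<Sum>i\<in>UNIV. \<Sum>k\<in>UNIV. Q powr (1 / \<alpha>) *
      ((\<theta> * p i + 1 / \<alpha> * y k) * ((cmod (A $ i $ k))\<^sup>2 / 2 + (cmod (B $ k $ i))\<^sup>2 / 2)))"
  proof (rule sum_norm_le, rule sum_norm_le)
    fix i k
    have "cmod (g i * A $ i $ k * of_real (m k) * B $ k $ i) = cmod (g i) * m k * (cmod (A $ i $ k) * cmod (B $ k $ i))"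
      using m by (simp add: norm_mult mult_ac)
    also have "\<dots> \<le> (Q powr (1 / \<alpha>) * (\<theta> * p i + 1 / \<alpha> * y k)) * ((cmod (A $ i $ k))\<^sup>2 / 2 + (cmod (B $ k $ i))\<^sup>2 / 2)"
    proof (rule mult_mono)
      have "cmod (g i) * m k \<le> p i powr \<theta> * m k" using g[of i] m by (intro mult_right_mono) (auto simp: \<theta>_def)
      also have "\<dots> = Q powr (1 / \<alpha>) * (p i powr \<theta> * y k powr (1 / \<alpha>))" by (subst my) simp
      also have "\<dots> \<le> Q powr (1 / \<alpha>) * (\<theta> * p i + 1 / \<alpha> * y k)"
        using young[OF p(1)[of i] y[of k]] by (intro mult_left_mono) auto
      finally show "cmod (g i) * m k \<le> Q powr (1 / \<alpha>) * (\<theta> * p i + 1 / \<alpha> * y k)" .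
      show "cmod (A $ i $ k) * cmod (B $ k $ i) \<le> (cmod (A $ i $ k))\<^sup>2 / 2 + (cmod (B $ k $ i))\<^sup>2 / 2"
        using sum_squares_bound[of "cmod (A $ i $ k)" "cmod (B $ k $ i)"] by simp
      show "0 \<le> Q powr (1 / \<alpha>) * (\<theta> * p i + 1 / \<alpha> * y k)" using \<theta> \<alpha> p y by simp
    qed simp
    finally show "cmod (g i * A $ i $ k * of_real (m k) * B $ k $ i) \<le> Q powr (1 / \<alpha>) *
      ((\<theta> * p i + 1 / \<alpha> * y k) * ((cmod (A $ i $ k))\<^sup>2 / 2 + (cmod (B $ k $ i))\<^sup>2 / 2))" by (simp add: mult.assoc)
  qed
  also have "\<dots> = Q powr (1 / \<alpha>) * (\<theta> * ((\<Sum>i\<in>UNIV. p i * (\<Sum>k\<in>UNIV. (cmod (A $ i $ k))\<^sup>2)) / 2 + (\<Sum>i\<in>UNIV. p i * (\<Sum>k\<in>UNIV. (cmod (B $ k $ i))\<^sup>2)) / 2)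
     + 1 / \<alpha> * ((\<Sum>k\<in>UNIV. y k * (\<Sum>i\<in>UNIV. (cmod (A $ i $ k))\<^sup>2)) / 2 + (\<Sum>k\<in>UNIV. y k * (\<Sum>i\<in>UNIV. (cmod (B $ k $ i))\<^sup>2)) / 2))"
  proof -
    have sw: "(\<Sum>i\<in>UNIV. \<Sum>k\<in>UNIV. y k * f i k) = (\<Sum>k\<in>UNIV. y k * (\<Sum>i\<in>UNIV. f i k))" for f :: "'i \<Rightarrow> 'k \<Rightarrow> real"
      by (subst sum.swap) (simp add: sum_distrib_left)
    have "(\<Sum>i\<in>UNIV. \<Sum>k\<in>UNIV. c * ((\<theta> * p i + b * y k) * (f i k / 2 + g i k / 2))) =
      c * (\<theta> * ((\<Sum>i\<in>UNIV. p i * (\<Sum>k\<in>UNIV. f i k)) / 2 + (\<Sum>i\<in>UNIV. p i * (\<Sum>k\<in>UNIV. g i k)) / 2)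
     + b * ((\<Sum>i\<in>UNIV. \<Sum>k\<in>UNIV. y k * f i k) / 2 + (\<Sum>i\<in>UNIV. \<Sum>k\<in>UNIV. y k * g i k) / 2))"
      for f g :: "'i \<Rightarrow> 'k \<Rightarrow> real" and c b
      by (simp add: sum_distrib_left sum_divide_distrib sum.distrib distrib_left distrib_right mult_ac add_ac)
    then show ?thesis unfolding sw .
  qed
  \<comment> \<open>Rows and columns of contractions have square sums at most 1, and what is left
    adds up to \<open>\<theta> + 1 / \<alpha> = 1\<close>.\<close>
  also have "\<dots> \<le> Q powr (1 / \<alpha>) * (\<theta> * ((\<Sum>i\<in>UNIV. p i * 1) / 2 + (\<Sum>i\<in>UNIV. p i * 1) / 2)
     + 1 / \<alpha> * ((\<Sum>k\<in>UNIV. y k * 1) / 2 + (\<Sum>k\<in>UNIV. y k * 1) / 2))"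
    using \<theta>(1) \<alpha> p(1) y
    by (intro mult_left_mono add_mono divide_right_mono sum_mono contraction_row contraction_col A B) auto
  also have "\<dots> = Q powr (1 / \<alpha>)" using p(2) sy \<theta>(2) by simp
  finally show ?thesis .
qed

definition mat_deriv :: "(complex \<Rightarrow> complex^'n::finite^'m::finite) \<Rightarrow> complex^'n^'m \<Rightarrow> complex \<Rightarrow> bool" where
  "mat_deriv F D z \<longleftrightarrow> (\<forall>i j. ((\<lambda>z. F z $ i $ j) has_field_derivative D $ i $ j) (at z))"

lemma mat_deriv_const: "mat_deriv (\<lambda>_. A) 0 z"
  by (simp add: mat_deriv_def)

lemma mat_deriv_mult:
  assumes "mat_deriv F D z" "mat_deriv G E z"
  shows "mat_deriv (\<lambda>z. F z ** G z) (D ** G z + F z ** E) z"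
  unfolding mat_deriv_def
proof (intro allI)
  fix i j
  have "((\<lambda>z. \<Sum>k\<in>UNIV. F z $ i $ k * G z $ k $ j) has_field_derivative
      (\<Sum>k\<in>UNIV. D $ i $ k * G z $ k $ j + E $ k $ j * F z $ i $ k)) (at z)"
    using assms unfolding mat_deriv_def by (intro DERIV_sum DERIV_mult) auto
  then show "((\<lambda>z. (F z ** G z) $ i $ j) has_field_derivative (D ** G z + F z ** E) $ i $ j) (at z)"
    by (simp add: matrix_mult_nth sum.distrib mult.commute)
qed

text \<open>Eigenvalue 0 contributes the constant 0 at every exponent, in agreement with
  \<open>ln_supp\<close>, so the formula also holds where the power is a support projection.\<close>

lemma mat_deriv_spectral:
  "mat_deriv (\<lambda>z. spow U l (a + b * z)) (spectral U (\<lambda>i. b * of_real (ln_supp (l i)) * cpow (l i) (a + b * z))) z"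
  unfolding mat_deriv_def
proof (intro allI)
  fix i j
  have "((\<lambda>z. cpow (l k) (a + b * z)) has_field_derivative b * of_real (ln_supp (l k)) * cpow (l k) (a + b * z)) (at z)" for k
  proof (cases "l k > 0")
    case True
    have "((\<lambda>z. exp ((a + b * z) * of_real (ln (l k)))) has_field_derivative b * of_real (ln (l k)) * exp ((a + b * z) * of_real (ln (l k)))) (at z)"
      by (auto intro!: derivative_eq_intros)
    then show ?thesis using True by (simp add: cpow_def ln_supp_def)
  qed (simp add: cpow_def)
  then have "((\<lambda>z. \<Sum>k\<in>UNIV. U $ i $ k * cpow (l k) (a + b * z) * cnj (U $ j $ k)) has_field_derivative
     (\<Sum>k\<in>UNIV. U $ i $ k * (b * of_real (ln_supp (l k)) * cpow (l k) (a + b * z)) * cnj (U $ j $ k))) (at z)"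
    by (intro DERIV_sum DERIV_cmult_right DERIV_cmult)
  then show "((\<lambda>z. spow U l (a + b * z) $ i $ j) has_field_derivative
     spectral U (\<lambda>i. b * of_real (ln_supp (l i)) * cpow (l i) (a + b * z)) $ i $ j) (at z)"
    by (simp add: spectral_nth)
qed

lemma mat_deriv_trace:
  assumes "mat_deriv F D (of_real x)"
  shows "((\<lambda>x. Re (trace (F (of_real x)))) has_real_derivative Re (trace D)) (at x)"
proof -
  have "((\<lambda>z. trace (F z)) has_field_derivative trace D) (at (of_real x))"
    using assms unfolding mat_deriv_def trace_def by (intro DERIV_sum) auto
  then have "((\<lambda>x. trace (F (of_real x))) has_vector_derivative trace D) (at x)"
    by (rule has_vector_derivative_real_field)
  then have "((\<lambda>x. Re (trace (F (of_real x)))) has_vector_derivative Re (trace D)) (at x)"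
    by (rule bounded_linear.has_vector_derivative[OF bounded_linear_Re])
  then show ?thesis by (simp add: has_real_derivative_iff_has_vector_derivative)
qed

section \<open>Relative entropies\<close>

text \<open>Since \<open>mlog\<close> vanishes on kernels, this real number is Umegaki's relative
  entropy when the kernel of \<sigma> lies in that of \<rho>; the inequalities below assume this
  inclusion.\<close>

definition rel_ent :: "complex^'n::finite^'n \<Rightarrow> complex^'n^'n \<Rightarrow> real" where
  "rel_ent \<rho> \<sigma> = Re (trace (\<rho> ** (mlog \<rho> - mlog \<sigma>)))"

lemma rel_ent_eq: "rel_ent \<rho> \<sigma> = Re (trace (mlog \<rho> ** \<rho>)) - Re (trace (mlog \<sigma> ** \<rho>))"
  unfolding rel_ent_def matrix_diff_left trace_sub by (simp add: trace_comm[of \<rho>])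

lemma trace_spectral_scale: "trace (spectral U (\<lambda>i. b * g i) ** A) = b * trace (spectral U g ** A)"
  unfolding trace_mult spectral_nth by (simp add: sum_distrib_left sum_distrib_right mult_ac)

lemma spectral_cong: "(\<And>i. g i = h i) \<Longrightarrow> spectral U g = spectral U h"
  by presburger

lemma ln_supp_cpow_0: "of_real (ln_supp x) * cpow x 0 = of_real (ln_supp x)"
  by (simp add: ln_supp_def cpow_0)

lemma cpow_strip_bound:
  assumes "0 \<le> Re z" "Re z \<le> 1"
  shows "cmod (cpow x (a + of_real c * z)) \<le> cmod (cpow x a) * (1 + x powr c)"
proof (cases "x > 0")
  case True
  define y where "y = x powr c"
  have y: "y > 0" using True by (simp add: y_def)
  have "y powr Re z \<le> 1 + y"
  proof (cases "y \<ge> 1")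
    case True
    then have "y powr Re z \<le> y powr 1" using assms by (intro powr_mono) auto
    then show ?thesis using y by simp
  next
    case False
    then have "y powr Re z \<le> 1" using assms y by (intro powr_le1) auto
    then show ?thesis using y by simp
  qed
  moreover have "cmod (cpow x (of_real c * z)) = y powr Re z"
    using True by (simp add: norm_cpow y_def powr_powr)
  ultimately show ?thesis unfolding cpow_add norm_mult y_def[symmetric] by (intro mult_left_mono) auto
qed (simp add: cpow_def)

lemma spectral_strip_bound:
  assumes "unitary_mat U"
  shows "\<exists>K. \<forall>z. 0 \<le> Re z \<longrightarrow> Re z \<le> 1 \<longrightarrow> norm (spow U l (a + of_real c * z)) \<le> K"
proof -
  have "norm (spow U l (a + of_real c * z)) \<le> sqrt (\<Sum>i\<in>UNIV. (cmod (cpow (l i) a) * (1 + l i powr c))\<^sup>2)"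
    if "0 \<le> Re z" "Re z \<le> 1" for z
    by (intro norm_spectral_le assms cpow_strip_bound that)
  then show ?thesis by blast
qed

lemma norm_trace_le: "cmod (trace A) \<le> norm (mat 1 :: complex^'n::finite^'n) * norm (A :: complex^'n^'n)"
  using norm_trace_mult_le[of "mat 1" A] by simp

lemma strip_bound_mult:
  fixes F :: "complex \<Rightarrow> complex^'n::finite^'m::finite" and G :: "complex \<Rightarrow> complex^'k::finite^'n"
  assumes "\<exists>K. \<forall>z. 0 \<le> Re z \<longrightarrow> Re z \<le> 1 \<longrightarrow> norm (F z) \<le> K"
    and "\<exists>K. \<forall>z. 0 \<le> Re z \<longrightarrow> Re z \<le> 1 \<longrightarrow> norm (G z) \<le> K"
  shows "\<exists>K. \<forall>z. 0 \<le> Re z \<longrightarrow> Re z \<le> 1 \<longrightarrow> norm (F z ** G z) \<le> K"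
proof -
  obtain K L where K: "\<And>z. 0 \<le> Re z \<Longrightarrow> Re z \<le> 1 \<Longrightarrow> norm (F z) \<le> K"
    and L: "\<And>z. 0 \<le> Re z \<Longrightarrow> Re z \<le> 1 \<Longrightarrow> norm (G z) \<le> L" using assms by blast
  have "norm (F z ** G z) \<le> K * L" if "0 \<le> Re z" "Re z \<le> 1" for z
  proof -
    have "0 \<le> K" using K[OF that] norm_ge_zero order_trans by blast
    then have "norm (F z) * norm (G z) \<le> K * L" using K[OF that] L[OF that] by (intro mult_mono) auto
    then show ?thesis using norm_matrix_mult_le[of "F z" "G z"] by linarith
  qed
  then show ?thesis by blast
qed

lemma strip_bound_trace:
  fixes F :: "complex \<Rightarrow> complex^'n::finite^'n"
  assumes "\<exists>K. \<forall>z. 0 \<le> Re z \<longrightarrow> Re z \<le> 1 \<longrightarrow> norm (F z) \<le> K"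
  obtains K where "\<And>z. 0 \<le> Re z \<Longrightarrow> Re z \<le> 1 \<Longrightarrow> cmod (trace (F z)) \<le> K"
proof -
  obtain K where K: "\<And>z. 0 \<le> Re z \<Longrightarrow> Re z \<le> 1 \<Longrightarrow> norm (F z) \<le> K" using assms by blast
  have "cmod (trace (F z)) \<le> norm (mat 1 :: complex^'n^'n) * K" if "0 \<le> Re z" "Re z \<le> 1" for z
    using norm_trace_le[of "F z"] mult_left_mono[OF K[OF that] norm_ge_zero[of "mat 1 :: complex^'n^'n"]] by linarith
  then show ?thesis using that by blast
qed

lemma holomorphic_trace:
  assumes "\<And>i j. (\<lambda>z. F z $ i $ j) holomorphic_on S" shows "(\<lambda>z. trace (F z)) holomorphic_on S"
  unfolding trace_def by (intro holomorphic_intros assms)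

lemma holomorphic_spectral_cpow:
  "(\<lambda>z. spow U l (a + b * z) $ i $ j) holomorphic_on S"
  by (intro holomorphic_spectral holomorphic_intros)

text \<open>Both sides equal 1 at 0, so their slopes there compare. Converts a three lines estimate
  on the unit interval into an entropy inequality.\<close>

lemma exp_bound_derivative:
  fixes F :: "real \<Rightarrow> real"
  assumes "(F has_real_derivative D) (at 0)" "F 0 = 1" "\<And>x. 0 \<le> x \<Longrightarrow> x \<le> 1 \<Longrightarrow> F x \<le> exp (c * x)"
  shows "D \<le> c"
proof (rule ccontr)
  assume "\<not> D \<le> c"
  moreover have "((\<lambda>x. exp (c * x) - F x) has_real_derivative (c - D)) (at 0)"
    using assms(1) by (auto intro!: derivative_eq_intros)
  ultimately obtain d where d: "d > 0" "\<And>h. 0 < h \<Longrightarrow> h < d \<Longrightarrow> exp (c * (0 + h)) - F (0 + h) < exp (c * 0) - F 0"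
    using DERIV_neg_dec_right[of "\<lambda>x. exp (c * x) - F x" "c - D" 0] by force
  have "exp (c * min 1 (d / 2)) - F (min 1 (d / 2)) < 0" using d(2)[of "min 1 (d / 2)"] d(1) assms(2) by simp
  moreover have "F (min 1 (d / 2)) \<le> exp (c * min 1 (d / 2))" using d(1) by (intro assms(3)) auto
  ultimately show False by simp
qed

text \<open>Diagonalizations of both operators are fixed so that their complex powers can be written
  down. The eigenvalues \<open>l\<close> are left unnormalized because \<open>sreal U l\<close> also
  stands for the identity tensored with a state.\<close>

locale supported_pair =
  fixes \<rho> :: "complex^'n::finite^'n" and U l P p
  assumes \<rho>: "density \<rho>" and U: "unitary_mat U" and l: "\<And>i. l i \<ge> 0"
    and supp: "\<And>v. sreal U l *v v = 0 \<Longrightarrow> \<rho> *v v = 0"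
    and P: "unitary_mat P" "\<rho> = sreal P p" "\<And>i. p i \<ge> 0" "(\<Sum>i\<in>UNIV. p i) = 1"
begin

abbreviation "\<sigma> \<equiv> sreal U l"

lemma hermitian: "cadj \<rho> = \<rho>"
  by (simp add: P(2) cadj_spectral)

lemma \<rho>_support: "\<rho> ** spow U l 0 = \<rho>" "spow U l 0 ** \<rho> = \<rho>"
  by (rule support_projection[OF U l hermitian supp], assumption)+

lemma \<rho>_self_support: "\<rho> ** spow P p 0 = \<rho>" "spow P p 0 ** \<rho> = \<rho>"
proof -
  have "of_real (p i) * cpow (p i) 0 = of_real (p i)" "cpow (p i) 0 * of_real (p i) = of_real (p i)" for i
    using P(3)[of i] by (simp_all add: cpow_0)
  then show "\<rho> ** spow P p 0 = \<rho>" "spow P p 0 ** \<rho> = \<rho>"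
    unfolding P(2) spectral_mult[OF P(1)] by presburger+
qed

lemma \<rho>_cpow: "spow P p 1 = \<rho>"
  unfolding P(2) by (rule spectral_cong) (simp add: cpow_one P(3))

lemma trace_\<rho>: "trace \<rho> = 1"
  using \<rho> by (simp add: density_def)

lemma mlog_\<rho>: "mlog \<rho> = spectral P (\<lambda>i. of_real (ln_supp (p i)))"
  by (rule mlog_spectral[OF P(1,2)])

lemma mlog_\<sigma>: "mlog \<sigma> = spectral U (\<lambda>i. of_real (ln_supp (l i)))"
  by (rule mlog_spectral[OF U refl])

text \<open>The function \<open>f z = trace (\<rho>^(\<theta> z) ** \<sigma>^(s z) ** \<rho> **
  \<sigma>^(s z))\<close> equals 1 at 0, is bounded by 1 on the left edge and, by Hoelder, by
  \<open>Q powr (1 / \<alpha>)\<close> on the right edge. Its slope at 0 is \<theta> times the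
  relative entropy, and the three lines bound has slope \<open>ln Q / \<alpha>\<close>
  there.\<close>

lemma rel_ent_le:
  assumes \<alpha>: "\<alpha> > 1"
  defines "Q \<equiv> sandwiched_Q \<alpha> \<rho> \<sigma>"
  shows "rel_ent \<rho> \<sigma> \<le> 1 / (\<alpha> - 1) * ln Q"
proof (rule sandwich_diagonalizable[where \<alpha> = \<alpha>, OF \<rho> U l supp])
  define s where "s = (1 - \<alpha>) / (2 * \<alpha>)"
  define \<theta> where "\<theta> = (\<alpha> - 1) / \<alpha>"
  fix W m
  assume W: "unitary_mat W" "\<And>k. m k \<ge> 0"
    "spow U l (of_real ((1 - \<alpha>) / (2 * \<alpha>))) ** \<rho> ** spow U l (of_real ((1 - \<alpha>) / (2 * \<alpha>))) = sreal W m"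
    "sandwiched_Q \<alpha> \<rho> \<sigma> = (\<Sum>k\<in>UNIV. Re (cpow (m k) (of_real \<alpha>)))" "sandwiched_Q \<alpha> \<rho> \<sigma> > 0"
  note M = W(3)[folded s_def]
  have Q: "Q = (\<Sum>k\<in>UNIV. m k powr \<alpha>)" "Q > 0"
  proof -
    have "Re (cpow (m k) (of_real \<alpha>)) = m k powr \<alpha>" for k
      using W(2)[of k] by (auto simp: cpow_of_real)
    then show "Q = (\<Sum>k\<in>UNIV. m k powr \<alpha>)" "Q > 0"
      using W(4,5) unfolding Q_def by simp_all
  qed
  define R where "R = (\<lambda>z. spow P p (0 + of_real \<theta> * z))"
  define S where "S = (\<lambda>z. spow U l (0 + of_real s * z))"
  define f where "f = (\<lambda>z. trace (R z ** (S z ** \<rho> ** S z)))"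
  have "f holomorphic_on UNIV" unfolding f_def R_def S_def
    by (intro holomorphic_trace holomorphic_matrix_mult holomorphic_spectral_cpow holomorphic_on_const)
  moreover obtain K where "\<And>z. 0 \<le> Re z \<Longrightarrow> Re z \<le> 1 \<Longrightarrow> cmod (f z) \<le> K"
  proof (rule strip_bound_trace)
    show "\<exists>K. \<forall>z. 0 \<le> Re z \<longrightarrow> Re z \<le> 1 \<longrightarrow> norm (R z ** (S z ** \<rho> ** S z)) \<le> K"
      unfolding R_def S_def by (intro strip_bound_mult spectral_strip_bound P U) blast
  qed (use f_def in blast)
  moreover have "cmod (f z) \<le> 1" if z: "Re z = 0" for z
  proof -
    have "f z = trace ((R z ** S z ** \<rho>) ** S z)" by (simp add: f_def matrix_mul_assoc)
    also have "\<dots> = trace ((S z ** R z ** S z) ** \<rho>)" by (subst trace_comm) (simp add: matrix_mul_assoc)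
    finally have "f z = trace ((S z ** R z ** S z) ** sreal P p)" unfolding P(2) .
    moreover have "contraction (S z ** R z ** S z)" unfolding S_def R_def
      by (intro contraction_mult contraction_spectral U P norm_cpow_imaginary) (simp_all add: z)
    ultimately show ?thesis using norm_trace_contraction_spectral[where p = p, OF _ P(1,3)] P(4) by simp
  qed
  moreover have "cmod (f z) \<le> Q powr (1 / \<alpha>)" if z: "Re z = 1" for z
  proof -
    \<comment> \<open>On the right edge each power of \<sigma> splits into an imaginary power
      \<open>T\<close> and the exponent \<open>s\<close> of the sandwich.\<close>
    define T where "T = spow U l (of_real s * (z - 1))"
    have e: "0 + of_real s * z = of_real s * (z - 1) + of_real s" "0 + of_real s * z = of_real s + of_real s * (z - 1)"
      by (simp_all add: algebra_simps)
    have S: "S z = T ** spow U l (of_real s)" "S z = spow U l (of_real s) ** T"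
      unfolding T_def spectral_mult[OF U] cpow_add[symmetric] S_def e(1) by (simp_all add: add.commute)
    have "S z ** \<rho> ** S z = T ** spow U l (of_real s) ** \<rho> ** (spow U l (of_real s) ** T)"
      using S by metis
    also have "\<dots> = T ** (spow U l (of_real s) ** \<rho> ** spow U l (of_real s)) ** T"
      by (simp add: matrix_mul_assoc)
    finally have SS: "S z ** \<rho> ** S z = T ** sreal W m ** T" unfolding M .
    define g where "g = (\<lambda>i. cpow (p i) (0 + of_real \<theta> * z))"
    have "f z = trace (P ** (diag_mat g ** (cadj P ** T ** W) ** diag_mat (\<lambda>k. of_real (m k)) ** (cadj W ** T)))"
      unfolding f_def SS R_def g_def[symmetric] spectral_def by (simp add: matrix_mul_assoc)
    also have "\<dots> = trace (diag_mat g ** (cadj P ** T ** W) ** diag_mat (\<lambda>k. of_real (m k)) ** (cadj W ** T ** P))"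
      by (subst trace_comm) (simp add: matrix_mul_assoc)
    also have "cmod \<dots> \<le> Q powr (1 / \<alpha>)"
    proof (rule trace_hoelder[OF _ _ \<alpha> P(3,4) W(2) Q])
      have T: "contraction T" unfolding T_def by (intro contraction_spectral U norm_cpow_imaginary) (simp add: z)
      show "contraction (cadj P ** T ** W)" "contraction (cadj W ** T ** P)"
        by (intro contraction_mult unitary_contraction unitary_cadj P W T)+
      show "cmod (g i) \<le> p i powr ((\<alpha> - 1) / \<alpha>)" for i
        by (simp add: g_def norm_cpow z \<theta>_def)
    qed
    finally show ?thesis .
  qed
  ultimately have fx: "cmod (f (of_real x)) \<le> 1 powr (1 - x) * (Q powr (1 / \<alpha>)) powr x" if "0 \<le> x" "x \<le> 1" for x
    using that Q(2) by (intro three_lines) auto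
  \<comment> \<open>The product rule in the shape that \<open>mat_deriv_mult\<close> returns; the
    zero matrix is the derivative of the constant factor \<rho>.\<close>
  define D where "D = spectral P (\<lambda>i. of_real \<theta> * of_real (ln_supp (p i)) * cpow (p i) (0 + of_real \<theta> * of_real 0)) ** (S (of_real 0) ** \<rho> ** S (of_real 0))
     + R (of_real 0) ** ((spectral U (\<lambda>i. of_real s * of_real (ln_supp (l i)) * cpow (l i) (0 + of_real s * of_real 0)) ** \<rho> + S (of_real 0) ** 0) ** S (of_real 0)
       + (S (of_real 0) ** \<rho>) ** spectral U (\<lambda>i. of_real s * of_real (ln_supp (l i)) * cpow (l i) (0 + of_real s * of_real 0)))"
  have "mat_deriv (\<lambda>z. R z ** (S z ** \<rho> ** S z)) D (of_real 0)"
    unfolding D_def R_def S_def by (intro mat_deriv_mult mat_deriv_spectral mat_deriv_const)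
  then have der: "((\<lambda>x. Re (f (of_real x))) has_real_derivative Re (trace D)) (at 0)"
    unfolding f_def by (rule mat_deriv_trace)
  have S0: "S 0 = spow U l 0" and R0: "R 0 = spow P p 0" by (simp_all add: S_def R_def)
  have "Re (trace D) \<le> ln Q / \<alpha>"
  proof (rule exp_bound_derivative[OF der])
    show "Re (f (of_real 0)) = 1" by (simp add: f_def S0 R0 \<rho>_support \<rho>_self_support trace_\<rho>)
    fix x :: real assume x: "0 \<le> x" "x \<le> 1"
    have "Re (f (of_real x)) \<le> 1 powr (1 - x) * (Q powr (1 / \<alpha>)) powr x"
      using fx[OF x] complex_Re_le_cmod order_trans by blast
    also have "\<dots> = exp (ln Q / \<alpha> * x)" using Q(2) by (simp add: powr_powr) (simp add: powr_def mult_ac)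
    finally show "Re (f (of_real x)) \<le> exp (ln Q / \<alpha> * x)" .
  qed
  moreover have "trace D = of_real \<theta> * (trace (mlog \<rho> ** \<rho>) - trace (mlog \<sigma> ** \<rho>))"
  proof -
    define B where "B = spectral U (\<lambda>i. of_real s * of_real (ln_supp (l i)))"
    have "D = spectral P (\<lambda>i. of_real \<theta> * of_real (ln_supp (p i))) ** \<rho> + R 0 ** (B ** \<rho> ** S 0 + (S 0 ** \<rho>) ** B)"
      by (simp add: D_def B_def mult.assoc ln_supp_cpow_0 S0 \<rho>_support)
    also have "B ** \<rho> ** S 0 = B ** \<rho>" by (simp add: matrix_mul_assoc[symmetric] S0 \<rho>_support)
    also have "S 0 ** \<rho> = \<rho>" by (simp add: S0 \<rho>_support)
    finally have "trace D = trace (spectral P (\<lambda>i. of_real \<theta> * of_real (ln_supp (p i))) ** \<rho>) + (trace (R 0 ** (B ** \<rho>)) + trace (R 0 ** (\<rho> ** B)))"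
      by (simp add: trace_add matrix_add_ldistrib)
    also have "trace (R 0 ** (B ** \<rho>)) = trace (B ** \<rho>)"
      by (subst trace_comm) (simp add: matrix_mul_assoc[symmetric] R0 \<rho>_self_support)
    also have "trace (R 0 ** (\<rho> ** B)) = trace (\<rho> ** B)"
      by (simp add: matrix_mul_assoc R0 \<rho>_self_support)
    also have "trace (\<rho> ** B) = trace (B ** \<rho>)" by (rule trace_comm)
    also have "trace (B ** \<rho>) = of_real s * trace (mlog \<sigma> ** \<rho>)" unfolding B_def trace_spectral_scale mlog_\<sigma> ..
    also have "trace (spectral P (\<lambda>i. of_real \<theta> * of_real (ln_supp (p i))) ** \<rho>) = of_real \<theta> * trace (mlog \<rho> ** \<rho>)"
      unfolding trace_spectral_scale mlog_\<rho> ..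
    finally have "trace D = of_real \<theta> * trace (mlog \<rho> ** \<rho>) + of_real (2 * s) * trace (mlog \<sigma> ** \<rho>)" by simp
    \<comment> \<open>The two powers of \<sigma> together contribute \<open>2 * s\<close>, which
      balances \<theta>, so a difference of logarithms appears.\<close>
    also have "2 * s = - \<theta>" using \<alpha> by (simp add: s_def \<theta>_def field_simps)
    finally show ?thesis by (simp add: algebra_simps)
  qed
  ultimately have "\<theta> * rel_ent \<rho> \<sigma> \<le> ln Q / \<alpha>" by (simp add: rel_ent_eq)
  then have "\<alpha> * (\<theta> * rel_ent \<rho> \<sigma>) \<le> ln Q" using \<alpha> by (simp add: field_simps)
  moreover have "\<alpha> * (\<theta> * rel_ent \<rho> \<sigma>) = (\<alpha> - 1) * rel_ent \<rho> \<sigma>" using \<alpha> by (simp add: \<theta>_def)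
  ultimately show ?thesis using \<alpha> by (simp add: field_simps)
qed

text \<open>The trace of \<open>\<rho>^\<alpha> ** \<sigma>^(1 - \<alpha>)\<close> from the Petz
  divergence. The exponents are spelled as affine functions to match
  \<open>mat_deriv_spectral\<close>.\<close>

definition petz :: "real \<Rightarrow> real" where
  "petz \<alpha> = Re (trace (spow P p (0 + 1 * of_real \<alpha>) ** spow U l (1 + - 1 * of_real \<alpha>)))"

lemma petz_1: "petz 1 = 1"
  by (simp add: petz_def \<rho>_cpow \<rho>_support trace_\<rho>)

text \<open>Together with \<open>petz_1\<close> this says that
  \<open>ln (petz \<alpha>) / (\<alpha> - 1)\<close> tends to the relative entropy as \<alpha> tends
  to 1.\<close>

lemma petz_deriv: "(petz has_real_derivative rel_ent \<rho> \<sigma>) (at 1)"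
proof -
  define D where "D = spectral P (\<lambda>i. 1 * of_real (ln_supp (p i)) * cpow (p i) (0 + 1 * of_real 1)) ** spow U l (1 + - 1 * of_real 1)
    + spow P p (0 + 1 * of_real 1) ** spectral U (\<lambda>i. - 1 * of_real (ln_supp (l i)) * cpow (l i) (1 + - 1 * of_real 1))"
  have "mat_deriv (\<lambda>z. spow P p (0 + 1 * z) ** spow U l (1 + - 1 * z)) D (of_real 1)"
    unfolding D_def by (intro mat_deriv_mult mat_deriv_spectral)
  then have "(petz has_real_derivative Re (trace D)) (at 1)"
    unfolding petz_def by (rule mat_deriv_trace)
  moreover have "Re (trace D) = rel_ent \<rho> \<sigma>"
  proof -
    have "spectral P (\<lambda>i. of_real (ln_supp (p i)) * cpow (p i) 1) = mlog \<rho> ** \<rho>"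
    proof -
      have "spectral P (\<lambda>i. of_real (ln_supp (p i)) * cpow (p i) 1) = spectral P (\<lambda>i. of_real (ln_supp (p i))) ** spow P p 1"
        by (simp only: spectral_mult[OF P(1)])
      then show ?thesis by (simp only: mlog_\<rho> \<rho>_cpow)
    qed
    then have "D = mlog \<rho> ** \<rho> ** spow U l 0 + \<rho> ** spectral U (\<lambda>i. - 1 * of_real (ln_supp (l i)))"
      by (simp add: D_def \<rho>_cpow ln_supp_cpow_0)
    also have "mlog \<rho> ** \<rho> ** spow U l 0 = mlog \<rho> ** \<rho>"
      by (simp add: matrix_mul_assoc[symmetric] \<rho>_support)
    finally have "trace D = trace (mlog \<rho> ** \<rho>) + trace (spectral U (\<lambda>i. - 1 * of_real (ln_supp (l i))) ** \<rho>)"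
      by (simp only: trace_add trace_comm[of \<rho>])
    also have "trace (spectral U (\<lambda>i. - 1 * of_real (ln_supp (l i))) ** \<rho>) = - trace (mlog \<sigma> ** \<rho>)"
      unfolding trace_spectral_scale mlog_\<sigma> by simp
    finally show ?thesis by (simp add: rel_ent_eq)
  qed
  ultimately show ?thesis by simp
qed

text \<open>Araki-Lieb-Thirring, again by interpolation: with \<open>K z = \<sigma>^(-z(\<alpha> - 1)/2) ** \<rho>^(z\<alpha>/2)\<close>, the sandwiched
  operator equals \<open>K ** cadj K\<close> at \<open>z = 1 / \<alpha>\<close>, while \<open>petz \<alpha>\<close> is the squared norm of \<open>K\<close> at \<open>z = 1\<close>.\<close>

lemma sandwiched_le_petz:
  assumes \<alpha>: "\<alpha> > 1"
  defines "Q \<equiv> sandwiched_Q \<alpha> \<rho> \<sigma>"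
  shows "petz \<alpha> > 0 \<and> ln Q \<le> ln (petz \<alpha>)"
proof (rule sandwich_diagonalizable[where \<alpha> = \<alpha>, OF \<rho> U l supp])
  define s where "s = (1 - \<alpha>) / (2 * \<alpha>)"
  fix W m
  assume W: "unitary_mat W" "\<And>k. m k \<ge> 0"
    "spow U l (of_real ((1 - \<alpha>) / (2 * \<alpha>))) ** \<rho> ** spow U l (of_real ((1 - \<alpha>) / (2 * \<alpha>))) = sreal W m"
    "sandwiched_Q \<alpha> \<rho> \<sigma> = (\<Sum>k\<in>UNIV. Re (cpow (m k) (of_real \<alpha>)))" "sandwiched_Q \<alpha> \<rho> \<sigma> > 0"
  note M = W(3)[folded s_def]
  define q where "q = (\<lambda>k. Re (cpow (m k) (of_real \<alpha>)))"
  have q: "cpow (m k) (of_real \<alpha>) = of_real (q k)" "q k \<ge> 0" for k by (simp_all add: q_def cpow_of_real)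
  have Q: "Q = (\<Sum>k\<in>UNIV. q k)" "Q > 0"
    using W(4,5) unfolding Q_def q_def by simp_all
  define c where "c = - (\<alpha> - 1) / 2"
  define S where "S = (\<lambda>z. spow U l (0 + of_real c * z))"
  define R where "R = (\<lambda>z. spow P p (0 + of_real (\<alpha> / 2) * z))"
  define K where "K = spow U l (of_real s) ** spow P p (of_real (1 / 2))"
  \<comment> \<open>As \<open>K ** cadj K = sreal W m\<close>, this is the adjoint of the partial
    isometry in the polar decomposition of \<open>K\<close>. It closes the trace so that
    \<open>f\<close> takes the value \<open>Q\<close> at \<open>1 / \<alpha>\<close>.\<close>
  define C where "C = cadj K ** spow W m (of_real (- 1 / 2))"
  define N where "N = (\<lambda>z. spow W m (of_real \<alpha> + of_real (- \<alpha> / 2) * z))"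
  define f where "f = (\<lambda>z. trace ((C ** N z) ** (S z ** R z)))"
  have KK: "K ** cadj K = sreal W m"
  proof -
    have "spow P p (of_real (1 / 2)) ** spow P p (of_real (1 / 2)) = \<rho>"
      unfolding spectral_mult[OF P(1)] cpow_add[symmetric] by (simp add: \<rho>_cpow)
    then show ?thesis unfolding M[symmetric]
      by (simp add: K_def cadj_mult cadj_spectral cnj_cpow matrix_mul_assoc) (metis matrix_mul_assoc)
  qed
  have C: "contraction C"
  proof -
    have "cadj C ** cadj (cadj C) = spow W m (of_real (- 1 / 2)) ** (K ** cadj K) ** spow W m (of_real (- 1 / 2))"
      by (simp add: C_def cadj_mult cadj_spectral cnj_cpow matrix_mul_assoc)
    also have "\<dots> = spow W m 0"
    proof -
      have "cpow (m k) (of_real (- 1 / 2)) * of_real (m k) * cpow (m k) (of_real (- 1 / 2)) = cpow (m k) 0" for k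
      proof -
        have "cpow (m k) (of_real (- 1 / 2)) * cpow (m k) 1 * cpow (m k) (of_real (- 1 / 2)) = cpow (m k) 0"
          unfolding cpow_add[symmetric] by simp
        then show ?thesis by (simp add: cpow_one W(2))
      qed
      then show ?thesis unfolding KK spectral_mult[OF W(1)] by presburger
    qed
    finally have "contraction (cadj C ** cadj (cadj C))"
      by (simp add: contraction_spectral W norm_cpow_imaginary)
    then have "contraction (cadj C)" by (rule contraction_of_gram)
    from contraction_cadj[OF this] show ?thesis by simp
  qed
  have petz: "(norm (S 1 ** R 1))\<^sup>2 = petz \<alpha>"
  proof -
    have "complex_of_real ((norm (S 1 ** R 1))\<^sup>2) = trace ((S 1 ** R 1) ** cadj (S 1 ** R 1))"
      by (rule norm_sq_trace)
    also have "\<dots> = trace ((S 1 ** (R 1 ** R 1)) ** S 1)"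
      by (simp add: cadj_mult S_def R_def cadj_spectral cnj_cpow matrix_mul_assoc)
    also have "\<dots> = trace ((R 1 ** R 1) ** (S 1 ** S 1))"
      by (subst trace_comm, subst (2) trace_comm) (simp add: matrix_mul_assoc)
    also have "R 1 ** R 1 = spow P p (0 + 1 * of_real \<alpha>)"
      unfolding R_def spectral_mult[OF P(1)] cpow_add[symmetric] by simp
    also have "S 1 ** S 1 = spow U l (1 + - 1 * of_real \<alpha>)"
    proof -
      have e: "0 + complex_of_real c * 1 + (0 + of_real c * 1) = 1 + - 1 * of_real \<alpha>"
        by (simp add: complex_eq_iff c_def field_simps)
      show ?thesis unfolding S_def spectral_mult[OF U] cpow_add[symmetric] e ..
    qed
    finally show ?thesis unfolding petz_def by (metis Re_complex_of_real)
  qed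
  \<comment> \<open>If the product vanished, multiplying by the complementary powers on both sides
    would leave \<rho> = 0.\<close>
  have petz_pos: "petz \<alpha> > 0"
  proof (rule ccontr)
    assume "\<not> ?thesis"
    then have "norm (S 1 ** R 1) = 0" using petz by (metis not_less power2_less_eq_zero_iff zero_eq_power2 norm_ge_zero order_antisym zero_le_power2)
    then have z: "S 1 ** R 1 = 0" by simp
    have "spow U l (- of_real c) ** (S 1 ** R 1) ** spow P p (1 - of_real (\<alpha> / 2))
      = (spow U l (- of_real c) ** S 1) ** (R 1 ** spow P p (1 - of_real (\<alpha> / 2)))"
      by (simp add: matrix_mul_assoc)
    also have "\<dots> = spow U l 0 ** spow P p 1"
      unfolding S_def R_def spectral_mult[OF U] spectral_mult[OF P(1)] cpow_add[symmetric] by simp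
    finally have "\<rho> = 0" by (simp add: z \<rho>_cpow \<rho>_support)
    then show False using trace_\<rho> by (simp add: trace_def)
  qed
  have "f holomorphic_on UNIV" unfolding f_def R_def S_def N_def
    by (intro holomorphic_trace holomorphic_matrix_mult holomorphic_spectral_cpow holomorphic_on_const)
  moreover obtain B where "\<And>z. 0 \<le> Re z \<Longrightarrow> Re z \<le> 1 \<Longrightarrow> cmod (f z) \<le> B"
  proof (rule strip_bound_trace)
    show "\<exists>K. \<forall>z. 0 \<le> Re z \<longrightarrow> Re z \<le> 1 \<longrightarrow> norm ((C ** N z) ** (S z ** R z)) \<le> K"
      unfolding R_def S_def N_def by (intro strip_bound_mult spectral_strip_bound P U W) blast
  qed (use f_def in blast)
  moreover have "cmod (f z) \<le> Q" if z: "Re z = 0" for z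
  proof -
    define J where "J = spow W m (of_real (- \<alpha> / 2) * z)"
    have "N z = J ** sreal W q"
      unfolding N_def J_def q(1)[symmetric] spectral_mult[OF W(1)] cpow_add[symmetric] by (simp add: add.commute)
    then have "f z = trace ((C ** J ** sreal W q) ** (S z ** R z))" by (simp add: f_def matrix_mul_assoc)
    also have "\<dots> = trace ((S z ** R z ** C ** J) ** sreal W q)"
      by (subst trace_comm) (simp add: matrix_mul_assoc)
    finally have "f z = \<dots>" .
    moreover have "contraction (S z ** R z ** C ** J)" unfolding S_def R_def J_def
      by (intro contraction_mult contraction_spectral U P W C norm_cpow_imaginary) (simp_all add: z)
    ultimately show ?thesis unfolding Q(1) using norm_trace_contraction_spectral[where p = q, OF _ W(1) q(2)] by simp
  qed
  moreover have "cmod (f z) \<le> sqrt Q * sqrt (petz \<alpha>)" if z: "Re z = 1" for z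
  proof -
    have "cmod (f z) \<le> norm (C ** N z) * norm (S z ** R z)" unfolding f_def by (rule norm_trace_mult_le)
    also have "\<dots> \<le> sqrt Q * sqrt (petz \<alpha>)"
    proof (intro mult_mono)
      have "(norm (N z))\<^sup>2 = Q" unfolding N_def norm_spectral_sq[OF W(1)] Q(1)
      proof (rule sum.cong[OF refl])
        fix k
        show "(cmod (cpow (m k) (of_real \<alpha> + of_real (- \<alpha> / 2) * z)))\<^sup>2 = q k"
        proof (cases "m k > 0")
          case True
          have e: "Re (of_real \<alpha> + of_real (- \<alpha> / 2) * z) = \<alpha> / 2" using z by simp
          have "cmod (cpow (m k) w) = m k powr Re w" for w using True by (simp add: norm_cpow)
          then have "(cmod (cpow (m k) (of_real \<alpha> + of_real (- \<alpha> / 2) * z)))\<^sup>2 = (m k powr (\<alpha> / 2))\<^sup>2"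
            by (simp only: e)
          also have "\<dots> = m k powr \<alpha>" using True by (simp add: powr_realpow[symmetric] powr_powr)
          finally show ?thesis using True by (simp add: q_def cpow_of_real)
        qed (simp add: cpow_def q_def)
      qed
      then have "norm (N z) = sqrt Q" by (intro real_sqrt_unique[symmetric]) auto
      then show "norm (C ** N z) \<le> sqrt Q" using norm_contraction_mult[OF C, of "N z"] by simp
      have "S z = spow U l (of_real c * (z - 1)) ** S 1"
        unfolding S_def spectral_mult[OF U] cpow_add[symmetric] by (simp add: algebra_simps)
      moreover have "R z = R 1 ** spow P p (of_real (\<alpha> / 2) * (z - 1))"
      proof -
        have "0 + a * z = (0 + a * 1) + a * (z - 1)" for a by (simp add: algebra_simps)
        then show ?thesis unfolding R_def spectral_mult[OF P(1)] cpow_add[symmetric] by (simp only:)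
      qed
      ultimately have "S z ** R z = spow U l (of_real c * (z - 1)) ** ((S 1 ** R 1) ** spow P p (of_real (\<alpha> / 2) * (z - 1)))"
        by (simp add: matrix_mul_assoc)
      also have "norm \<dots> \<le> norm ((S 1 ** R 1) ** spow P p (of_real (\<alpha> / 2) * (z - 1)))"
        by (intro norm_contraction_mult contraction_spectral U norm_cpow_imaginary) (simp add: z)
      also have "\<dots> \<le> norm (S 1 ** R 1)"
        by (intro norm_mult_contraction contraction_spectral P norm_cpow_imaginary) (simp add: z)
      also have "\<dots> = sqrt (petz \<alpha>)" using petz by (intro real_sqrt_unique[symmetric]) auto
      finally show "norm (S z ** R z) \<le> sqrt (petz \<alpha>)" .
    qed (use Q in auto)
    finally show ?thesis .
  qed
  ultimately have "cmod (f (of_real (1 / \<alpha>))) \<le> Q powr (1 - 1 / \<alpha>) * (sqrt Q * sqrt (petz \<alpha>)) powr (1 / \<alpha>)"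
    using \<alpha> Q(2) petz_pos by (intro three_lines) auto
  moreover have "f (of_real (1 / \<alpha>)) = of_real Q"
  proof -
    have "complex_of_real c * of_real (1 / \<alpha>) = of_real s" unfolding of_real_mult[symmetric]
      using \<alpha> by (intro arg_cong[of _ _ complex_of_real]) (simp add: c_def s_def field_simps)
    moreover have "complex_of_real (\<alpha> / 2) * of_real (1 / \<alpha>) = of_real (1 / 2)" unfolding of_real_mult[symmetric]
      using \<alpha> by (intro arg_cong[of _ _ complex_of_real]) simp
    ultimately have SR: "S (of_real (1 / \<alpha>)) ** R (of_real (1 / \<alpha>)) = K"
      unfolding S_def R_def K_def by (simp only: add_0)
    have "complex_of_real \<alpha> + of_real (- \<alpha> / 2) * of_real (1 / \<alpha>) = of_real (\<alpha> - 1 / 2)"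
      unfolding of_real_mult[symmetric] of_real_add[symmetric]
      using \<alpha> by (intro arg_cong[of _ _ complex_of_real]) simp
    then have N: "N (of_real (1 / \<alpha>)) = spow W m (of_real (\<alpha> - 1 / 2))"
      unfolding N_def by (simp only:)
    have "f (of_real (1 / \<alpha>)) = trace (cadj K ** (spow W m (of_real (- 1 / 2)) ** spow W m (of_real (\<alpha> - 1 / 2)) ** K))"
      unfolding f_def SR N C_def by (simp add: matrix_mul_assoc)
    also have "\<dots> = trace (spow W m (of_real (- 1 / 2)) ** spow W m (of_real (\<alpha> - 1 / 2)) ** (K ** cadj K))"
      by (subst trace_comm) (simp add: matrix_mul_assoc)
    also have "\<dots> = (\<Sum>k\<in>UNIV. cpow (m k) (of_real (- 1 / 2)) * cpow (m k) (of_real (\<alpha> - 1 / 2)) * of_real (m k))"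
      unfolding KK spectral_mult[OF W(1)] trace_spectral[OF W(1)] ..
    also have "\<dots> = (\<Sum>k\<in>UNIV. of_real (q k))"
    proof (rule sum.cong[OF refl])
      fix k
      have "of_real (- 1 / 2) + of_real (\<alpha> - 1 / 2) + 1 = complex_of_real \<alpha>" by simp
      then have "cpow (m k) (of_real (- 1 / 2)) * cpow (m k) (of_real (\<alpha> - 1 / 2)) * cpow (m k) 1 = of_real (q k)"
        unfolding cpow_add[symmetric] q(1)[symmetric] by (rule arg_cong)
      then show "cpow (m k) (of_real (- 1 / 2)) * cpow (m k) (of_real (\<alpha> - 1 / 2)) * of_real (m k) = of_real (q k)"
        by (simp add: cpow_one W(2))
    qed
    finally show ?thesis by (simp add: Q(1))
  qed
  \<comment> \<open>\<open>Q\<close> stands on both sides; in logarithms all that remains is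
    \<open>1 / (2 * \<alpha>)\<close> times the difference of \<open>ln (petz \<alpha>)\<close> and
    \<open>ln Q\<close>.\<close>
  ultimately have "Q \<le> Q powr (1 - 1 / \<alpha>) * (sqrt Q * sqrt (petz \<alpha>)) powr (1 / \<alpha>)" using Q(2) by simp
  then have "ln Q \<le> ln (Q powr (1 - 1 / \<alpha>) * (sqrt Q * sqrt (petz \<alpha>)) powr (1 / \<alpha>))"
    using Q(2) petz_pos by simp
  also have "\<dots> = (1 - 1 / \<alpha>) * ln Q + 1 / \<alpha> * (ln Q / 2 + ln (petz \<alpha>) / 2)"
    using Q(2) petz_pos by (simp add: ln_mult ln_powr ln_sqrt)
  finally have "0 \<le> 1 / (2 * \<alpha>) * (ln (petz \<alpha>) - ln Q)" by (simp add: algebra_simps)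
  then have "ln Q \<le> ln (petz \<alpha>)" using \<alpha> by (simp add: zero_le_divide_iff)
  then show ?thesis using petz_pos by simp
qed

text \<open>Klein's inequality by reduction to the classical case: the squared overlaps
  \<open>w\<close> are doubly stochastic, \<open>x ln (x / y) \<ge> x - y\<close> is applied
  termwise, and the linear terms sum to 1 - 1.\<close>

lemma klein:
  assumes suml: "(\<Sum>i\<in>UNIV. l i) = 1"
  shows "rel_ent \<rho> \<sigma> \<ge> 0"
proof -
  define W where "W = cadj P ** U"
  define w where "w = (\<lambda>i j. (cmod (W $ i $ j))\<^sup>2)"
  have uW: "unitary_mat W" unfolding W_def by (intro unitary_mult unitary_cadj P U)
  have row: "(\<Sum>j\<in>UNIV. w i j) = 1" for i unfolding w_def by (rule unitary_row[OF uW])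
  have col: "(\<Sum>i\<in>UNIV. w i j) = 1" for j unfolding w_def by (rule unitary_col[OF uW])
  \<comment> \<open>Where the logarithm of \<sigma> is cut off, the support condition makes the
    overlap vanish.\<close>
  have zero: "w i j = 0" if "p i > 0" "\<not> l j > 0" for i j
  proof -
    have "diag_mat (\<lambda>i. complex_of_real (p i)) ** W ** diag_mat (\<lambda>j. cpow (l j) 0) = cadj P ** (\<rho> ** spow U l 0) ** U"
    proof -
      have "cadj P ** (\<rho> ** spow U l 0) ** U = (cadj P ** P) ** diag_mat (\<lambda>i. complex_of_real (p i)) ** W ** diag_mat (\<lambda>j. cpow (l j) 0) ** (cadj U ** U)"
        unfolding P(2) spectral_def W_def by (simp add: matrix_mul_assoc)
      then show ?thesis using P(1) U by (simp add: unitary_mat_def)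
    qed
    also have "\<dots> = (cadj P ** P) ** diag_mat (\<lambda>i. complex_of_real (p i)) ** W"
      unfolding \<rho>_support unfolding P(2) spectral_def W_def by (simp add: matrix_mul_assoc)
    also have "\<dots> = diag_mat (\<lambda>i. complex_of_real (p i)) ** W" using P(1) by (simp add: unitary_mat_def)
    finally have "of_real (p i) * W $ i $ j * cpow (l j) 0 = of_real (p i) * W $ i $ j"
      by (metis diag_mat_mult_nth mult_diag_mat_nth)
    then show ?thesis using that by (simp add: cpow_0 w_def)
  qed
  have "rel_ent \<rho> \<sigma> = (\<Sum>i\<in>UNIV. ln_supp (p i) * p i) - (\<Sum>i\<in>UNIV. \<Sum>j\<in>UNIV. p i * ln_supp (l j) * w i j)"
  proof -
    have "trace (mlog \<rho> ** \<rho>) = (\<Sum>i\<in>UNIV. of_real (ln_supp (p i)) * of_real (p i))"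
      unfolding mlog_\<rho> by (subst P(2)) (simp add: spectral_mult[OF P(1)] trace_spectral[OF P(1)])
    then have "trace (mlog \<rho> ** \<rho>) = of_real (\<Sum>i\<in>UNIV. ln_supp (p i) * p i)" by simp
    moreover have "trace (mlog \<sigma> ** \<rho>) = of_real (\<Sum>i\<in>UNIV. \<Sum>j\<in>UNIV. p i * ln_supp (l j) * w i j)"
    proof -
      have "trace (mlog \<sigma> ** \<rho>) = trace (\<rho> ** mlog \<sigma>)" by (rule trace_comm)
      also have "\<dots> = (\<Sum>i\<in>UNIV. \<Sum>j\<in>UNIV. of_real (p i) * of_real (ln_supp (l j)) * of_real ((cmod (W $ i $ j))\<^sup>2))"
        unfolding mlog_\<sigma> unfolding P(2) W_def by (rule trace_spectral_spectral[OF P(1) U])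
      finally show ?thesis by (simp add: w_def)
    qed
    ultimately show ?thesis by (simp add: rel_ent_eq)
  qed
  also have "(\<Sum>i\<in>UNIV. ln_supp (p i) * p i) = (\<Sum>i\<in>UNIV. \<Sum>j\<in>UNIV. ln_supp (p i) * p i * w i j)"
    by (simp add: sum_distrib_left[symmetric] row)
  also have "\<dots> - (\<Sum>i\<in>UNIV. \<Sum>j\<in>UNIV. p i * ln_supp (l j) * w i j) = (\<Sum>i\<in>UNIV. \<Sum>j\<in>UNIV. p i * (ln_supp (p i) - ln_supp (l j)) * w i j)"
    by (simp add: sum_subtractf[symmetric] algebra_simps)
  also have "\<dots> \<ge> (\<Sum>i\<in>UNIV. \<Sum>j\<in>UNIV. (p i - l j) * w i j)"
  proof (intro sum_mono)
    fix i j
    have w: "w i j \<ge> 0" by (simp add: w_def)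
    consider "p i = 0" | "p i > 0" "l j > 0" | "p i > 0" "\<not> l j > 0" using P(3)[of i] by force
    then show "(p i - l j) * w i j \<le> p i * (ln_supp (p i) - ln_supp (l j)) * w i j"
    proof cases
      case 1
      then show ?thesis using l[of j] w by simp
    next
      case 2
      have "ln (l j / p i) \<le> l j / p i - 1" using 2 by (intro ln_le_minus_one) simp
      then have "p i * ln (l j / p i) \<le> l j - p i" using 2 by (simp add: field_simps)
      then have "p i - l j \<le> p i * (ln_supp (p i) - ln_supp (l j))" using 2 by (simp add: ln_supp_def ln_div algebra_simps)
      then show ?thesis using w by (rule mult_right_mono)
    next
      case 3
      then show ?thesis by (simp add: zero)
    qed
  qed
  finally have "(\<Sum>i\<in>UNIV. \<Sum>j\<in>UNIV. (p i - l j) * w i j) \<le> rel_ent \<rho> \<sigma>" .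
  moreover have "(\<Sum>i\<in>UNIV. \<Sum>j\<in>UNIV. (p i - l j) * w i j) = 0"
  proof -
    have "(\<Sum>i\<in>UNIV. \<Sum>j\<in>UNIV. (p i - l j) * w i j) = (\<Sum>i\<in>UNIV. p i * (\<Sum>j\<in>UNIV. w i j)) - (\<Sum>i\<in>UNIV. \<Sum>j\<in>UNIV. l j * w i j)"
      by (simp add: left_diff_distrib sum_subtractf sum_distrib_left)
    also have "(\<Sum>i\<in>UNIV. \<Sum>j\<in>UNIV. l j * w i j) = (\<Sum>j\<in>UNIV. l j * (\<Sum>i\<in>UNIV. w i j))"
      by (subst sum.swap) (simp add: sum_distrib_left)
    finally show ?thesis by (simp add: row col P(4) suml)
  qed
  ultimately show ?thesis by simp
qed

end

lemma rel_ent_le_sandwiched: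
  fixes \<rho> :: "complex^'n::finite^'n"
  assumes \<rho>: "density \<rho>" and \<sigma>: "psd \<sigma>" and supp: "\<And>v. \<sigma> *v v = 0 \<Longrightarrow> \<rho> *v v = 0" and \<alpha>: "\<alpha> > 1"
  shows "rel_ent \<rho> \<sigma> \<le> 1 / (\<alpha> - 1) * ln (sandwiched_Q \<alpha> \<rho> \<sigma>)"
proof -
  obtain U l where uU: "unitary_mat U" "\<sigma> = sreal U l" "\<And>i. l i \<ge> 0" using psd_diagonalizable[OF \<sigma>] by metis
  obtain P p where uP: "unitary_mat P" "\<rho> = sreal P p" "\<And>i. p i \<ge> 0" "(\<Sum>i\<in>UNIV. p i) = 1"
    using density_diagonalizable[OF \<rho>] by metis
  interpret supported_pair \<rho> U l P p
    by unfold_locales (use \<rho> uU uP supp in auto)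
  show ?thesis using rel_ent_le[OF \<alpha>] unfolding uU(2) .
qed

lemma rel_ent_nonneg:
  fixes \<rho> :: "complex^'n::finite^'n"
  assumes \<rho>: "density \<rho>" and \<sigma>: "density \<sigma>" and supp: "\<And>v. \<sigma> *v v = 0 \<Longrightarrow> \<rho> *v v = 0"
  shows "rel_ent \<rho> \<sigma> \<ge> 0"
proof -
  obtain U l where uU: "unitary_mat U" "\<sigma> = sreal U l" "\<And>i. l i \<ge> 0" "(\<Sum>i\<in>UNIV. l i) = 1"
    using density_diagonalizable[OF \<sigma>] by metis
  obtain P p where uP: "unitary_mat P" "\<rho> = sreal P p" "\<And>i. p i \<ge> 0" "(\<Sum>i\<in>UNIV. p i) = 1"
    using density_diagonalizable[OF \<rho>] by metis
  interpret supported_pair \<rho> U l P p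
    by unfold_locales (use \<rho> uU uP supp in auto)
  show ?thesis using klein[OF uU(4)] unfolding uU(2) .
qed

text \<open>Packages the Petz trace as an anonymous majorant, so that the eigenbases fixed in
  \<open>supported_pair\<close> do not leak out.\<close>

lemma sandwiched_upper_bound:
  fixes \<rho> :: "complex^'n::finite^'n"
  assumes \<rho>: "density \<rho>" and \<sigma>: "psd \<sigma>" and supp: "\<And>v. \<sigma> *v v = 0 \<Longrightarrow> \<rho> *v v = 0"
  shows "\<exists>g. (g has_real_derivative rel_ent \<rho> \<sigma>) (at 1) \<and> g 1 = 1 \<and>
    (\<forall>\<alpha>>1. g \<alpha> > 0 \<and> ln (sandwiched_Q \<alpha> \<rho> \<sigma>) \<le> ln (g \<alpha>))"
proof -
  obtain U l where uU: "unitary_mat U" "\<sigma> = sreal U l" "\<And>i. l i \<ge> 0" using psd_diagonalizable[OF \<sigma>] by metis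
  obtain P p where uP: "unitary_mat P" "\<rho> = sreal P p" "\<And>i. p i \<ge> 0" "(\<Sum>i\<in>UNIV. p i) = 1"
    using density_diagonalizable[OF \<rho>] by metis
  interpret supported_pair \<rho> U l P p
    by unfold_locales (use \<rho> uU uP supp in auto)
  show ?thesis
    unfolding uU(2) by (intro exI[of _ petz] conjI allI impI petz_deriv petz_1) (use sandwiched_le_petz in blast)+
qed

section \<open>Reduced states and conditional entropies\<close>

lemma kron_mat_1_diagonal:
  fixes \<sigma> :: "complex^'e::finite^'e"
  assumes "\<sigma> = sreal V l"
  shows "kron (mat 1 :: complex^'a::finite^'a) \<sigma> = spectral (kron (mat 1) V) (\<lambda>p. of_real (l (snd p)))"
  unfolding assms by (rule kron_mat_1_spectral)

lemma psd_kron_mat_1: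
  assumes "psd \<sigma>" shows "psd (kron (mat 1 :: complex^'a::finite^'a) \<sigma>)"
proof -
  obtain V l where V: "unitary_mat V" "\<sigma> = sreal V l" "\<And>i. l i \<ge> 0" using psd_diagonalizable[OF assms] by metis
  show ?thesis unfolding kron_mat_1_diagonal[OF V(2)] by (rule psd_spectral) (rule V(3))
qed

lemma mlog_kron_mat_1:
  assumes "psd \<sigma>" shows "mlog (kron (mat 1 :: complex^'a::finite^'a) \<sigma>) = kron (mat 1) (mlog \<sigma>)"
proof -
  obtain V l where V: "unitary_mat V" "\<sigma> = sreal V l" using psd_diagonalizable[OF assms] by metis
  show ?thesis
    unfolding mlog_spectral[OF V] mlog_spectral[OF unitary_kron_mat_1[OF V(1)] kron_mat_1_diagonal[OF V(2)]] kron_mat_1_spectral ..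
qed

lemma trace_kron_mat_1_mult: "trace (kron (mat 1) L ** X) = trace (L ** ptr1 X)"
  by (simp add: ptr1_left[symmetric] trace_ptr1)

text \<open>Let \<open>Z\<close> project onto the kernel of the reduced state. The squared norm of
  \<open>kron (mat 1) Z\<close> times the square root of \<rho> is
  \<open>trace (Z ** ptr1 \<rho>)\<close>, which is 0, so \<rho> annihilates the range of
  \<open>kron (mat 1) Z\<close>. By assumption \<open>v\<close> lies in that range.\<close>

lemma support_reduced:
  fixes \<rho> :: "complex^('a::finite\<times>'e::finite)^('a\<times>'e)"
  assumes \<rho>: "density \<rho>" and v: "kron (mat 1) (ptr1 \<rho>) *v v = 0"
  shows "\<rho> *v v = 0"
proof -
  obtain V l where V: "unitary_mat V" "ptr1 \<rho> = sreal V l" "\<And>i. l i \<ge> 0"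
    using density_diagonalizable[OF density_ptr1[OF \<rho>]] by metis
  obtain P p where P: "unitary_mat P" "\<rho> = sreal P p" "\<And>i. p i \<ge> 0"
    using density_diagonalizable[OF \<rho>] by metis
  define Z where "Z = spectral V (\<lambda>i. 1 - cpow (l i) 0)"
  define K where "K = kron (mat 1 :: complex^'a^'a) Z"
  define H where "H = spow P p (1 / 2)"
  have HH: "H ** H = \<rho>"
  proof -
    have "cpow (p i) (1 / 2) * cpow (p i) (1 / 2) = of_real (p i)" for i
      unfolding cpow_add[symmetric] by (simp add: cpow_one P(3))
    then show ?thesis unfolding H_def P(2) spectral_mult[OF P(1)] by presburger
  qed
  have cH: "cadj H = H" by (simp add: H_def cadj_spectral cnj_cpow)
  have cZ: "cadj Z = Z" by (simp add: Z_def cadj_spectral cnj_cpow)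
  have cK: "cadj K = K" by (simp add: K_def cadj_kron cZ)
  have "Z ** Z = Z"
  proof -
    have "(1 - cpow (l i) 0) * (1 - cpow (l i) 0) = 1 - cpow (l i) 0" for i by (simp add: cpow_0)
    then show ?thesis unfolding Z_def spectral_mult[OF V(1)] by presburger
  qed
  then have KK: "K ** K = K" by (simp add: K_def kron_mult)
  have "complex_of_real ((norm (K ** H))\<^sup>2) = trace ((K ** \<rho>) ** K)"
    unfolding norm_sq_trace cadj_mult cH cK HH[symmetric] by (simp add: matrix_mul_assoc)
  also have "\<dots> = trace (K ** \<rho>)" by (subst trace_comm) (simp add: matrix_mul_assoc KK)
  also have "\<dots> = trace (Z ** ptr1 \<rho>)" unfolding K_def by (rule trace_kron_mat_1_mult)
  also have "\<dots> = 0"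
    unfolding V(2) Z_def spectral_mult[OF V(1)] trace_spectral[OF V(1)]
    by (rule sum.neutral) (use V(3) in \<open>auto simp: cpow_0 order.antisym\<close>)
  finally have "K ** H = 0" by simp
  then have "K ** \<rho> = 0" unfolding HH[symmetric] by (simp add: matrix_mul_assoc)
  then have "cadj (K ** \<rho>) = cadj 0" by simp
  then have \<rho>K: "\<rho> ** K = 0"
    by (simp add: cadj_mult cK P(2) cadj_spectral) (simp add: vec_eq_iff)
  have "kron (mat 1 :: complex^'a^'a) (spow V l 0) = kron (mat 1) (spow V l (-1)) ** kron (mat 1) (ptr1 \<rho>)"
  proof -
    have "cpow (l i) (-1) * of_real (l i) = cpow (l i) 0" for i
      unfolding cpow_one[OF V(3), symmetric] cpow_add[symmetric] by simp
    then have "spow V l 0 = spow V l (-1) ** ptr1 \<rho>"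
      unfolding V(2) spectral_mult[OF V(1)] by presburger
    then show ?thesis by (simp add: kron_mult)
  qed
  then have E: "kron (mat 1 :: complex^'a^'a) (spow V l 0) *v v = 0"
    by (simp add: matrix_vector_mul_assoc[symmetric] v)
  have "K + kron (mat 1 :: complex^'a^'a) (spow V l 0) = mat 1"
  proof -
    have "Z + spow V l 0 = mat 1"
    proof -
      have "Z + spow V l 0 = spectral V (\<lambda>_. 1)"
        by (simp add: Z_def vec_eq_iff spectral_nth sum.distrib[symmetric] algebra_simps)
      then show ?thesis by (simp add: spectral_one V(1))
    qed
    then have "kron (mat 1 :: complex^'a^'a) (Z + spow V l 0) = mat 1" by (simp add: kron_mat_1)
    moreover have "kron (mat 1 :: complex^'a^'a) (X + Y) = kron (mat 1) X + kron (mat 1) Y" for X Y :: "complex^'e^'e"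
      by (simp add: vec_eq_iff kron_nth distrib_left)
    ultimately show ?thesis by (simp add: K_def)
  qed
  then have "K *v v + kron (mat 1 :: complex^'a^'a) (spow V l 0) *v v = v"
    by (metis matrix_vector_mult_add_rdistrib matrix_vector_mul_lid)
  then have "v = K *v v" using E by simp
  then have "\<rho> *v v = (\<rho> ** K) *v v" by (metis matrix_vector_mul_assoc)
  then show ?thesis by (simp add: \<rho>K)
qed

text \<open>A kernel vector of \<sigma>, placed in any one slice of the first factor, is a kernel
  vector of \<open>kron (mat 1) \<sigma>\<close>; summing over the slices produces the partial
  trace.\<close>

lemma support_ptr1:
  fixes \<rho> :: "complex^('a::finite\<times>'e::finite)^('a\<times>'e)"
  assumes supp: "\<And>v. kron (mat 1) \<sigma> *v v = 0 \<Longrightarrow> \<rho> *v v = 0" and v: "\<sigma> *v v = 0"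
  shows "ptr1 \<rho> *v v = 0"
proof -
  define u where "u = (\<lambda>i :: 'a. \<chi> p. (if fst p = i then v $ snd p else (0 :: complex)))"
  have s: "(\<Sum>p\<in>UNIV. f p * u i $ p) = (\<Sum>e\<in>UNIV. f (i, e) * v $ e)" for f :: "'a \<times> 'e \<Rightarrow> complex" and i
  proof -
    have "(\<Sum>p\<in>UNIV. f p * u i $ p) = (\<Sum>a\<in>UNIV. if a = i then (\<Sum>e\<in>UNIV. f (a, e) * v $ e) else 0)"
      unfolding sum_UNIV_prod by (rule sum.cong[OF refl]) (simp add: u_def)
    then show ?thesis by simp
  qed
  have "kron (mat 1) \<sigma> *v u i = 0" for i
  proof -
    have "(kron (mat 1) \<sigma> *v u i) $ p = 0" for p
    proof -
      have "(kron (mat 1) \<sigma> *v u i) $ p = (\<Sum>e\<in>UNIV. kron (mat 1) \<sigma> $ p $ (i, e) * v $ e)"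
        by (simp add: matrix_vector_mult_def s)
      also have "\<dots> = mat 1 $ fst p $ i * (\<sigma> *v v) $ snd p"
        by (simp add: kron_nth matrix_vector_mult_def sum_distrib_left)
      finally show ?thesis by (simp add: v)
    qed
    then show ?thesis by (simp add: vec_eq_iff)
  qed
  then have "\<rho> *v u i = 0" for i by (rule supp)
  then have "(\<Sum>i\<in>UNIV. (\<rho> *v u i) $ (i, k)) = 0" for k by simp
  then have "(\<Sum>i\<in>UNIV. \<Sum>e\<in>UNIV. \<rho> $ (i, k) $ (i, e) * v $ e) = 0" for k
    by (simp add: matrix_vector_mult_def s)
  then have "(\<Sum>e\<in>UNIV. \<Sum>i\<in>UNIV. \<rho> $ (i, k) $ (i, e) * v $ e) = 0" for k
    by (subst sum.swap)
  then show ?thesis by (simp add: vec_eq_iff matrix_vector_mult_def ptr1_def sum_distrib_right)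
qed

text \<open>The two sides differ by the relative entropy of \<open>ptr1 \<rho>\<close> and \<sigma>.
  So at \<alpha> = 1 the reduced state is the optimal choice.\<close>

lemma rel_ent_reduced_le:
  fixes \<rho> :: "complex^('a::finite\<times>'e::finite)^('a\<times>'e)"
  assumes \<rho>: "density \<rho>" and \<sigma>: "density \<sigma>" and supp: "\<And>v. kron (mat 1) \<sigma> *v v = 0 \<Longrightarrow> \<rho> *v v = 0"
  shows "rel_ent \<rho> (kron (mat 1) (ptr1 \<rho>)) \<le> rel_ent \<rho> (kron (mat 1) \<sigma>)"
proof -
  have "0 \<le> rel_ent (ptr1 \<rho>) \<sigma>"
    by (rule rel_ent_nonneg[OF density_ptr1[OF \<rho>] \<sigma>]) (rule support_ptr1[OF supp])
  moreover have "psd \<sigma>" "psd (ptr1 \<rho>)" using \<sigma> density_ptr1[OF \<rho>] by (auto simp: density_def)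
  ultimately show ?thesis
    by (simp add: rel_ent_eq mlog_kron_mat_1 trace_kron_mat_1_mult)
qed

lemma cond_vN_rel_ent: "cond_vN \<rho> = - rel_ent \<rho> (kron (mat 1) (ptr1 \<rho>))"
  by (simp add: cond_vN_def rel_ent_def)

text \<open>\<open>real_of_ereal\<close> is faithful only on finite values; the infimum is finite
  because it lies between the von Neumann value and the value at the reduced state. States within
  \<open>e\<close> of the infimum take the place of a minimizer.\<close>

lemma cond_sandwiched_characterization:
  fixes \<rho> :: "complex^('a::finite\<times>'e::finite)^('a\<times>'e)"
  assumes \<rho>: "density \<rho>" and \<alpha>: "\<alpha> > 1"
  shows "cond_sandwiched \<alpha> \<rho> \<le> cond_vN \<rho>"
    and "- cond_sandwiched \<alpha> \<rho> \<le> 1 / (\<alpha> - 1) * ln (sandwiched_Q \<alpha> \<rho> (kron (mat 1) (ptr1 \<rho>)))"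
    and "\<And>e. e > 0 \<Longrightarrow> \<exists>\<sigma>. density \<sigma> \<and> (\<forall>v. kron (mat 1) \<sigma> *v v = 0 \<longrightarrow> \<rho> *v v = 0) \<and>
      1 / (\<alpha> - 1) * ln (sandwiched_Q \<alpha> \<rho> (kron (mat 1) \<sigma>)) < - cond_sandwiched \<alpha> \<rho> + e"
proof -
  define S where "S = {sandwiched_div \<alpha> \<rho> (kron (mat 1 :: complex^'a^'a) \<sigma>) | \<sigma>. density \<sigma>}"
  have val: "sandwiched_div \<alpha> \<rho> \<sigma> = ereal (1 / (\<alpha> - 1) * ln (sandwiched_Q \<alpha> \<rho> \<sigma>))"
    if "\<forall>v. \<sigma> *v v = 0 \<longrightarrow> \<rho> *v v = 0" for \<sigma>
    unfolding sandwiched_div_def if_P[OF that] sandwiched_Q_def Let_def ..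
  have lower: "ereal (- cond_vN \<rho>) \<le> x" if x: "x \<in> S" for x
  proof -
    obtain \<sigma> where \<sigma>: "density \<sigma>" "x = sandwiched_div \<alpha> \<rho> (kron (mat 1 :: complex^'a^'a) \<sigma>)" using x unfolding S_def by blast
    show ?thesis
    proof (cases "\<forall>v. kron (mat 1 :: complex^'a^'a) \<sigma> *v v = 0 \<longrightarrow> \<rho> *v v = 0")
      case True
      have "- cond_vN \<rho> \<le> rel_ent \<rho> (kron (mat 1) \<sigma>)"
        unfolding cond_vN_rel_ent using rel_ent_reduced_le[OF \<rho> \<sigma>(1)] True by simp
      also have "\<dots> \<le> 1 / (\<alpha> - 1) * ln (sandwiched_Q \<alpha> \<rho> (kron (mat 1) \<sigma>))"
        using True \<sigma>(1)
        by (intro rel_ent_le_sandwiched \<rho> \<alpha> psd_kron_mat_1) (auto simp: density_def)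
      finally show ?thesis by (simp add: \<sigma>(2) val[OF True])
    next
      case False
      show ?thesis unfolding \<sigma>(2) sandwiched_div_def if_not_P[OF False] by simp
    qed
  qed
  have red: "\<forall>v. kron (mat 1 :: complex^'a^'a) (ptr1 \<rho>) *v v = 0 \<longrightarrow> \<rho> *v v = 0"
    using support_reduced[OF \<rho>] by blast
  have "sandwiched_div \<alpha> \<rho> (kron (mat 1) (ptr1 \<rho>)) \<in> S"
    unfolding S_def using density_ptr1[OF \<rho>] by blast
  then have up: "Inf S \<le> ereal (1 / (\<alpha> - 1) * ln (sandwiched_Q \<alpha> \<rho> (kron (mat 1) (ptr1 \<rho>))))"
    unfolding val[OF red] by (rule Inf_lower)
  have lo: "ereal (- cond_vN \<rho>) \<le> Inf S" by (rule Inf_greatest) (rule lower)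
  have fin: "Inf S = ereal (- cond_sandwiched \<alpha> \<rho>)"
  proof -
    have "\<bar>Inf S\<bar> \<noteq> \<infinity>" using up lo by auto
    then show ?thesis using \<alpha> by (simp add: cond_sandwiched_def S_def[symmetric] ereal_real)
  qed
  show "cond_sandwiched \<alpha> \<rho> \<le> cond_vN \<rho>" using lo unfolding fin by simp
  show "- cond_sandwiched \<alpha> \<rho> \<le> 1 / (\<alpha> - 1) * ln (sandwiched_Q \<alpha> \<rho> (kron (mat 1) (ptr1 \<rho>)))"
    using up unfolding fin by simp
  fix e :: real assume e: "e > 0"
  have "Inf S < ereal (- cond_sandwiched \<alpha> \<rho> + e)" unfolding fin using e by simp
  then obtain x where x: "x \<in> S" "x < ereal (- cond_sandwiched \<alpha> \<rho> + e)" by (auto simp: Inf_less_iff)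
  then obtain \<sigma> where \<sigma>: "density \<sigma>" "x = sandwiched_div \<alpha> \<rho> (kron (mat 1 :: complex^'a^'a) \<sigma>)" unfolding S_def by blast
  have True: "\<forall>v. kron (mat 1 :: complex^'a^'a) \<sigma> *v v = 0 \<longrightarrow> \<rho> *v v = 0"
  proof (rule ccontr)
    assume n: "\<not> ?thesis"
    have "x = \<infinity>" unfolding \<sigma>(2) sandwiched_div_def if_not_P[OF n] ..
    then show False using x(2) by simp
  qed
  have "1 / (\<alpha> - 1) * ln (sandwiched_Q \<alpha> \<rho> (kron (mat 1) \<sigma>)) < - cond_sandwiched \<alpha> \<rho> + e"
    using x(2) unfolding \<sigma>(2) val[OF True] by simp
  with \<sigma>(1) True show "\<exists>\<sigma>. density \<sigma> \<and> (\<forall>v. kron (mat 1) \<sigma> *v v = 0 \<longrightarrow> \<rho> *v v = 0) \<and>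
      1 / (\<alpha> - 1) * ln (sandwiched_Q \<alpha> \<rho> (kron (mat 1) \<sigma>)) < - cond_sandwiched \<alpha> \<rho> + e" by blast
qed

text \<open>\<open>ln g + ln h\<close> is 0 at 1 with negative slope, hence negative just to the
  right of 1, and it dominates \<open>\<alpha> - 1\<close> times the negated sum of the
  entropies.\<close>

lemma cond_sandwiched_positive_near_one:
  fixes \<rho> :: "complex^('a::finite\<times>'e::finite)^('a\<times>'e)" and \<omega> :: "complex^('b::finite\<times>'c::finite)^('b\<times>'c)"
  assumes \<rho>: "density \<rho>" and \<omega>: "density \<omega>" and pos: "cond_vN \<rho> + cond_vN \<omega> > 0"
  shows "\<exists>\<alpha>. 1 < \<alpha> \<and> \<alpha> \<le> 2 \<and> cond_sandwiched \<alpha> \<rho> + cond_sandwiched \<alpha> \<omega> > 0"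
proof -
  have psd: "psd (kron (mat 1 :: complex^'a^'a) (ptr1 \<rho>))" "psd (kron (mat 1 :: complex^'b^'b) (ptr1 \<omega>))"
    using density_ptr1[OF \<rho>] density_ptr1[OF \<omega>] by (auto simp: density_def intro: psd_kron_mat_1)
  obtain g where g: "(g has_real_derivative - cond_vN \<rho>) (at 1)" "g 1 = 1"
    "\<And>\<alpha>. \<alpha> > 1 \<Longrightarrow> g \<alpha> > 0 \<and> ln (sandwiched_Q \<alpha> \<rho> (kron (mat 1) (ptr1 \<rho>))) \<le> ln (g \<alpha>)"
    using sandwiched_upper_bound[OF \<rho> psd(1) support_reduced[OF \<rho>]]
    unfolding cond_vN_rel_ent by auto
  obtain h where h: "(h has_real_derivative - cond_vN \<omega>) (at 1)" "h 1 = 1"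
    "\<And>\<alpha>. \<alpha> > 1 \<Longrightarrow> h \<alpha> > 0 \<and> ln (sandwiched_Q \<alpha> \<omega> (kron (mat 1) (ptr1 \<omega>))) \<le> ln (h \<alpha>)"
    using sandwiched_upper_bound[OF \<omega> psd(2) support_reduced[OF \<omega>]]
    unfolding cond_vN_rel_ent by auto
  have "((\<lambda>x. ln (g x) + ln (h x)) has_real_derivative (- cond_vN \<rho> + - cond_vN \<omega>)) (at 1)"
    using g(1,2) h(1,2) by (auto intro!: derivative_eq_intros)
  then obtain d where d: "d > 0" "\<And>x. 0 < x \<Longrightarrow> x < d \<Longrightarrow> ln (g (1 + x)) + ln (h (1 + x)) < ln (g 1) + ln (h 1)"
    using DERIV_neg_dec_right[of "\<lambda>x. ln (g x) + ln (h x)" _ 1] pos by force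
  \<comment> \<open>The minimum with 1 keeps \<open>1 + x\<close> within the range of
    \<alpha>.\<close>
  define x where "x = min 1 (d / 2)"
  have x: "0 < x" "x \<le> 1" "x < d" using d(1) by (auto simp: x_def)
  have \<alpha>: "1 + x > 1" using x by simp
  have "- cond_sandwiched (1 + x) \<rho> - cond_sandwiched (1 + x) \<omega> \<le> 1 / x * ln (g (1 + x)) + 1 / x * ln (h (1 + x))"
  proof -
    have "1 / x * ln (sandwiched_Q (1 + x) \<rho> (kron (mat 1) (ptr1 \<rho>))) \<le> 1 / x * ln (g (1 + x))"
      "1 / x * ln (sandwiched_Q (1 + x) \<omega> (kron (mat 1) (ptr1 \<omega>))) \<le> 1 / x * ln (h (1 + x))"
      using g(3)[OF \<alpha>] h(3)[OF \<alpha>] x by (intro mult_left_mono; simp)+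
    then show ?thesis
      using cond_sandwiched_characterization(2)[OF \<rho> \<alpha>] cond_sandwiched_characterization(2)[OF \<omega> \<alpha>] by simp
  qed
  also have "\<dots> = 1 / x * (ln (g (1 + x)) + ln (h (1 + x)))" by (simp add: distrib_left)
  also have "\<dots> < 0" using d(2)[OF x(1,3)] g(2) h(2) x by (simp add: mult_pos_neg divide_neg_pos)
  finally show ?thesis using x by (intro exI[of _ "1 + x"]) auto
qed

theorem theorem1p2:
  fixes T :: "complex^'a::finite^'a \<Rightarrow> complex^'c::finite^'c"
    and \<rho> :: "complex^('a \<times> 'e::finite)^('a \<times> 'e)"
    and \<mu> :: "(complex^'a^'a) measure"
  assumes "quantum_channel T"
    and "density \<rho>"
    and "haar_measure \<mu>"
  shows "(\<forall>\<alpha>\<in>{1..2}.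
      1/2 * (\<integral>U. trnorm (tensor_id T (kron U (mat 1) ** \<rho> ** cadj (kron U (mat 1)))
                 - kron (ptr1 (choi_state T)) (ptr1 \<rho>)) \<partial>\<mu>)
      \<le> exp ((1 - \<alpha>) / \<alpha> * (cond_sandwiched \<alpha> (choi_state T) + cond_sandwiched \<alpha> \<rho> + ln 3)))
    \<and> ((SUP \<alpha>\<in>{1..2::real}. (\<alpha> - 1) / \<alpha> * (cond_sandwiched \<alpha> \<rho> + cond_sandwiched \<alpha> (choi_state T))) > 0
      \<longleftrightarrow> cond_vN (choi_state T) + cond_vN \<rho> > 0)"
proof -
  interpret haar \<mu> by unfold_locales (rule assms)
  define \<omega> where "\<omega> = choi_state T"
  have \<omega>: "density \<omega>" unfolding \<omega>_def by (rule density_choi_state[OF assms(1)])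
  note \<rho> = assms(2)
  have "clinear_map T" using assms(1) by (simp add: quantum_channel_def)
  then have decouple: "tensor_id T (kron U (mat 1) ** \<rho> ** cadj (kron U (mat 1))) - kron (ptr1 \<omega>) (ptr1 \<rho>) = decouple \<omega> \<rho> U" for U
    by (simp add: tensor_id_eq_choi_map decouple_def twirl_def \<omega>_def)
  define I where "I = (\<integral>U. trnorm (decouple \<omega> \<rho> U) \<partial>\<mu>)"
  have main: "1/2 * I \<le> exp ((1 - \<alpha>) / \<alpha> * (cond_sandwiched \<alpha> \<omega> + cond_sandwiched \<alpha> \<rho> + ln 3))"
    if "1 \<le> \<alpha>" "\<alpha> \<le> 2" for \<alpha>
  proof (cases "\<alpha> = 1")
    \<comment> \<open>The exponent on the right vanishes, so the claim is that the integral is at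
      most 2.\<close>
    case True
    then show ?thesis using decoupling_bound_one[OF \<rho> \<omega>] by (simp add: I_def)
  next
    case False
    then have \<alpha>: "1 < \<alpha>" using that by simp
    define C where "C = exp ((1 - \<alpha>) / \<alpha> * (cond_sandwiched \<alpha> \<omega> + cond_sandwiched \<alpha> \<rho> + ln 3))"
    \<comment> \<open>Near-optimal \<sigma> and \<tau> lose \<open>e\<close> each, hence
      \<open>2 * e\<close>; the limit is taken afterwards.\<close>
    have bound: "1/2 * I \<le> C * exp ((\<alpha> - 1) / \<alpha> * (2 * e))" if e: "e > 0" for e
    proof -
      obtain \<sigma> where \<sigma>: "density \<sigma>" "\<And>v. kron (mat 1) \<sigma> *v v = 0 \<Longrightarrow> \<rho> *v v = 0"
        "1 / (\<alpha> - 1) * ln (sandwiched_Q \<alpha> \<rho> (kron (mat 1) \<sigma>)) < - cond_sandwiched \<alpha> \<rho> + e"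
        using cond_sandwiched_characterization(3)[OF \<rho> \<alpha> e] by blast
      obtain \<tau> where \<tau>: "density \<tau>" "\<And>v. kron (mat 1) \<tau> *v v = 0 \<Longrightarrow> \<omega> *v v = 0"
        "1 / (\<alpha> - 1) * ln (sandwiched_Q \<alpha> \<omega> (kron (mat 1) \<tau>)) < - cond_sandwiched \<alpha> \<omega> + e"
        using cond_sandwiched_characterization(3)[OF \<omega> \<alpha> e] by blast
      define x where "x = 1 / (\<alpha> - 1) * ln (sandwiched_Q \<alpha> \<rho> (kron (mat 1) \<sigma>))"
      define y where "y = 1 / (\<alpha> - 1) * ln (sandwiched_Q \<alpha> \<omega> (kron (mat 1) \<tau>))"
      have "1/2 * I \<le> exp (1 / \<alpha> * (ln (sandwiched_Q \<alpha> \<rho> (kron (mat 1) \<sigma>)) + ln (sandwiched_Q \<alpha> \<omega> (kron (mat 1) \<tau>))) - (\<alpha> - 1) / \<alpha> * ln 3)"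
        using decoupling_bound[OF \<rho> \<omega> \<sigma>(1) \<tau>(1) \<alpha> \<open>\<alpha> \<le> 2\<close> \<sigma>(2) \<tau>(2)]
        by (simp add: I_def)
      also have "1 / \<alpha> * (ln (sandwiched_Q \<alpha> \<rho> (kron (mat 1) \<sigma>)) + ln (sandwiched_Q \<alpha> \<omega> (kron (mat 1) \<tau>))) = (\<alpha> - 1) / \<alpha> * (x + y)"
      proof -
        have "(\<alpha> - 1) / \<alpha> * (1 / (\<alpha> - 1) * a) = 1 / \<alpha> * a" for a using \<alpha> by simp
        then show ?thesis by (simp only: x_def y_def distrib_left)
      qed
      also have "(\<alpha> - 1) / \<alpha> * (x + y) - (\<alpha> - 1) / \<alpha> * ln 3 = (\<alpha> - 1) / \<alpha> * (x + y - ln 3)"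
        by (simp add: right_diff_distrib)
      also have "exp \<dots> \<le> exp ((\<alpha> - 1) / \<alpha> * ((- cond_sandwiched \<alpha> \<rho> + e) + (- cond_sandwiched \<alpha> \<omega> + e) - ln 3))"
        using \<sigma>(3) \<tau>(3) \<alpha> unfolding x_def[symmetric] y_def[symmetric] exp_le_cancel_iff
        by (intro mult_left_mono) auto
      also have "(\<alpha> - 1) / \<alpha> * ((- cond_sandwiched \<alpha> \<rho> + e) + (- cond_sandwiched \<alpha> \<omega> + e) - ln 3)
          = (1 - \<alpha>) / \<alpha> * (cond_sandwiched \<alpha> \<omega> + cond_sandwiched \<alpha> \<rho> + ln 3) + (\<alpha> - 1) / \<alpha> * (2 * e)"
        using \<alpha> by (simp add: field_simps)
      finally show ?thesis unfolding C_def exp_add .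
    qed
    have "1/2 * I \<le> C * exp ((\<alpha> - 1) / \<alpha> * (2 * 0))"
    proof (rule tendsto_lowerbound)
      show "((\<lambda>e. C * exp ((\<alpha> - 1) / \<alpha> * (2 * e))) \<longlongrightarrow> C * exp ((\<alpha> - 1) / \<alpha> * (2 * 0))) (at_right 0)"
        by (intro tendsto_intros)
      show "eventually (\<lambda>e. 1/2 * I \<le> C * exp ((\<alpha> - 1) / \<alpha> * (2 * e))) (at_right 0)"
        using eventually_at_right_less[of "0::real"] by eventually_elim (rule bound)
    qed simp
    then show ?thesis by (simp add: C_def)
  qed
  define F where "F = (\<lambda>\<alpha>. (\<alpha> - 1) / \<alpha> * (cond_sandwiched \<alpha> \<rho> + cond_sandwiched \<alpha> \<omega>))"
  \<comment> \<open>Holds on the whole range, the prefactor being 0 at \<alpha> = 1. It gives one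
    direction of the equivalence and the boundedness of \<open>F\<close> for the other.\<close>
  have F_le: "F \<alpha> \<le> (\<alpha> - 1) / \<alpha> * (cond_vN \<rho> + cond_vN \<omega>)" if "1 \<le> \<alpha>" for \<alpha>
  proof (cases "\<alpha> = 1")
    case False
    then have \<alpha>: "1 < \<alpha>" using that by simp
    show ?thesis unfolding F_def
      using cond_sandwiched_characterization(1)[OF \<rho> \<alpha>] cond_sandwiched_characterization(1)[OF \<omega> \<alpha>] \<alpha>
      by (intro mult_left_mono) auto
  qed (simp add: F_def)
  have "(SUP \<alpha>\<in>{1..2}. F \<alpha>) > 0 \<longleftrightarrow> cond_vN \<omega> + cond_vN \<rho> > 0"
  proof
    assume sup: "(SUP \<alpha>\<in>{1..2}. F \<alpha>) > 0"
    show "cond_vN \<omega> + cond_vN \<rho> > 0"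
    proof (rule ccontr)
      assume neg: "\<not> ?thesis"
      have "(SUP \<alpha>\<in>{1..2}. F \<alpha>) \<le> 0"
      proof (rule cSUP_least)
        fix \<alpha> :: real assume "\<alpha> \<in> {1..2}"
        then have \<alpha>: "1 \<le> \<alpha>" by simp
        have "(\<alpha> - 1) / \<alpha> * (cond_vN \<rho> + cond_vN \<omega>) \<le> 0"
          using \<alpha> neg by (intro mult_nonneg_nonpos) auto
        with F_le[OF \<alpha>] show "F \<alpha> \<le> 0" by linarith
      qed simp
      then show False using sup by simp
    qed
  next
    assume "cond_vN \<omega> + cond_vN \<rho> > 0"
    then have pos: "cond_vN \<rho> + cond_vN \<omega> > 0" by simp
    obtain \<alpha> where \<alpha>: "1 < \<alpha>" "\<alpha> \<le> 2" "cond_sandwiched \<alpha> \<rho> + cond_sandwiched \<alpha> \<omega> > 0"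
      using cond_sandwiched_positive_near_one[OF \<rho> \<omega> pos] by blast
    \<comment> \<open>A real supremum dominates its members only once the set is known to be bounded
      above.\<close>
    have "bdd_above (F ` {1..2})"
    proof (rule bdd_aboveI2)
      fix \<beta> :: real assume \<beta>: "\<beta> \<in> {1..2}"
      have "(\<beta> - 1) / \<beta> * (cond_vN \<rho> + cond_vN \<omega>) \<le> 1 * (cond_vN \<rho> + cond_vN \<omega>)"
        using pos \<beta> by (intro mult_right_mono) auto
      then show "F \<beta> \<le> cond_vN \<rho> + cond_vN \<omega>" using F_le[of \<beta>] \<beta> by simp
    qed
    then have "F \<alpha> \<le> (SUP \<alpha>\<in>{1..2}. F \<alpha>)" using \<alpha> by (intro cSUP_upper) auto
    moreover have "F \<alpha> > 0" unfolding F_def using \<alpha> by (intro mult_pos_pos) auto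
    ultimately show "(SUP \<alpha>\<in>{1..2}. F \<alpha>) > 0" by linarith
  qed
  then show ?thesis
    unfolding decouple[unfolded \<omega>_def] using main unfolding I_def F_def \<omega>_def by simp
qed

end
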